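(* Let $\mathcal{S}$ be a co-doubly commuting submodule of $H^2(\mathbb{D}^2)$. Then $\operatorname{rank} \mathcal{S} = 1$ if and only if $\mathcal{S} = \Theta H^2(\mathbb{D}^2)$ for some one variable inner function $\Theta \in H^\infty(\mathbb{D})$, i.e. there is an inner function $\Theta \in H^\infty(\mathbb{D})$ such that either $\mathcal{S} = \{\Theta(z) f(z,w) : f \in H^2(\mathbb{D}^2)\}$ or $\mathcal{S} = \{\Theta(w) f(z,w) : f \in H^2(\mathbb{D}^2)\}$.
   Context: $\mathbb{D}$ is the open unit disc in $\mathbb{C}$ and $\mathbb{T}$ the unit circle. $H^2(\mathbb{D}^2)$ is the Hardy space over the bidisc (the Hilbert space of holomorphic functions on $\mathbb{D}^2$ with square summable power series coefficients), and $H^\infty(\mathbb{D})$ is the algebra of bounded holomorphic functions on $\mathbb{D}$. An inner function is a $\Theta \in H^\infty(\mathbb{D})$ whose boundary values satisfy $|\Theta| = 1$ a.e. on $\mathbb{T}$ (constants of modulus one are allowed). $M_z$ and $M_w$ are the operators of multiplication by the coordinate functions $z$ and $w$ on $H^2(\mathbb{D}^2)$. A submodule of $H^2(\mathbb{D}^2)$ is a closed subspace $\mathcal{S}$ with $M_z \mathcal{S} \subseteq \mathcal{S}$ and $M_w \mathcal{S} \subseteq \mathcal{S}$; a quotient module is a closed subspace $\mathcal{Q}$ such that $\mathcal{Q}^\perp$ is a submodule. A quotient module $\mathcal{Q}$ is doubly commuting if $C_z C_w^* = C_w^* C_z$, where $C_z = P_{\mathcal{Q}} M_z|_{\mathcal{Q}}$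 and $C_w = P_{\mathcal{Q}} M_w|_{\mathcal{Q}}$, with $P_{\mathcal{Q}}$ the orthogonal projection onto $\mathcal{Q}$. A submodule $\mathcal{S}$ is co-doubly commuting if the quotient module $\mathcal{S}^\perp$ is doubly commuting. Rank: for an $n$-tuple $T = (T_1, \ldots, T_n)$ of commuting bounded linear operators on a Hilbert space $\mathcal{H}$ and $E \subseteq \mathcal{H}$, let $[E]_T$ be the closed linear span of $\{T_1^{k_1}\cdots T_n^{k_n} f : f \in E,\ k_1,\ldots,k_n \in \mathbb{N}\}$, where $\mathbb{N}$ includes $0$. Then $\operatorname{rank}(T) = \min\{\# E : E \subseteq \mathcal{H},\ [E]_T = \mathcal{H}\}$. The rank of a submodule $\mathcal{S}$ of $H^2(\mathbb{D}^2)$ is $\operatorname{rank} \mathcal{S} = \operatorname{rank}(M_z|_{\mathcal{S}}, M_w|_{\mathcal{S}})$. *)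

theory Defs
  imports
    "HOL-Complex_Analysis.Complex_Analysis"
    "HOL-Library.Function_Algebras"
    "HOL-Library.Extended_Nat"
begin

section \<open>The Hardy space over the bidisc\<close>

definition bidisc :: "(complex \<times> complex) set" where
  "bidisc = ball 0 1 \<times> ball 0 1"

definition has_power_series :: "(complex \<times> complex \<Rightarrow> complex) \<Rightarrow> (nat \<times> nat \<Rightarrow> complex) \<Rightarrow> bool" where
  "has_power_series f a \<longleftrightarrow>
     (\<forall>(z, w) \<in> bidisc. ((\<lambda>(m, n). a (m, n) * z ^ m * w ^ n) has_sum f (z, w)) UNIV)"

text \<open>Functions on the bidisc are represented by total functions that vanish outside it, so that
  equality of the represented functions is equality in HOL. The holomorphic functions on the bidisc
  are exactly the sums of the (unconditionally) convergent power series on it.\<close>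

definition hardy2 :: "(complex \<times> complex \<Rightarrow> complex) set" where
  "hardy2 = {f. (\<forall>p. p \<notin> bidisc \<longrightarrow> f p = 0) \<and>
     (\<exists>a. has_power_series f a \<and> (\<lambda>p. (cmod (a p))\<^sup>2) summable_on UNIV)}"

definition hcoeff :: "(complex \<times> complex \<Rightarrow> complex) \<Rightarrow> nat \<times> nat \<Rightarrow> complex" where
  "hcoeff f = (THE a. has_power_series f a)"

definition hinner :: "(complex \<times> complex \<Rightarrow> complex) \<Rightarrow> (complex \<times> complex \<Rightarrow> complex) \<Rightarrow> complex" where
  "hinner f g = (\<Sum>\<^sub>\<infinity>p. hcoeff f p * cnj (hcoeff g p))"

definition hdist :: "(complex \<times> complex \<Rightarrow> complex) \<Rightarrow> (complex \<times> complex \<Rightarrow> complex) \<Rightarrow> real" where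
  "hdist f g = sqrt (Re (hinner (f - g) (f - g)))"

definition cscale :: "complex \<Rightarrow> (complex \<times> complex \<Rightarrow> complex) \<Rightarrow> complex \<times> complex \<Rightarrow> complex" where
  "cscale c f = (\<lambda>p. c * f p)"

lemma vector_space_cscale: "vector_space cscale"
  by standard (auto simp: cscale_def fun_eq_iff algebra_simps)

lemma powser_zero_imp_coeff_zero:
  fixes a :: "nat \<Rightarrow> complex"
  assumes "\<And>z. norm z < 1 \<Longrightarrow> (\<lambda>n. a n * z ^ n) sums 0"
  shows "a n = 0"
proof -
  have "conv_radius a \<ge> norm (1/2 :: complex)"
    using assms[of "1/2"] by (intro conv_radius_geI) (auto simp: sums_iff)
  moreover have "ereal (norm (1/2 :: complex)) > 0" by simp
  ultimately have "fps_conv_radius (Abs_fps a) > 0"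
    unfolding fps_conv_radius_def fps_nth_Abs_fps by (meson less_le_trans)
  moreover have "eventually (\<lambda>z::complex. z \<in> ball 0 1) (nhds 0)"
    by (intro eventually_nhds_in_open) auto
  then have "eventually (\<lambda>z. eval_fps (Abs_fps a) z = eval_fps 0 z) (nhds 0)"
    by eventually_elim (use assms in \<open>auto simp: eval_fps_def sums_iff\<close>)
  ultimately have "Abs_fps a = 0"
    by (intro eval_fps_eqD) auto
  then show ?thesis by (metis fps_nth_Abs_fps fps_zero_nth)
qed

lemma has_power_series_add:
  assumes "has_power_series f a" "has_power_series g b"
  shows "has_power_series (f + g) (a + b)"
  unfolding has_power_series_def
proof safe
  fix z w assume zw: "(z, w) \<in> bidisc"
  have "((\<lambda>(m, n). a (m, n) * z ^ m * w ^ n) has_sum f (z, w)) UNIV"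
    and "((\<lambda>(m, n). b (m, n) * z ^ m * w ^ n) has_sum g (z, w)) UNIV"
    using assms zw by (auto simp: has_power_series_def)
  from has_sum_add[OF this]
  show "((\<lambda>(m, n). (a + b) (m, n) * z ^ m * w ^ n) has_sum (f + g) (z, w)) UNIV"
    by (simp add: case_prod_unfold algebra_simps)
qed

lemma has_power_series_cscale:
  assumes "has_power_series f a"
  shows "has_power_series (cscale c f) (\<lambda>p. c * a p)"
  unfolding has_power_series_def
proof safe
  fix z w assume zw: "(z, w) \<in> bidisc"
  have "((\<lambda>(m, n). a (m, n) * z ^ m * w ^ n) has_sum f (z, w)) UNIV"
    using assms zw by (auto simp: has_power_series_def)
  from has_sum_cmult_right[OF this, of c]
  show "((\<lambda>(m, n). c * a (m, n) * z ^ m * w ^ n) has_sum cscale c f (z, w)) UNIV"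
    by (simp add: case_prod_unfold algebra_simps cscale_def)
qed

lemma has_power_series_diff:
  assumes "has_power_series f a" "has_power_series g b"
  shows "has_power_series (f - g) (a - b)"
proof -
  have "f - g = f + cscale (-1) g" "a - b = a + (\<lambda>p. (-1) * b p)"
    by (auto simp: fun_eq_iff cscale_def)
  then show ?thesis
    using has_power_series_add[OF assms(1) has_power_series_cscale[OF assms(2), of "-1"]] by metis
qed

lemma has_power_series_0: "has_power_series 0 (\<lambda>_. 0)"
  by (auto simp: has_power_series_def case_prod_unfold)

lemma has_power_series_zero:
  assumes "has_power_series 0 a"
  shows "a = 0"
proof -
  have "a (m, n) = 0" for m n
  proof -
    have row: "(\<Sum>\<^sub>\<infinity>n. a (m, n) * w ^ n) = 0" if w: "norm w < 1" for w m
    proof (rule powser_zero_imp_coeff_zero[of "\<lambda>m. \<Sum>\<^sub>\<infinity>n. a (m, n) * w ^ n"])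
      fix z :: complex assume z: "norm z < 1"
      have s: "((\<lambda>(m, n). a (m, n) * z ^ m * w ^ n) has_sum 0) (UNIV \<times> UNIV)"
        using assms z w by (auto simp: has_power_series_def bidisc_def)
      have sm: "(\<lambda>n. a (m, n) * z ^ m * w ^ n) summable_on UNIV" for m
        using summable_on_SigmaD1[OF has_sum_imp_summable[OF s]] by auto
      have eq: "(\<Sum>\<^sub>\<infinity>n. a (m, n) * z ^ m * w ^ n) = (\<Sum>\<^sub>\<infinity>n. a (m, n) * w ^ n) * z ^ m" for m
        by (subst infsum_cmult_left'[symmetric]) (simp add: algebra_simps)
      have "((\<lambda>m. \<Sum>\<^sub>\<infinity>n. a (m, n) * z ^ m * w ^ n) has_sum 0) UNIV"
        using s sm by (intro has_sum_SigmaD[OF s]) (auto intro: has_sum_infsum)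
      then show "(\<lambda>m. (\<Sum>\<^sub>\<infinity>n. a (m, n) * w ^ n) * z ^ m) sums 0"
        unfolding eq by (rule has_sum_imp_sums)
    qed
    show ?thesis
    proof (rule powser_zero_imp_coeff_zero[of "\<lambda>n. a (m, n)"])
      fix w :: complex assume w: "norm w < 1"
      have "((\<lambda>(m, n). a (m, n) * (1/2) ^ m * w ^ n) has_sum 0) (UNIV \<times> UNIV)"
        using assms w by (auto simp: has_power_series_def bidisc_def)
      from summable_on_SigmaD1[OF has_sum_imp_summable[OF this], of m]
      have "(\<lambda>n. (1/2) ^ m * (a (m, n) * w ^ n)) summable_on UNIV"
        by (simp add: algebra_simps)
      then have "(\<lambda>n. a (m, n) * w ^ n) summable_on UNIV"
        by (subst (asm) summable_on_cmult_right') auto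
      then show "(\<lambda>n. a (m, n) * w ^ n) sums 0"
        using row[OF w, of m] has_sum_infsum has_sum_imp_sums by metis
    qed
  qed
  then show ?thesis by (auto simp: fun_eq_iff)
qed

lemma has_power_series_unique:
  assumes "has_power_series f a" "has_power_series f b"
  shows "a = b"
  using has_power_series_zero[of "a - b"] has_power_series_diff[OF assms]
  by (auto simp: zero_fun_def fun_eq_iff)

lemma hcoeff_eq: "has_power_series f a \<Longrightarrow> hcoeff f = a"
  unfolding hcoeff_def using has_power_series_unique by blast

lemma hardy2_iff:
  "f \<in> hardy2 \<longleftrightarrow> (\<forall>p. p \<notin> bidisc \<longrightarrow> f p = 0) \<and> has_power_series f (hcoeff f) \<and>
     (\<lambda>p. (cmod (hcoeff f p))\<^sup>2) summable_on UNIV"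
  unfolding hardy2_def using hcoeff_eq by auto

lemma square_summable_add:
  fixes a b :: "'a \<Rightarrow> complex"
  assumes "(\<lambda>p. (cmod (a p))\<^sup>2) summable_on UNIV" "(\<lambda>p. (cmod (b p))\<^sup>2) summable_on UNIV"
  shows "(\<lambda>p. (cmod (a p + b p))\<^sup>2) summable_on UNIV"
    and "sqrt (\<Sum>\<^sub>\<infinity>p. (cmod (a p + b p))\<^sup>2)
      \<le> sqrt (\<Sum>\<^sub>\<infinity>p. (cmod (a p))\<^sup>2) + sqrt (\<Sum>\<^sub>\<infinity>p. (cmod (b p))\<^sup>2)" (is "_ \<le> ?A + ?B")
proof -
  have fin: "(\<Sum>p\<in>F. (cmod (a p + b p))\<^sup>2) \<le> (?A + ?B)\<^sup>2" if F: "finite F" for F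
  proof -
    have "L2_set (\<lambda>p. cmod (a p + b p)) F \<le> L2_set (\<lambda>p. cmod (a p) + cmod (b p)) F"
      by (intro L2_set_mono) (auto simp: norm_triangle_ineq)
    also have "\<dots> \<le> L2_set (\<lambda>p. cmod (a p)) F + L2_set (\<lambda>p. cmod (b p)) F"
      by (rule L2_set_triangle_ineq)
    also have "\<dots> \<le> ?A + ?B"
      unfolding L2_set_def using F assms
      by (intro add_mono real_sqrt_le_mono finite_sum_le_infsum) auto
    finally have "(L2_set (\<lambda>p. cmod (a p + b p)) F)\<^sup>2 \<le> (?A + ?B)\<^sup>2"
      by (intro power_mono) (auto simp: L2_set_nonneg)
    then show ?thesis by (simp add: L2_set_def sum_nonneg)
  qed
  show s: "(\<lambda>p. (cmod (a p + b p))\<^sup>2) summable_on UNIV"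
    by (intro nonneg_bdd_above_summable_on) (auto intro!: bdd_aboveI2 fin)
  have "(\<Sum>\<^sub>\<infinity>p. (cmod (a p + b p))\<^sup>2) \<le> (?A + ?B)\<^sup>2"
    using s fin by (intro infsum_le_finite_sums) auto
  moreover have "?A + ?B \<ge> 0" by (intro add_nonneg_nonneg real_sqrt_ge_zero infsum_nonneg) auto
  ultimately show "sqrt (\<Sum>\<^sub>\<infinity>p. (cmod (a p + b p))\<^sup>2) \<le> ?A + ?B"
    by (intro real_le_lsqrt) (auto intro: infsum_nonneg)
qed

lemma subspace_hardy2: "module.subspace cscale hardy2"
proof -
  interpret vector_space cscale by (rule vector_space_cscale)
  show ?thesis
    unfolding subspace_def
  proof (intro conjI ballI allI)
    show "0 \<in> hardy2"
      unfolding hardy2_def using has_power_series_0 by (auto intro!: exI[of _ "\<lambda>_. 0"])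
  next
    fix f g assume fg: "f \<in> hardy2" "g \<in> hardy2"
    then show "f + g \<in> hardy2"
      using square_summable_add(1)[of "hcoeff f" "hcoeff g"]
        has_power_series_add[of f "hcoeff f" g "hcoeff g"]
      unfolding hardy2_iff[of f] hardy2_iff[of g] unfolding hardy2_def
      by (auto simp: plus_fun_def)
  next
    fix c f assume f: "f \<in> hardy2"
    then have "(\<lambda>p. (cmod (c * hcoeff f p))\<^sup>2) summable_on UNIV"
      unfolding hardy2_iff by (auto simp: norm_mult power_mult_distrib intro: summable_on_cmult_right)
    then show "cscale c f \<in> hardy2"
      using f has_power_series_cscale[of f "hcoeff f" c]
      unfolding hardy2_iff[of f] unfolding hardy2_def
      by (auto simp: cscale_def)
  qed
qed

lemma hdist_eq: "hdist f g = sqrt (\<Sum>\<^sub>\<infinity>p. (cmod (hcoeff (f - g) p))\<^sup>2)"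
proof -
  have "hinner h h = of_real (\<Sum>\<^sub>\<infinity>p. (cmod (hcoeff h p))\<^sup>2)" for h
    
  proof (cases "(\<lambda>p. (cmod (hcoeff h p))\<^sup>2) summable_on UNIV")
    case True
    then show ?thesis
      unfolding hinner_def complex_norm_square[symmetric]
      by (intro infsumI has_sum_of_real has_sum_infsum)
  next
    case False
    then have "\<not> (\<lambda>p. complex_of_real ((cmod (hcoeff h p))\<^sup>2)) summable_on UNIV"
      using summable_on_Re[of "\<lambda>p. complex_of_real ((cmod (hcoeff h p))\<^sup>2)" UNIV] by auto
    with False show ?thesis
      unfolding hinner_def complex_norm_square[symmetric] by (simp add: infsum_not_exists)
  qed
  then show ?thesis by (simp add: hdist_def)
qed

lemma Metric_space_hardy2: "Metric_space hardy2 hdist"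
proof
  interpret vector_space cscale by (rule vector_space_cscale)
  show "0 \<le> hdist f g" for f g
    unfolding hdist_eq by (auto intro: infsum_nonneg)
  show "hdist f g = hdist g f" for f g
  proof -
    have neg: "has_power_series (- h) (- a)" if "has_power_series h a" for h a
      using has_power_series_cscale[OF that, of "-1"]
      by (simp add: cscale_def fun_Compl_def)
    have "cmod (hcoeff (- h) p) = cmod (hcoeff h p)" for h p
    proof (cases "\<exists>a. has_power_series h a")
      case True
      then show ?thesis using neg hcoeff_eq by fastforce
    next
      case False
      then have "\<nexists>a. has_power_series (- h) a" using neg[of "- h"] by auto
      then have "hcoeff (- h) = hcoeff h" using False by (simp add: hcoeff_def)
      then show ?thesis by simp
    qed
    then show ?thesis unfolding hdist_eq by (metis minus_diff_eq)
  qed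
  show "hdist f g = 0 \<longleftrightarrow> f = g" if fg: "f \<in> hardy2" "g \<in> hardy2" for f g
  proof
    assume "hdist f g = 0"
    have h: "f - g \<in> hardy2" using subspace_hardy2 fg by (rule subspace_diff)
    have "hcoeff (f - g) p = 0" for p
      using \<open>hdist f g = 0\<close> h nonneg_infsum_le_0D[of "\<lambda>p. (cmod (hcoeff (f - g) p))\<^sup>2" UNIV p]
      unfolding hdist_eq hardy2_iff by simp
    then have "hcoeff (f - g) = (\<lambda>_. 0)" by auto
    then have "has_power_series (f - g) (\<lambda>_. 0)" and v: "\<forall>p. p \<notin> bidisc \<longrightarrow> (f - g) p = 0"
      using h unfolding hardy2_iff by auto
    have "(f - g) (z, w) = 0" if "(z, w) \<in> bidisc" for z w
    proof (rule has_sum_unique)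
      show "((\<lambda>(m, n). 0 * z ^ m * w ^ n) has_sum (f - g) (z, w)) (UNIV :: (nat \<times> nat) set)"
        using \<open>has_power_series (f - g) (\<lambda>_. 0)\<close> that by (auto simp: has_power_series_def)
    qed (simp add: case_prod_unfold)
    with v have "f - g = 0" by (fastforce simp: fun_eq_iff)
    then show "f = g" by simp
  next
    assume "f = g"
    then show "hdist f g = 0" using hcoeff_eq[OF has_power_series_0] by (simp add: hdist_eq)
  qed
  show "hdist f h \<le> hdist f g + hdist g h" if "f \<in> hardy2" "g \<in> hardy2" "h \<in> hardy2" for f g h
  proof -
    have 1: "f - g \<in> hardy2" "g - h \<in> hardy2"
      using subspace_hardy2 that by (auto intro: subspace_diff)
    then have "has_power_series ((f - g) + (g - h)) (hcoeff (f - g) + hcoeff (g - h))"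
      unfolding hardy2_iff by (intro has_power_series_add) auto
    then have "hcoeff ((f - g) + (g - h)) = hcoeff (f - g) + hcoeff (g - h)"
      by (rule hcoeff_eq)
    moreover have "(f - g) + (g - h) = f - h" by simp
    ultimately have "hcoeff (f - h) = (\<lambda>p. hcoeff (f - g) p + hcoeff (g - h) p)"
      by (simp only: plus_fun_def)
    then show ?thesis
      using 1 square_summable_add(2)[of "hcoeff (f - g)" "hcoeff (g - h)"]
      unfolding hdist_eq hardy2_iff by simp
  qed
qed

definition closed_subspace :: "(complex \<times> complex \<Rightarrow> complex) set \<Rightarrow> bool" where
  "closed_subspace V \<longleftrightarrow> V \<subseteq> hardy2 \<and> module.subspace cscale V \<and>
     closedin (Metric_space.mtopology hardy2 hdist) V"

definition orth_compl :: "(complex \<times> complex \<Rightarrow> complex) set \<Rightarrow> (complex \<times> complex \<Rightarrow> complex) set" where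
  "orth_compl V = {f \<in> hardy2. \<forall>g\<in>V. hinner f g = 0}"

definition orth_proj ::
  "(complex \<times> complex \<Rightarrow> complex) set \<Rightarrow> (complex \<times> complex \<Rightarrow> complex) \<Rightarrow> complex \<times> complex \<Rightarrow> complex" where
  "orth_proj V f = (THE g. g \<in> V \<and> (\<forall>h\<in>V. hinner (f - g) h = 0))"

text \<open>The adjoint, with respect to \<^const>\<open>hinner\<close>, of an operator on the Hilbert space \<open>V\<close>.\<close>

definition adjoint_on ::
  "(complex \<times> complex \<Rightarrow> complex) set \<Rightarrow>
   ((complex \<times> complex \<Rightarrow> complex) \<Rightarrow> complex \<times> complex \<Rightarrow> complex) \<Rightarrow>
   (complex \<times> complex \<Rightarrow> complex) \<Rightarrow> complex \<times> complex \<Rightarrow> complex" where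
  "adjoint_on V T f = (THE g. g \<in> V \<and> (\<forall>h\<in>V. hinner (T h) f = hinner h g))"

definition M_z :: "(complex \<times> complex \<Rightarrow> complex) \<Rightarrow> complex \<times> complex \<Rightarrow> complex" where
  "M_z f = (\<lambda>(z, w). z * f (z, w))"

definition M_w :: "(complex \<times> complex \<Rightarrow> complex) \<Rightarrow> complex \<times> complex \<Rightarrow> complex" where
  "M_w f = (\<lambda>(z, w). w * f (z, w))"


section \<open>Submodules, quotient modules and rank\<close>

definition submodule :: "(complex \<times> complex \<Rightarrow> complex) set \<Rightarrow> bool" where
  "submodule S \<longleftrightarrow> closed_subspace S \<and> M_z ` S \<subseteq> S \<and> M_w ` S \<subseteq> S"

definition quotient_module :: "(complex \<times> complex \<Rightarrow> complex) set \<Rightarrow> bool" where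
  "quotient_module Q \<longleftrightarrow> closed_subspace Q \<and> submodule (orth_compl Q)"

definition compression ::
  "(complex \<times> complex \<Rightarrow> complex) set \<Rightarrow>
   ((complex \<times> complex \<Rightarrow> complex) \<Rightarrow> complex \<times> complex \<Rightarrow> complex) \<Rightarrow>
   (complex \<times> complex \<Rightarrow> complex) \<Rightarrow> complex \<times> complex \<Rightarrow> complex" where
  "compression Q T f = orth_proj Q (T f)"

definition doubly_commuting :: "(complex \<times> complex \<Rightarrow> complex) set \<Rightarrow> bool" where
  "doubly_commuting Q \<longleftrightarrow> quotient_module Q \<and>
     (let C_z = compression Q M_z; C_w = compression Q M_w
      in \<forall>f\<in>Q. C_z (adjoint_on Q C_w f) = adjoint_on Q C_w (C_z f))"

definition co_doubly_commuting :: "(complex \<times> complex \<Rightarrow> complex) set \<Rightarrow> bool" where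
  "co_doubly_commuting S \<longleftrightarrow> submodule S \<and> doubly_commuting (orth_compl S)"

text \<open>\<open>[E]\<^sub>T\<close> for a pair \<open>T = (T\<^sub>1, T\<^sub>2)\<close> of operators on the Hilbert space \<open>H \<subseteq> hardy2\<close>;
  the closure is taken in \<open>H\<close>.\<close>

definition generated ::
  "(complex \<times> complex \<Rightarrow> complex) set \<Rightarrow>
   ((complex \<times> complex \<Rightarrow> complex) \<Rightarrow> complex \<times> complex \<Rightarrow> complex) \<Rightarrow>
   ((complex \<times> complex \<Rightarrow> complex) \<Rightarrow> complex \<times> complex \<Rightarrow> complex) \<Rightarrow>
   (complex \<times> complex \<Rightarrow> complex) set \<Rightarrow> (complex \<times> complex \<Rightarrow> complex) set" where
  "generated H T1 T2 E =
     Metric_space.mtopology H hdist closure_of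
       module.span cscale {(T1 ^^ k) ((T2 ^^ l) f) | k l f. f \<in> E}"

text \<open>The infimum of a nonempty set of extended naturals is its minimum; infinite cardinalities are
  not distinguished.\<close>

definition pair_rank ::
  "(complex \<times> complex \<Rightarrow> complex) set \<Rightarrow>
   ((complex \<times> complex \<Rightarrow> complex) \<Rightarrow> complex \<times> complex \<Rightarrow> complex) \<Rightarrow>
   ((complex \<times> complex \<Rightarrow> complex) \<Rightarrow> complex \<times> complex \<Rightarrow> complex) \<Rightarrow> enat" where
  "pair_rank H T1 T2 =
     (INF E \<in> {E. E \<subseteq> H \<and> generated H T1 T2 E = H}. if finite E then enat (card E) else \<infinity>)"

definition submodule_rank :: "(complex \<times> complex \<Rightarrow> complex) set \<Rightarrow> enat" where
  "submodule_rank S = pair_rank S M_z M_w"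


section \<open>Inner functions\<close>

text \<open>Boundary values are radial limits; by Fatou's theorem these exist almost everywhere for bounded
  holomorphic functions. The circle is parametrised by \<open>t \<mapsto> cis t\<close>.\<close>

definition inner_function :: "(complex \<Rightarrow> complex) \<Rightarrow> bool" where
  "inner_function \<Theta> \<longleftrightarrow> \<Theta> holomorphic_on ball 0 1 \<and> bounded (\<Theta> ` ball 0 1) \<and>
     (AE t in lebesgue_on {0..2*pi}.
        \<exists>b. ((\<lambda>r. \<Theta> (of_real r * cis t)) \<longlongrightarrow> b) (at_left 1) \<and> cmod b = 1)"

end

theory Submission
  imports Defs
begin

text \<open>Taking power series coefficients identifies \<open>H\<^sup>2\<close> of the bidisc with the square summable families on
  \<open>\<nat> \<times> \<nat>\<close>, and multiplication by \<open>z\<close> and \<open>w\<close> with the two coordinate shifts.  All operator theory is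
  done in that coefficient space.

  Let \<open>S\<close> be co-doubly commuting with orthogonal complement \<open>Q\<close>.  Let \<open>V\<^sub>1\<close> consist of those \<open>f\<close> in \<open>S\<close> for
  which every \<open>(M\<^sub>w\<^sup>*)\<^sup>n f\<close> lies in \<open>S\<close>, and let \<open>V\<^sub>2\<close> be defined in the same way with \<open>M\<^sub>z\<close>.  If \<open>C\<^sub>z\<close> commutes with
  \<open>C\<^sub>w\<^sup>*\<close>, then \<open>M\<^sub>z Q \<subseteq> Q + V\<^sub>1\<close>, so \<open>Q + V\<^sub>1\<close> is invariant under \<open>M\<^sub>z\<close>; passing to
  orthogonal complements, the part of \<open>S\<close> orthogonal to \<open>V\<^sub>1\<close> lies in \<open>V\<^sub>2\<close> (\<open>orthogonal_reducing_core_in_reducing_core\<close>).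
  So \<open>S = V\<^sub>1 + V\<^sub>2\<close> and the two projections commute.  A Wold argument in two variables (\<open>beurling\<close>) shows
  that a nonzero \<open>V\<^sub>1\<close> is \<open>\<phi>(z) H\<^sup>2\<close> and a nonzero \<open>V\<^sub>2\<close> is \<open>\<psi>(w) H\<^sup>2\<close>, with \<open>\<phi>\<close> and \<open>\<psi>\<close> inner.

  Now let \<open>S\<close> be generated by one \<open>f\<close>, and suppose that neither \<open>V\<^sub>1\<close> nor \<open>V\<^sub>2\<close> is all of \<open>S\<close>.  Both are
  nonzero, and with \<open>\<Phi> = \<phi>\<^sup>2 \<psi>\<^sup>2\<close> the Hankel form \<open>N(x, y) = \<langle>z w x y, \<Phi>\<rangle>\<close> is bounded and symmetric, satisfies
  \<open>N(p x, y) = N(x, p y)\<close> for polynomials \<open>p\<close>, and vanishes on \<open>V\<^sub>1 \<times> V\<^sub>1\<close> and on \<open>V\<^sub>2 \<times> V\<^sub>2\<close>.  Hence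
  \<open>\<omega>(g, h) = N(P\<^sub>1 g - P\<^sub>2 g, h)\<close> with the projections \<open>P\<^sub>1\<close>, \<open>P\<^sub>2\<close> onto \<open>V\<^sub>1\<close>, \<open>V\<^sub>2\<close>
  is an alternating form on \<open>S\<close> for which multiplication by polynomials is
  symmetric.  Such a form is zero at all \<open>(p f, q f)\<close>, so it is zero on \<open>S\<close>.  But
  \<open>\<omega>(z\<^sup>i w\<^sup>j \<phi>, \<psi>) = \<langle>z\<^sup>i\<^sup>+\<^sup>1 w\<^sup>j\<^sup>+\<^sup>1, \<phi> \<psi>\<rangle>\<close>, so \<open>\<phi>\<close> or \<open>\<psi>\<close> is constant, which forces one of \<open>V\<^sub>1\<close>, \<open>V\<^sub>2\<close> to be
  everything.  Therefore \<open>S = V\<^sub>1\<close> or \<open>S = V\<^sub>2\<close> (\<open>cyclic_structure\<close>).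

  Conversely, \<open>\<Theta>(z) H\<^sup>2\<close> is invariant under \<open>M\<^sub>w\<^sup>*\<close>, so \<open>beurling\<close> rewrites it as \<open>\<xi> H\<^sup>2\<close> where
  multiplication by \<open>\<xi>\<close> is isometric; then polynomial multiples of \<open>\<xi>\<close> are dense.

  What remains is that the one-variable vectors produced by \<open>beurling\<close> are inner functions in the sense of
  radial limits, and this rests on Fatou's theorem.  Centred averages of the boundary values of \<open>|f|\<^sup>2\<close> dominate
  \<open>|f|\<^sup>2\<close> along radii, because the Poisson kernel decreases away from its peak; the Vitali covering lemma
  turns this into a weak type estimate; and splitting off a polynomial leaves a function whose radial
  oscillation is small outside a small set (\<open>fatou_radial_limits\<close>).  Parseval's identity then forces the limits
  to have modulus one (\<open>inner_functionI\<close>).\<close>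

section \<open>The Hilbert space of square summable families\<close>

text \<open>Type classes only know real scalars, so the real part of the complex inner product \<open>cinner\<close> is the
  registered inner product, and complex scalar multiplication is a constant of its own.\<close>

typedef 'i ell2 = "{x :: 'i \<Rightarrow> complex. (\<lambda>i. (cmod (x i))\<^sup>2) summable_on UNIV}"
  morphisms coef Abs_ell2
  by (rule exI[of _ "\<lambda>_. 0"]) simp

setup_lifting type_definition_ell2

lemma square_summable_cmult:
  assumes "(\<lambda>i. (cmod (x i))\<^sup>2) summable_on A"
  shows "(\<lambda>i. (cmod (c * x i))\<^sup>2) summable_on A"
  using summable_on_cmult_right[OF assms, of "(cmod c)\<^sup>2"] by (simp add: norm_mult power_mult_distrib)

lemma square_summable_mult:
  fixes x y :: "'i \<Rightarrow> complex"
  assumes "(\<lambda>i. (cmod (x i))\<^sup>2) summable_on UNIV" "(\<lambda>i. (cmod (y i))\<^sup>2) summable_on UNIV"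
  shows "(\<lambda>i. norm (x i * cnj (y i))) summable_on UNIV"
proof (rule summable_on_comparison_test)
  show "(\<lambda>i. (cmod (x i))\<^sup>2 + (cmod (y i))\<^sup>2) summable_on UNIV"
    using assms by (rule summable_on_add)
  show "cmod (x i * cnj (y i)) \<le> (cmod (x i))\<^sup>2 + (cmod (y i))\<^sup>2" for i
  proof -
    have "2 * (cmod (x i) * cmod (y i)) \<le> (cmod (x i))\<^sup>2 + (cmod (y i))\<^sup>2"
      using sum_squares_bound[of "cmod (x i)" "cmod (y i)"] by simp
    moreover have "0 \<le> cmod (x i) * cmod (y i)" by simp
    ultimately show ?thesis unfolding norm_mult complex_mod_cnj by linarith
  qed
qed auto

instantiation ell2 :: (type) real_vector
begin
lift_definition zero_ell2 :: "'a ell2" is "\<lambda>_. 0" by simp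
lift_definition plus_ell2 :: "'a ell2 \<Rightarrow> 'a ell2 \<Rightarrow> 'a ell2" is "\<lambda>x y i. x i + y i"
  by (rule square_summable_add)
lift_definition uminus_ell2 :: "'a ell2 \<Rightarrow> 'a ell2" is "\<lambda>x i. - x i" by simp
lift_definition minus_ell2 :: "'a ell2 \<Rightarrow> 'a ell2 \<Rightarrow> 'a ell2" is "\<lambda>x y i. x i - y i"
  subgoal for x y using square_summable_add(1)[of x "\<lambda>i. - y i"] by simp
  done
lift_definition scaleR_ell2 :: "real \<Rightarrow> 'a ell2 \<Rightarrow> 'a ell2" is "\<lambda>r x i. of_real r * x i"
  by (rule square_summable_cmult)
instance
  by standard (transfer; simp add: algebra_simps fun_eq_iff)+
end

lift_definition scaleC :: "complex \<Rightarrow> 'i ell2 \<Rightarrow> 'i ell2" (infixr "*\<^sub>C" 75) is "\<lambda>c x i. c * x i"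
  by (rule square_summable_cmult)

lift_definition cinner :: "'i ell2 \<Rightarrow> 'i ell2 \<Rightarrow> complex" is "\<lambda>x y. \<Sum>\<^sub>\<infinity>i. x i * cnj (y i)" .

global_interpretation cvs: vector_space "scaleC :: complex \<Rightarrow> 'i ell2 \<Rightarrow> 'i ell2"
  by standard (transfer; simp add: algebra_simps fun_eq_iff)+

lemma coef_simps [simp]:
  "coef 0 i = 0" "coef (x + y) i = coef x i + coef y i" "coef (x - y) i = coef x i - coef y i"
  "coef (- x) i = - coef x i" "coef (c *\<^sub>C x) i = c * coef x i" "coef (r *\<^sub>R x) i = of_real r * coef x i"
  by (transfer; simp)+

lemma ell2_eqI: "(\<And>i. coef x i = coef y i) \<Longrightarrow> x = y"
  by (metis coef_inject ext)

lemma scaleR_scaleC: "r *\<^sub>R x = of_real r *\<^sub>C (x :: 'i ell2)"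
  by (rule ell2_eqI) simp

lemma square_summable_coef: "(\<lambda>i. (cmod (coef x i))\<^sup>2) summable_on UNIV"
  using coef[of x] by simp

lemma cinner_eq_infsum: "cinner x y = (\<Sum>\<^sub>\<infinity>i. coef x i * cnj (coef y i))"
  by transfer simp

lemma summable_cinner: "(\<lambda>i. coef x i * cnj (coef y i)) summable_on UNIV"
  by (rule abs_summable_summable, rule square_summable_mult) (rule square_summable_coef)+

lemma cinner_add_left: "cinner (x + y) z = cinner x z + cinner y z"
  using infsum_add[OF summable_cinner[of x z] summable_cinner[of y z]] by (simp add: cinner_eq_infsum algebra_simps)

lemma cinner_zero_left [simp]: "cinner 0 y = 0"
  by (simp add: cinner_eq_infsum)

lemma cinner_scaleC_left [simp]: "cinner (c *\<^sub>C x) y = c * cinner x y"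
  by (simp add: cinner_eq_infsum mult.assoc infsum_cmult_right')

lemma cnj_cinner: "cnj (cinner x y) = cinner y x"
  by (simp add: cinner_eq_infsum mult.commute flip: infsum_cnj)

lemma cinner_scaleC_right [simp]: "cinner x (c *\<^sub>C y) = cnj c * cinner x y"
  by (metis cinner_scaleC_left cnj_cinner complex_cnj_mult)

lemma cinner_add_right: "cinner x (y + z) = cinner x y + cinner x z"
  by (metis cinner_add_left cnj_cinner complex_cnj_add)

lemma cinner_self: "cinner x x = of_real (\<Sum>\<^sub>\<infinity>i. (cmod (coef x i))\<^sup>2)"
  unfolding cinner_eq_infsum complex_norm_square[symmetric]
  by (intro infsumI has_sum_of_real has_sum_infsum square_summable_coef)

instantiation ell2 :: (type) real_inner
begin
definition inner_ell2 :: "'a ell2 \<Rightarrow> 'a ell2 \<Rightarrow> real" where "inner_ell2 x y = Re (cinner x y)"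
definition norm_ell2 :: "'a ell2 \<Rightarrow> real" where "norm_ell2 x = sqrt (inner x x)"
definition dist_ell2 :: "'a ell2 \<Rightarrow> 'a ell2 \<Rightarrow> real" where "dist_ell2 x y = norm (x - y)"
definition uniformity_ell2 :: "('a ell2 \<times> 'a ell2) filter"
  where "uniformity_ell2 = (INF e\<in>{0<..}. principal {(x, y). dist x y < e})"
definition open_ell2 :: "'a ell2 set \<Rightarrow> bool"
  where "open_ell2 U \<longleftrightarrow> (\<forall>x\<in>U. \<forall>\<^sub>F (x', y) in uniformity. x' = x \<longrightarrow> y \<in> U)"
definition sgn_ell2 :: "'a ell2 \<Rightarrow> 'a ell2" where "sgn_ell2 x = x /\<^sub>R norm x"
instance
proof
  fix x y z :: "'a ell2" and r :: real
  show "inner x y = inner y x"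
    unfolding inner_ell2_def by (metis cnj_cinner complex_cnj(1) complex.sel(1) cnj.simps(1))
  show "inner (x + y) z = inner x z + inner y z" by (simp add: inner_ell2_def cinner_add_left)
  show "inner (r *\<^sub>R x) y = r * inner x y" by (simp add: inner_ell2_def scaleR_scaleC)
  show "0 \<le> inner x x" by (simp add: inner_ell2_def cinner_self infsum_nonneg)
  show "inner x x = 0 \<longleftrightarrow> x = 0"
  proof
    assume "inner x x = 0"
    then have "(cmod (coef x i))\<^sup>2 = 0" for i
      using nonneg_infsum_le_0D[OF _ square_summable_coef[of x], of i] by (simp add: inner_ell2_def cinner_self)
    then show "x = 0" by (intro ell2_eqI) simp
  qed (simp add: inner_ell2_def cinner_self)
qed (simp_all only: norm_ell2_def dist_ell2_def uniformity_ell2_def open_ell2_def sgn_ell2_def)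
end

lemma cinner_self_norm: "cinner x x = of_real ((norm x)\<^sup>2)"
  by (simp add: norm_ell2_def inner_ell2_def cinner_self infsum_nonneg)

lemma norm_ell2_sum: "(norm x)\<^sup>2 = (\<Sum>\<^sub>\<infinity>i. (cmod (coef x i))\<^sup>2)"
  using cinner_self_norm[of x] cinner_self[of x] by (metis of_real_eq_iff)

lemma norm_scaleC [simp]: "norm (c *\<^sub>C x) = cmod c * norm (x :: 'i ell2)"
proof -
  have "(norm (c *\<^sub>C x))\<^sup>2 = (cmod c * norm x)\<^sup>2"
    by (simp add: norm_ell2_sum norm_mult power_mult_distrib infsum_cmult_right')
  then show ?thesis by (simp add: power2_eq_iff_nonneg)
qed

text \<open>Rotating \<open>x\<close> by a unimodular constant makes \<open>cinner x y\<close> nonnegative, which reduces the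
  inequality to the real Cauchy-Schwarz inequality.\<close>

lemma norm_cinner_le: "cmod (cinner x y) \<le> norm x * norm y"
proof -
  define c where "c = cnj (sgn (cinner x y))"
  have c: "cmod c \<le> 1" by (simp add: c_def norm_sgn)
  have "cinner (c *\<^sub>C x) y = of_real (cmod (cinner x y))"
    using complex_norm_square[of "cinner x y"]
    by (cases "cinner x y = 0") (simp_all add: c_def sgn_eq field_simps power2_eq_square)
  then have "cmod (cinner x y) = inner (c *\<^sub>C x) y" by (simp add: inner_ell2_def)
  also have "\<dots> \<le> norm (c *\<^sub>C x) * norm y" by (rule norm_cauchy_schwarz)
  also have "\<dots> \<le> norm x * norm y" using c by (auto intro!: mult_right_mono mult_left_le_one_le)
  finally show ?thesis .
qed

lemma bounded_bilinear_cinner: "bounded_bilinear (cinner :: 'i ell2 \<Rightarrow> _)"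
  by standard (auto simp: cinner_add_left cinner_add_right scaleR_scaleC scaleR_conv_of_real
      intro!: exI[of _ 1] norm_cinner_le)

interpretation cinner: bounded_bilinear "cinner :: 'i ell2 \<Rightarrow> _"
  by (rule bounded_bilinear_cinner)

lemmas cinner_simps = cinner.add_left cinner.add_right cinner.diff_left cinner.diff_right cinner.minus_left
  cinner.minus_right cinner.zero_left cinner.zero_right

lemma bounded_linear_scaleC: "bounded_linear (\<lambda>x :: 'i ell2. c *\<^sub>C x)"
  by (rule bounded_linear_intro[of _ "cmod c"])
     (auto simp: cvs.scale_right_distrib scaleR_scaleC mult.commute)

lift_definition delta :: "'i \<Rightarrow> 'i ell2" is "\<lambda>k i. if i = k then 1 else 0"
  subgoal for k by (rule finite_nonzero_values_imp_summable_on) (auto intro: finite_subset[of _ "{k}"])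
  done

lemma coef_delta [simp]: "coef (delta k) i = (if i = k then 1 else 0)"
  by transfer simp

lemma cinner_delta_right [simp]: "cinner x (delta k) = coef x k"
proof -
  have "cinner x (delta k) = (\<Sum>\<^sub>\<infinity>i\<in>{k}. coef x i)"
    unfolding cinner_eq_infsum by (intro infsum_cong_neutral) auto
  then show ?thesis by simp
qed

lemma cinner_delta_left [simp]: "cinner (delta k) x = cnj (coef x k)"
  by (metis cinner_delta_right cnj_cinner)

instance ell2 :: (type) complete_space
proof
  fix X :: "nat \<Rightarrow> 'a ell2" assume X: "Cauchy X"
  have "Cauchy (\<lambda>n. coef (X n) i)" for i
    using bounded_linear.Cauchy[OF cinner.bounded_linear_left X, of "delta i"] by simp
  then have "\<forall>i. \<exists>l. (\<lambda>n. coef (X n) i) \<longlonglongrightarrow> l"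
    by (simp add: Cauchy_convergent_iff convergent_def)
  then obtain l where l: "\<And>i. (\<lambda>n. coef (X n) i) \<longlonglongrightarrow> l i" by metis
  have fin: "(\<Sum>i\<in>F. (cmod (coef (X n) i - l i))\<^sup>2) \<le> e\<^sup>2"
    if F: "finite F" and e: "\<And>m. m \<ge> n \<Longrightarrow> dist (X n) (X m) \<le> e" for F n e
  proof (rule tendsto_upperbound)
    show "(\<lambda>m. \<Sum>i\<in>F. (cmod (coef (X n) i - coef (X m) i))\<^sup>2) \<longlonglongrightarrow> (\<Sum>i\<in>F. (cmod (coef (X n) i - l i))\<^sup>2)"
      by (intro tendsto_intros l)
    have "(\<Sum>i\<in>F. (cmod (coef (X n) i - coef (X m) i))\<^sup>2) \<le> e\<^sup>2" if "m \<ge> n" for m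
    proof -
      have "(\<Sum>i\<in>F. (cmod (coef (X n - X m) i))\<^sup>2) \<le> (norm (X n - X m))\<^sup>2"
        unfolding norm_ell2_sum using F by (intro finite_sum_le_infsum square_summable_coef) auto
      also have "\<dots> \<le> e\<^sup>2" using e[OF that] by (intro power_mono) (auto simp: dist_norm)
      finally show ?thesis by simp
    qed
    then show "\<forall>\<^sub>F m in sequentially. (\<Sum>i\<in>F. (cmod (coef (X n) i - coef (X m) i))\<^sup>2) \<le> e\<^sup>2"
      by (auto simp: eventually_sequentially)
  qed simp
  have ex: "\<exists>N. \<forall>n\<ge>N. \<forall>m\<ge>n. dist (X n) (X m) \<le> e" if "e > 0" for e
  proof -
    obtain N where "\<forall>m\<ge>N. \<forall>n\<ge>N. dist (X m) (X n) < e"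
      using X \<open>e > 0\<close> unfolding Cauchy_def by blast
    then show ?thesis by (intro exI[of _ N]) (auto intro: less_imp_le)
  qed
  obtain N where N: "\<And>m. m \<ge> N \<Longrightarrow> dist (X N) (X m) \<le> 1" using ex[of 1] by auto
  have s: "(\<lambda>i. (cmod (coef (X N) i - l i))\<^sup>2) summable_on UNIV"
    using fin[of _ N 1] N by (intro nonneg_bdd_above_summable_on) (auto intro!: bdd_aboveI2)
  have "(\<lambda>i. (cmod (l i))\<^sup>2) summable_on UNIV"
    using square_summable_add(1)[OF square_summable_coef[of "X N"], of "\<lambda>i. l i - coef (X N) i"] s
    by (simp add: norm_minus_commute)
  then have L: "coef (Abs_ell2 l) i = l i" for i
    by (simp add: Abs_ell2_inverse)
  define L where "L = Abs_ell2 l"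
  have "X \<longlonglongrightarrow> L"
  proof (rule metric_LIMSEQ_I)
    fix e :: real assume "e > 0"
    then obtain N where N: "\<forall>n\<ge>N. \<forall>m\<ge>n. dist (X n) (X m) \<le> e / 2" using ex[of "e/2"] by auto
    have "dist (X n) L < e" if "n \<ge> N" for n
    proof -
      have "(norm (X n - L))\<^sup>2 \<le> (e/2)\<^sup>2"
        unfolding norm_ell2_sum using fin[of _ n "e/2"] N that
        by (intro infsum_le_finite_sums square_summable_coef) (auto simp: L L_def)
      then have "norm (X n - L) \<le> e / 2" by (rule power2_le_imp_le) (use \<open>e > 0\<close> in auto)
      then show ?thesis using \<open>e > 0\<close> by (simp add: dist_norm)
    qed
    then show "\<exists>N. \<forall>n\<ge>N. dist (X n) L < e" by auto
  qed
  then show "convergent X" by (auto simp: convergent_def)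
qed

section \<open>Orthogonal projections\<close>

text \<open>The parallelogram law: midpoints of almost optimal points cannot be closer to \<open>x\<close> than
  \<open>d\<close>, so almost optimal points are close to each other.\<close>

lemma cauchy_minimizing_sequence:
  fixes x :: "'a :: real_inner"
  assumes conv: "\<And>u v. u \<in> V \<Longrightarrow> v \<in> V \<Longrightarrow> (1/2) *\<^sub>R (u + v) \<in> V"
    and X: "\<And>n. X n \<in> V" "(\<lambda>n. norm (x - X n)) \<longlonglongrightarrow> d" and d: "\<And>v. v \<in> V \<Longrightarrow> d \<le> norm (x - v)" "d \<ge> 0"
  shows "Cauchy X"
proof (rule metric_CauchyI)
  fix e :: real assume e: "e > 0"
  have "(\<lambda>n. (norm (x - X n))\<^sup>2) \<longlonglongrightarrow> d\<^sup>2" by (intro tendsto_intros X)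
  from LIMSEQ_D[OF this, of "e\<^sup>2/4"] e obtain N where
    N: "\<And>n. n \<ge> N \<Longrightarrow> \<bar>(norm (x - X n))\<^sup>2 - d\<^sup>2\<bar> < e\<^sup>2/4" by auto
  have "dist (X m) (X n) < e" if mn: "m \<ge> N" "n \<ge> N" for m n
  proof -
    let ?a = "x - X m" and ?b = "x - X n"
    have "(norm (?a - ?b))\<^sup>2 = 2 * (norm ?a)\<^sup>2 + 2 * (norm ?b)\<^sup>2 - (norm (?a + ?b))\<^sup>2"
      by (simp add: power2_norm_eq_inner inner_simps inner_commute algebra_simps)
    moreover have "norm (?a + ?b) = 2 * norm (x - (1/2) *\<^sub>R (X m + X n))"
    proof -
      have "?a + ?b = 2 *\<^sub>R (x - (1/2) *\<^sub>R (X m + X n))" by (simp add: algebra_simps scaleR_2)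
      then show ?thesis by (metis norm_scaleR abs_numeral)
    qed
    moreover have "d\<^sup>2 \<le> (norm (x - (1/2) *\<^sub>R (X m + X n)))\<^sup>2"
      using d conv X(1) by (intro power_mono) auto
    moreover have "(norm ?a)\<^sup>2 < d\<^sup>2 + e\<^sup>2/4" "(norm ?b)\<^sup>2 < d\<^sup>2 + e\<^sup>2/4"
      using N[OF mn(1)] N[OF mn(2)] by linarith+
    ultimately have "(norm (?a - ?b))\<^sup>2 < e\<^sup>2"
      unfolding power_mult_distrib by simp
    then have "norm (?a - ?b) < e" by (rule power2_less_imp_less) (use e in auto)
    then show ?thesis by (simp add: dist_norm norm_minus_commute)
  qed
  then show "\<exists>M. \<forall>m\<ge>M. \<forall>n\<ge>M. dist (X m) (X n) < e" by blast
qed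

lemma csubspace_scaleR: "cvs.subspace V \<Longrightarrow> x \<in> V \<Longrightarrow> r *\<^sub>R x \<in> V"
  by (simp add: scaleR_scaleC cvs.subspace_scale)

lemma nearest_point_exists:
  fixes V :: "'i ell2 set"
  assumes V: "closed V" "cvs.subspace V"
  obtains p where "p \<in> V" "\<And>v. v \<in> V \<Longrightarrow> norm (x - p) \<le> norm (x - v)"
proof -
  define d where "d = (INF v\<in>V. norm (x - v))"
  have ne: "V \<noteq> {}" using V(2) cvs.subspace_0 by auto
  have bdd: "bdd_below ((\<lambda>v. norm (x - v)) ` V)" by (rule bdd_belowI2[of _ 0]) simp
  have d: "d \<le> norm (x - v)" if "v \<in> V" for v
    unfolding d_def using that bdd by (rule cINF_lower[rotated])
  have d0: "d \<ge> 0" unfolding d_def by (rule cINF_greatest[OF ne]) simp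
  have "\<exists>v\<in>V. norm (x - v) < d + 1 / real (Suc n)" for n
  proof -
    have "(INF v\<in>V. norm (x - v)) < d + 1 / real (Suc n)" by (simp add: d_def)
    then show ?thesis using cINF_less_iff[OF ne bdd] by blast
  qed
  then obtain X where X: "\<And>n. X n \<in> V" "\<And>n. norm (x - X n) < d + 1 / real (Suc n)" by metis
  have lim: "(\<lambda>n. norm (x - X n)) \<longlonglongrightarrow> d"
  proof (rule tendsto_sandwich[OF _ _ tendsto_const])
    show "(\<lambda>n. d + 1 / real (Suc n)) \<longlonglongrightarrow> d"
      using tendsto_add[OF tendsto_const LIMSEQ_inverse_real_of_nat, of d] by (simp add: inverse_eq_divide)
    show "\<forall>\<^sub>F n in sequentially. norm (x - X n) \<le> d + 1 / real (Suc n)"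
      using X(2) by (intro always_eventually allI less_imp_le)
  qed (use X(1) d in auto)
  have "Cauchy X"
    by (rule cauchy_minimizing_sequence[OF _ X(1) lim d d0])
       (use V in \<open>auto intro: csubspace_scaleR cvs.subspace_add\<close>)
  then obtain p where p: "X \<longlonglongrightarrow> p" using Cauchy_convergent_iff convergent_def by metis
  have "p \<in> V" using V(1) X(1) p closed_sequentially by blast
  moreover have "norm (x - p) = d"
    by (rule LIMSEQ_unique[OF _ lim]) (intro tendsto_intros p)
  ultimately show thesis using that[of p] d by simp
qed

text \<open>Minimality of the distance along real multiples of \<open>v\<close> only makes the real part of
  \<open>cinner (x - p) v\<close> vanish; the imaginary part is obtained from \<open>\<i> v\<close>.\<close>

lemma projection_exists:
  fixes V :: "'i ell2 set"
  assumes V: "closed V" "cvs.subspace V"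
  shows "\<exists>!p. p \<in> V \<and> (\<forall>v\<in>V. cinner (x - p) v = 0)"
proof (rule ex_ex1I)
  obtain p where p: "p \<in> V" and min: "\<And>v. v \<in> V \<Longrightarrow> norm (x - p) \<le> norm (x - v)"
    using nearest_point_exists[OF V] by blast
  have inner0: "inner (x - p) v = 0" if v: "v \<in> V" for v
  proof (rule ccontr)
    assume ne: "inner (x - p) v \<noteq> 0"
    then have v0: "inner v v > 0" by auto
    define t where "t = inner (x - p) v / inner v v"
    have "p + t *\<^sub>R v \<in> V" using V p v by (auto intro: cvs.subspace_add csubspace_scaleR)
    then have "(norm (x - p))\<^sup>2 \<le> (norm (x - (p + t *\<^sub>R v)))\<^sup>2" by (intro power_mono min) auto
    also have "\<dots> = (norm (x - p))\<^sup>2 - 2 * t * inner (x - p) v + t * t * inner v v"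
      by (simp add: power2_norm_eq_inner inner_simps inner_commute algebra_simps)
    also have "\<dots> = (norm (x - p))\<^sup>2 - (inner (x - p) v)\<^sup>2 / inner v v"
      using v0 by (simp add: t_def power2_eq_square field_simps)
    finally have "(inner (x - p) v)\<^sup>2 / inner v v \<le> 0" by simp
    moreover have "(inner (x - p) v)\<^sup>2 / inner v v > 0" using ne v0 by simp
    ultimately show False by linarith
  qed
  have "cinner (x - p) v = 0" if v: "v \<in> V" for v
  proof -
    have "Re (cinner (x - p) v) = 0" using inner0[OF v] by (simp add: inner_ell2_def)
    moreover have "Re (cinner (x - p) (\<i> *\<^sub>C v)) = 0"
      using inner0[OF cvs.subspace_scale[OF V(2) v, of \<i>]] unfolding inner_ell2_def .
    ultimately show ?thesis by (simp add: complex_eq_iff)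
  qed
  with p show "\<exists>p. p \<in> V \<and> (\<forall>v\<in>V. cinner (x - p) v = 0)" by blast
next
  fix p q assume pq: "p \<in> V \<and> (\<forall>v\<in>V. cinner (x - p) v = 0)" "q \<in> V \<and> (\<forall>v\<in>V. cinner (x - q) v = 0)"
  then have "p - q \<in> V" using V(2) cvs.subspace_diff by blast
  then have "cinner (x - q) (p - q) - cinner (x - p) (p - q) = 0" using pq by simp
  then have "cinner (p - q) (p - q) = 0" by (simp flip: cinner.diff_left)
  then show "p = q" by (simp add: cinner_self_norm)
qed

definition proj :: "'i ell2 set \<Rightarrow> 'i ell2 \<Rightarrow> 'i ell2" where
  "proj V x = (THE p. p \<in> V \<and> (\<forall>v\<in>V. cinner (x - p) v = 0))"

definition ortho :: "'i ell2 set \<Rightarrow> 'i ell2 set" where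
  "ortho V = {x. \<forall>v\<in>V. cinner x v = 0}"

lemma closed_ortho: "closed (ortho V)"
proof -
  have "ortho V = (\<Inter>v\<in>V. {x. cinner x v = 0})" by (auto simp: ortho_def)
  moreover have "closed {x. cinner x v = 0}" for v :: "'a ell2"
    by (intro closed_Collect_eq continuous_intros cinner.continuous_on)
  ultimately show ?thesis by auto
qed

lemma csubspace_ortho: "cvs.subspace (ortho V)"
  by (auto simp: cvs.subspace_def ortho_def cinner_simps)

lemma cinner_eq_0_sym: "cinner x y = 0 \<longleftrightarrow> cinner y x = 0"
  by (metis cnj_cinner complex_cnj_zero_iff)

context
  fixes V :: "'i ell2 set"
  assumes V: "closed V" "cvs.subspace V"
begin

lemma proj_in: "proj V x \<in> V" and proj_orth: "v \<in> V \<Longrightarrow> cinner (x - proj V x) v = 0"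
  using theI'[OF projection_exists[OF V, of x]] unfolding proj_def[symmetric] by auto

lemma proj_eqI: "p \<in> V \<Longrightarrow> (\<And>v. v \<in> V \<Longrightarrow> cinner (x - p) v = 0) \<Longrightarrow> proj V x = p"
  unfolding proj_def using projection_exists[OF V, of x] by (intro the1_equality) auto

lemma proj_id: "v \<in> V \<Longrightarrow> proj V v = v"
  by (rule proj_eqI) auto

lemma diff_proj_in_ortho: "x - proj V x \<in> ortho V"
  using proj_orth by (auto simp: ortho_def)

lemma ortho_ortho: "ortho (ortho V) = V"
proof
  show "V \<subseteq> ortho (ortho V)" using cinner_eq_0_sym by (auto simp: ortho_def)
  show "ortho (ortho V) \<subseteq> V"
  proof
    fix x assume x: "x \<in> ortho (ortho V)"
    have "cinner (x - proj V x) (x - proj V x) = cinner x (x - proj V x) - cinner (proj V x) (x - proj V x)"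
      by (rule cinner.diff_left)
    also have "\<dots> = 0"
      using x diff_proj_in_ortho[of x] proj_orth[OF proj_in, of x x] cinner_eq_0_sym by (auto simp: ortho_def)
    finally have "x = proj V x" by (simp add: cinner_self_norm)
    then show "x \<in> V" using proj_in by metis
  qed
qed

lemma proj_add: "proj V (x + y) = proj V x + proj V y"
proof (rule proj_eqI)
  show "cinner (x + y - (proj V x + proj V y)) v = 0" if "v \<in> V" for v
    using proj_orth[OF that, of x] proj_orth[OF that, of y] by (simp add: cinner_simps)
qed (intro cvs.subspace_add V proj_in)

lemma proj_scaleC: "proj V (c *\<^sub>C x) = c *\<^sub>C proj V x"
proof (rule proj_eqI)
  show "cinner (c *\<^sub>C x - c *\<^sub>C proj V x) v = 0" if "v \<in> V" for v
    using proj_orth[OF that, of x] by (simp add: cinner_simps flip: right_diff_distrib)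
qed (intro cvs.subspace_scale V proj_in)

lemma cinner_proj_proj: "cinner (proj V x) y = cinner (proj V x) (proj V y)"
  using proj_orth[OF proj_in, of y x, unfolded cinner_eq_0_sym[of "_ - _"]] by (simp add: cinner_simps)

lemma cinner_proj_swap: "cinner (proj V x) y = cinner x (proj V y)"
  using cinner_proj_proj[of x y] proj_orth[OF proj_in, of x y] by (simp add: cinner_simps)

lemma norm_proj_le: "norm (proj V x) \<le> norm x"
proof (cases "proj V x = 0")
  case False
  have "(norm (proj V x))\<^sup>2 = cmod (cinner x (proj V x))"
    using cinner_proj_proj[of x x] cinner_proj_swap[of x x] cinner_self_norm[of "proj V x"]
    by (metis abs_power2 norm_of_real)
  also have "\<dots> \<le> norm x * norm (proj V x)" by (rule norm_cinner_le)
  finally show ?thesis using False by (simp add: power2_eq_square)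
qed simp

lemma bounded_linear_proj: "bounded_linear (proj V)"
  by (rule bounded_linear_intro[of _ 1])
     (auto simp: proj_add scaleR_scaleC proj_scaleC norm_proj_le)

end

text \<open>A vector orthogonal to \<open>V\<close> has no coefficients.  This is how identities between bounded
  operators are extended from monomials to all vectors.\<close>

lemma total_delta:
  assumes "closed V" "cvs.subspace V" "\<And>k. delta k \<in> V"
  shows "x \<in> V"
proof -
  have "coef (x - proj V x) k = 0" for k
    using proj_orth[OF assms(1,2) assms(3), of x k] by simp
  then have "x - proj V x = 0" by (intro ell2_eqI) simp
  then show ?thesis using proj_in[OF assms(1,2), of x] by simp
qed


section \<open>Shifts and the two reducing parts of a submodule\<close>

text \<open>With exponent \<open>k = (a, b)\<close> these are multiplication by \<open>z\<^sup>a w\<^sup>b\<close> and its adjoint.\<close>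

lift_definition shift :: "nat \<times> nat \<Rightarrow> (nat \<times> nat) ell2 \<Rightarrow> (nat \<times> nat) ell2" is
  "\<lambda>k x i. if i \<in> range ((+) k) then x (i - k) else 0"
proof -
  fix k :: "nat \<times> nat" and x :: "nat \<times> nat \<Rightarrow> complex"
  assume x: "(\<lambda>i. (cmod (x i))\<^sup>2) summable_on UNIV"
  have "(\<lambda>i. (cmod (x (i - k)))\<^sup>2) summable_on range ((+) k)"
    using x by (subst summable_on_reindex) (auto simp: o_def)
  then show "(\<lambda>i. (cmod (if i \<in> range ((+) k) then x (i - k) else 0))\<^sup>2) summable_on UNIV"
    by (rule summable_on_cong_neutral[THEN iffD1, rotated -1]) auto
qed

lift_definition coshift :: "nat \<times> nat \<Rightarrow> (nat \<times> nat) ell2 \<Rightarrow> (nat \<times> nat) ell2" is "\<lambda>k x i. x (k + i)"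
proof -
  fix k :: "nat \<times> nat" and x :: "nat \<times> nat \<Rightarrow> complex"
  assume x: "(\<lambda>i. (cmod (x i))\<^sup>2) summable_on UNIV"
  then have "(\<lambda>i. (cmod (x i))\<^sup>2) summable_on range ((+) k)" by (rule summable_on_subset_banach) auto
  then show "(\<lambda>i. (cmod (x (k + i)))\<^sup>2) summable_on UNIV"
    by (subst (asm) summable_on_reindex) (auto simp: o_def)
qed

lemma coef_shift: "coef (shift k x) i = (if i \<in> range ((+) k) then coef x (i - k) else 0)"
  by transfer simp

lemma coef_shift_add [simp]: "coef (shift k x) (k + i) = coef x i"
  by (simp add: coef_shift)

lemma coef_coshift [simp]: "coef (coshift k x) i = coef x (k + i)"
  by transfer simp

lemma cinner_shift: "cinner (shift k x) y = cinner x (coshift k y)"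
proof -
  have "cinner (shift k x) y = (\<Sum>\<^sub>\<infinity>i\<in>range ((+) k). coef x (i - k) * cnj (coef y i))"
    unfolding cinner_eq_infsum by (intro infsum_cong_neutral) (auto simp: coef_shift)
  also have "\<dots> = (\<Sum>\<^sub>\<infinity>i. coef x i * cnj (coef y (k + i)))"
    by (subst infsum_reindex) (auto simp: o_def)
  finally show ?thesis by (simp add: cinner_eq_infsum)
qed

lemma cinner_coshift: "cinner (coshift k x) y = cinner x (shift k y)"
  by (metis cinner_shift cnj_cinner)

lemma coshift_shift [simp]: "coshift k (shift k x) = x"
  by (rule ell2_eqI) simp

lemma cinner_shift_shift [simp]: "cinner (shift k x) (shift k y) = cinner x y"
  by (simp add: cinner_shift)

lemma coshift_coshift: "coshift k (coshift l x) = coshift (k + l) x"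
  by (rule ell2_eqI) (simp add: ac_simps)

lemma cinner_eqI: "(\<And>z. cinner x z = cinner y z) \<Longrightarrow> x = y"
  by (rule ell2_eqI) (metis cinner_delta_right)

lemma shift_shift: "shift k (shift l x) = shift (k + l) x"
  by (rule cinner_eqI) (simp add: cinner_shift coshift_coshift ac_simps)

lemma coshift_0 [simp]: "coshift 0 x = x"
  by (rule ell2_eqI) simp

lemma shift_0 [simp]: "shift 0 x = x"
  by (rule cinner_eqI) (simp add: cinner_shift)

lemma shift_linear: "shift k (x + y) = shift k x + shift k y" "shift k (c *\<^sub>C x) = c *\<^sub>C shift k x" "shift k (x - y) = shift k x - shift k y"
  by (rule ell2_eqI; simp add: coef_shift)+

lemma coshift_linear: "coshift k (x + y) = coshift k x + coshift k y" "coshift k (c *\<^sub>C x) = c *\<^sub>C coshift k x" "coshift k (x - y) = coshift k x - coshift k y"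
  by (rule ell2_eqI; simp)+

lemma norm_shift [simp]: "norm (shift k x) = norm x"
  by (simp add: norm_ell2_def inner_ell2_def)

lemma norm_coshift_le: "norm (coshift k x) \<le> norm x"
proof (cases "coshift k x = 0")
  case False
  have "(norm (coshift k x))\<^sup>2 = cmod (cinner x (shift k (coshift k x)))"
    by (metis cinner_self_norm cinner_coshift abs_power2 norm_of_real)
  also have "\<dots> \<le> norm x * norm (coshift k x)" using norm_cinner_le[of x "shift k (coshift k x)"] by simp
  finally show ?thesis using False by (simp add: power2_eq_square)
qed simp

lemma bounded_linear_shift: "bounded_linear (shift k)" and bounded_linear_coshift: "bounded_linear (coshift k)"
  by (rule bounded_linear_intro[of _ 1]; simp add: scaleR_scaleC shift_linear coshift_linear norm_coshift_le)+

lemma shift_delta [simp]: "shift k (delta l) = delta (k + l)"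
  by (rule ell2_eqI) (auto simp: coef_shift)


text \<open>The exponents of the coordinate functions \<open>z\<close> and \<open>w\<close>.  Lemmas that are symmetric in the two
  variables take a direction \<open>d\<close> and the other direction \<open>e\<close>.\<close>

abbreviation ez :: "nat \<times> nat" where "ez \<equiv> (1, 0)"
abbreviation ew :: "nat \<times> nat" where "ew \<equiv> (0, 1)"

lemma coshift_shift_commute:
  "coshift (0, b) (shift (a, 0) x) = shift (a, 0) (coshift (0, b) x)"
  "coshift (a, 0) (shift (0, b) x) = shift (0, b) (coshift (a, 0) x)"
proof -
  have r: "(m, n) \<in> range ((+) (p, q)) \<longleftrightarrow> p \<le> m \<and> q \<le> n" for m n p q :: nat
    by (auto simp: image_iff le_iff_add)
  show "coshift (0, b) (shift (a, 0) x) = shift (a, 0) (coshift (0, b) x)"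
  proof (rule ell2_eqI)
    show "coef (coshift (0, b) (shift (a, 0) x)) i = coef (shift (a, 0) (coshift (0, b) x)) i" for i
      by (cases i) (simp add: coef_shift r)
  qed
  show "coshift (a, 0) (shift (0, b) x) = shift (0, b) (coshift (a, 0) x)"
  proof (rule ell2_eqI)
    show "coef (coshift (a, 0) (shift (0, b) x)) i = coef (shift (0, b) (coshift (a, 0) x)) i" for i
      by (cases i) (simp add: coef_shift r)
  qed
qed

definition shift_invariant :: "(nat \<times> nat) ell2 set \<Rightarrow> bool" where
  "shift_invariant V \<longleftrightarrow> closed V \<and> cvs.subspace V \<and> shift ez ` V \<subseteq> V \<and> shift ew ` V \<subseteq> V"

lemma shift_invariantD:
  assumes "shift_invariant V"
  shows "closed V" "cvs.subspace V" "d \<in> {ez, ew} \<Longrightarrow> x \<in> V \<Longrightarrow> shift d x \<in> V"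
  using assms by (auto simp: shift_invariant_def)

lemma shift_invariant_shift:
  assumes "shift_invariant V" "x \<in> V"
  shows "shift k x \<in> V"
proof -
  have z: "shift (a, 0) y \<in> V" if "y \<in> V" for a y
  proof (induction a)
    case (Suc a)
    have "shift (Suc a, 0) y = shift ez (shift (a, 0) y)" by (simp add: shift_shift)
    then show ?case using Suc shift_invariantD(3)[OF assms(1), of ez] by simp
  qed (use that in \<open>simp flip: zero_prod_def\<close>)
  have w: "shift (0, b) y \<in> V" if "y \<in> V" for b y
  proof (induction b)
    case (Suc b)
    have "shift (0, Suc b) y = shift ew (shift (0, b) y)" by (simp add: shift_shift)
    then show ?case using Suc shift_invariantD(3)[OF assms(1), of ew] by simp
  qed (use that in \<open>simp flip: zero_prod_def\<close>)
  have "shift k x = shift (fst k, 0) (shift (0, snd k) x)" by (simp add: shift_shift)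
  then show ?thesis using z w assms(2) by simp
qed

text \<open>The largest part of \<open>T\<close> that is invariant under the backward shift in direction \<open>d\<close>.\<close>

definition reducing_core :: "nat \<times> nat \<Rightarrow> (nat \<times> nat) ell2 set \<Rightarrow> (nat \<times> nat) ell2 set" where
  "reducing_core d T = {f. \<forall>n. (coshift d ^^ n) f \<in> T}"

lemma reducing_core_subset: "reducing_core d T \<subseteq> T"
proof
  fix f assume "f \<in> reducing_core d T"
  then have "(coshift d ^^ 0) f \<in> T" unfolding reducing_core_def by blast
  then show "f \<in> T" by simp
qed

lemma coshift_reducing_core: "f \<in> reducing_core d T \<Longrightarrow> coshift d f \<in> reducing_core d T"
  unfolding reducing_core_def by (auto simp: funpow_swap1 simp flip: funpow.simps(2)[unfolded o_def, THEN fun_cong])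
    (metis comp_apply funpow.simps(2) funpow_swap1)

lemma funpow_coshift_linear:
  "(coshift d ^^ n) (x + y) = (coshift d ^^ n) x + (coshift d ^^ n) y"
  "(coshift d ^^ n) (c *\<^sub>C x) = c *\<^sub>C (coshift d ^^ n) x"
  "(coshift d ^^ n) (x - y) = (coshift d ^^ n) x - (coshift d ^^ n) y"
  by (induction n) (simp_all add: coshift_linear)

lemma continuous_funpow_coshift: "continuous_on UNIV (coshift d ^^ n)"
proof (induction n)
  case (Suc n)
  have "continuous_on UNIV (\<lambda>x. coshift d ((coshift d ^^ n) x))"
    by (rule continuous_on_compose2[OF linear_continuous_on[OF bounded_linear_coshift] Suc]) auto
  then show ?case by (simp add: o_def)
qed (simp add: id_def continuous_on_id)

lemma cross_commute:
  assumes "{d, e} = {ez, ew}"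
  shows "coshift d (shift e x) = shift e (coshift d x)"
proof -
  have "d = ez \<and> e = ew \<or> d = ew \<and> e = ez" using assms by (auto simp: doubleton_eq_iff)
  then show ?thesis using coshift_shift_commute(1)[of 1 1 x] coshift_shift_commute(2)[of 1 1 x] by auto
qed

lemma shift_invariant_reducing_core:
  assumes T: "shift_invariant T" and de: "{d, e} = {ez, ew}"
  shows "shift_invariant (reducing_core d T)"
proof -
  have cl: "closed (reducing_core d T)"
  proof -
    have "reducing_core d T = (\<Inter>n. (coshift d ^^ n) -` T)" by (auto simp: reducing_core_def)
    moreover have "closed ((coshift d ^^ n) -` T)" for n
      by (rule closed_vimage[OF shift_invariantD(1)[OF T] continuous_funpow_coshift])
    ultimately show ?thesis by auto
  qed
  have L0: "(coshift d ^^ n) 0 = 0" for n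
    using funpow_coshift_linear(3)[of n d 0 0] by simp
  have sub: "cvs.subspace (reducing_core d T)"
    using shift_invariantD(2)[OF T]
    by (auto simp: cvs.subspace_def reducing_core_def funpow_coshift_linear L0)
  have comm: "(coshift d ^^ n) (shift e f) = shift e ((coshift d ^^ n) f)" for n f
    by (induction n) (simp_all add: cross_commute[OF de])
  have Te: "shift e x \<in> T" "shift d x \<in> T" if "x \<in> T" for x
    using shift_invariantD(3)[OF T] that de by blast+
  have "shift e f \<in> reducing_core d T" if "f \<in> reducing_core d T" for f
    using that Te(1) unfolding reducing_core_def mem_Collect_eq comm by blast
  moreover have "shift d f \<in> reducing_core d T" if "f \<in> reducing_core d T" for f
  proof -
    have "(coshift d ^^ n) (shift d f) \<in> T" for n
    proof (cases n)
      case 0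
      then show ?thesis using Te(2) subsetD[OF reducing_core_subset that] by simp
    next
      case (Suc m)
      then have "(coshift d ^^ n) (shift d f) = (coshift d ^^ m) f" by (simp add: funpow_swap1)
      then show ?thesis using that by (simp add: reducing_core_def)
    qed
    then show ?thesis by (simp add: reducing_core_def)
  qed
  ultimately show ?thesis
    using cl sub de unfolding shift_invariant_def by (auto simp: doubleton_eq_iff)
qed

text \<open>If \<open>Q\<close> is invariant under the backward shifts, then the compressed shift in direction \<open>e\<close> is
  \<open>proj Q \<circ> shift e\<close> and the adjoint of the one in direction \<open>d\<close> is \<open>coshift d\<close>.  The condition says that
  these two operators commute on \<open>Q\<close>.\<close>

definition cross_condition :: "nat \<times> nat \<Rightarrow> nat \<times> nat \<Rightarrow> (nat \<times> nat) ell2 set \<Rightarrow> bool" where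
  "cross_condition d e Q \<longleftrightarrow> (\<forall>q\<in>Q. proj Q (shift e (coshift d q)) = coshift d (proj Q (shift e q)))"

lemma coshift_ortho:
  assumes "shift_invariant T" "d \<in> {ez, ew}" "q \<in> ortho T"
  shows "coshift d q \<in> ortho T"
  using assms shift_invariantD(3)[OF assms(1,2)] by (auto simp: ortho_def cinner_coshift)

text \<open>Taking adjoints of \<open>C\<^sub>e C\<^sub>d\<^sup>* = C\<^sub>d\<^sup>* C\<^sub>e\<close> exchanges the roles of the directions.\<close>

lemma cross_condition_sym:
  assumes T: "shift_invariant T" and de: "{d, e} = {ez, ew}"
    and c: "cross_condition d e (ortho T)"
  shows "cross_condition e d (ortho T)"
  unfolding cross_condition_def
proof
  let ?Q = "ortho T"
  note Q = closed_ortho[of T] csubspace_ortho[of T]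
  have ed: "d \<in> {ez, ew}" "e \<in> {ez, ew}" using de by blast+
  fix q assume q: "q \<in> ?Q"
  have eq: "cinner (coshift e (proj ?Q (shift d q))) q' = cinner (proj ?Q (shift d (coshift e q))) q'" if q': "q' \<in> ?Q" for q'
  proof -
    have "cinner (coshift e (proj ?Q (shift d q))) q' = cinner q (coshift d (proj ?Q (shift e q')))"
      by (simp add: cinner_coshift cinner_proj_swap[OF Q] cinner_shift)
    also have "\<dots> = cinner q (proj ?Q (shift e (coshift d q')))"
      using c q' by (simp add: cross_condition_def)
    also have "\<dots> = cinner q (shift e (coshift d q'))"
      using cinner_proj_swap[OF Q, of q "shift e (coshift d q')"] proj_id[OF Q q] by simp
    also have "\<dots> = cinner (shift d (coshift e q)) q'" by (simp add: cinner_shift cinner_coshift)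
    also have "\<dots> = cinner (proj ?Q (shift d (coshift e q))) q'"
      using cinner_proj_swap[OF Q, of "shift d (coshift e q)" q'] proj_id[OF Q q'] by simp
    finally show ?thesis .
  qed
  have "coshift e (proj ?Q (shift d q)) - proj ?Q (shift d (coshift e q)) \<in> ?Q"
    by (intro cvs.subspace_diff csubspace_ortho coshift_ortho T ed proj_in Q)
  from eq[OF this] have "cinner (coshift e (proj ?Q (shift d q)) - proj ?Q (shift d (coshift e q)))
      (coshift e (proj ?Q (shift d q)) - proj ?Q (shift d (coshift e q))) = 0"
    by (simp add: cinner.diff_left)
  then show "proj ?Q (shift d (coshift e q)) = coshift e (proj ?Q (shift d q))" by (simp add: cinner_self_norm)
qed

text \<open>Write \<open>Q\<close> for the complement of \<open>T\<close>.  Commutation lets the backward shift pass through the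
  component of \<open>shift e q\<close> in \<open>T\<close>, so all backward shifts of that component stay in \<open>T\<close>.  Hence
  \<open>Q + reducing_core d T\<close> is invariant under \<open>shift e\<close>, and whatever is orthogonal to it is orthogonal to
  every \<open>shift e\<close>-iterate of \<open>Q\<close>, that is, lies in the core for \<open>e\<close>.\<close>

lemma orthogonal_reducing_core_in_reducing_core:
  assumes T: "shift_invariant T" and de: "{d, e} = {ez, ew}"
    and c: "cross_condition d e (ortho T)"
    and f: "f \<in> T" "\<And>v. v \<in> reducing_core d T \<Longrightarrow> cinner f v = 0"
  shows "f \<in> reducing_core e T"
proof -
  let ?Q = "ortho T"
  note Q = closed_ortho[of T] csubspace_ortho[of T]
  have ed: "d \<in> {ez, ew}" "e \<in> {ez, ew}" using de by blast+
  have TQ: "T = ortho ?Q" using ortho_ortho shift_invariantD[OF T] by metis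
  have reducing_core: "shift e q - proj ?Q (shift e q) \<in> reducing_core d T" if "q \<in> ?Q" for q
  proof -
    have "\<exists>q'\<in>?Q. (coshift d ^^ n) (shift e q - proj ?Q (shift e q)) = shift e q' - proj ?Q (shift e q')" for n
    proof (induction n)
      case (Suc n)
      then obtain q' where q': "q' \<in> ?Q" "(coshift d ^^ n) (shift e q - proj ?Q (shift e q)) = shift e q' - proj ?Q (shift e q')"
        by blast
      have "coshift d (shift e q' - proj ?Q (shift e q')) = shift e (coshift d q') - proj ?Q (shift e (coshift d q'))"
        using c q'(1) by (simp add: coshift_linear cross_commute[OF de] cross_condition_def)
      then show ?case using q' coshift_ortho[OF T ed(1) q'(1)] by auto
    qed (use that in auto)
    moreover have "shift e q' - proj ?Q (shift e q') \<in> T" for q'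
      using diff_proj_in_ortho[OF Q] TQ by metis
    ultimately have "(coshift d ^^ n) (shift e q - proj ?Q (shift e q)) \<in> T" for n by metis
    then show ?thesis by (simp add: reducing_core_def)
  qed
  have inv: "shift_invariant (reducing_core d T)" by (rule shift_invariant_reducing_core[OF T de])
  have dec: "\<exists>q'\<in>?Q. \<exists>v\<in>reducing_core d T. (shift e ^^ n) q = q' + v" if "q \<in> ?Q" for q n
  proof (induction n)
    case 0
    show ?case using that shift_invariantD(2)[OF inv] cvs.subspace_0 by (intro bexI[of _ q] bexI[of _ 0]) auto
  next
    case (Suc n)
    then obtain q' v where qv: "q' \<in> ?Q" "v \<in> reducing_core d T" "(shift e ^^ n) q = q' + v" by blast
    have "(shift e ^^ Suc n) q = proj ?Q (shift e q') + ((shift e q' - proj ?Q (shift e q')) + shift e v)"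
      by (simp add: qv(3) shift_linear)
    moreover have "(shift e q' - proj ?Q (shift e q')) + shift e v \<in> reducing_core d T"
      by (intro cvs.subspace_add shift_invariantD(2,3)[OF inv] reducing_core qv ed)
    ultimately show ?case using proj_in[OF Q] by blast
  qed
  have adj: "cinner ((coshift e ^^ n) f) q = cinner f ((shift e ^^ n) q)" for n q
    by (induction n arbitrary: q) (simp_all add: cinner_coshift funpow_swap1[of "shift e"])
  have "(coshift e ^^ n) f \<in> ortho ?Q" for n
  proof -
    have "cinner ((coshift e ^^ n) f) q = 0" if q: "q \<in> ?Q" for q
    proof -
      obtain q' v where "q' \<in> ?Q" "v \<in> reducing_core d T" "(shift e ^^ n) q = q' + v" using dec[OF q] by blast
      then show ?thesis unfolding adj
        using f TQ by (simp add: cinner.add_right) (use TQ in \<open>auto simp: ortho_def\<close>)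
    qed
    then show ?thesis by (simp add: ortho_def)
  qed
  then show ?thesis using TQ by (simp add: reducing_core_def)
qed


section \<open>Multiplication by inner vectors\<close>

text \<open>This expresses \<open>|\<phi>| = 1\<close> almost everywhere on the torus by Fourier coefficients of \<open>|\<phi>|\<^sup>2\<close>.\<close>

definition inner_vector :: "(nat \<times> nat) ell2 \<Rightarrow> bool" where
  "inner_vector \<phi> \<longleftrightarrow> (\<forall>i j. cinner (shift i \<phi>) (shift j \<phi>) = (if i = j then 1 else 0))"

lemma inner_vectorD: "inner_vector \<phi> \<Longrightarrow> cinner (shift i \<phi>) (shift j \<phi>) = (if i = j then 1 else 0)"
  unfolding inner_vector_def by blast

lemma coef_sum [simp]: "coef (sum f F) i = (\<Sum>k\<in>F. coef (f k) i)"
  by (induction F rule: infinite_finite_induct) auto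

lemma orthonormal_sum:
  assumes \<phi>: "inner_vector \<phi>" and F: "finite F" "inj_on g F"
  shows "(norm (\<Sum>k\<in>F. c k *\<^sub>C shift (g k) \<phi>))\<^sup>2 = (\<Sum>k\<in>F. (cmod (c k))\<^sup>2)"
proof -
  let ?y = "\<Sum>k\<in>F. c k *\<^sub>C shift (g k) \<phi>"
  have "complex_of_real ((norm ?y)\<^sup>2) = (\<Sum>k\<in>F. \<Sum>l\<in>F. c k * (cnj (c l) * cinner (shift (g k) \<phi>) (shift (g l) \<phi>)))"
    unfolding cinner_self_norm[symmetric] cinner.sum_left
    by (intro sum.cong refl) (simp add: cinner.sum_right sum_distrib_left mult.left_commute)
  also have "\<dots> = (\<Sum>k\<in>F. \<Sum>l\<in>F. if l = k then c k * cnj (c l) else 0)"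
    using F(2) by (intro sum.cong refl) (auto simp: inj_on_def inner_vectorD[OF \<phi>])
  also have "\<dots> = of_real (\<Sum>k\<in>F. (cmod (c k))\<^sup>2)"
    using F(1) by (simp flip: complex_norm_square)
  finally show ?thesis using of_real_eq_iff by blast
qed

text \<open>The exponents of the monomials that divide the monomial with exponent \<open>i\<close>.\<close>

definition below :: "nat \<times> nat \<Rightarrow> (nat \<times> nat) set" where
  "below i = {..fst i} \<times> {..snd i}"

lemma finite_below [simp]: "finite (below i)"
  by (simp add: below_def)

lemma below_iff: "k \<in> below i \<longleftrightarrow> i \<in> range ((+) k)"
proof -
  have "i \<in> range ((+) k) \<longleftrightarrow> (\<exists>a b. i = (fst k + a, snd k + b))"
    by (cases k) (force simp: image_iff)
  then show ?thesis by (cases i; cases k) (auto simp: below_def le_iff_add)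
qed

text \<open>The Cauchy product of the power series of \<open>\<phi>\<close> and \<open>x\<close>, which is square summable if \<open>\<phi>\<close> is inner.\<close>

definition multiplier :: "(nat \<times> nat) ell2 \<Rightarrow> (nat \<times> nat) ell2 \<Rightarrow> (nat \<times> nat) ell2" where
  "multiplier \<phi> x = Abs_ell2 (\<lambda>i. \<Sum>k\<in>below i. coef x k * coef \<phi> (i - k))"

text \<open>Finitely many coefficients of the product involve only finitely many coefficients of \<open>x\<close>, and
  for those the norm of the product is known by orthonormality.\<close>

lemma multiplier_bound:
  assumes \<phi>: "inner_vector \<phi>" and G: "finite G"
  shows "(\<Sum>i\<in>G. (cmod (\<Sum>k\<in>below i. coef x k * coef \<phi> (i - k)))\<^sup>2) \<le> (norm x)\<^sup>2"
proof -
  define F where "F = (\<Union>i\<in>G. below i)"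
  have F: "finite F" using G by (auto simp: F_def)
  define y where "y = (\<Sum>k\<in>F. coef x k *\<^sub>C shift k \<phi>)"
  have c: "coef y i = (\<Sum>k\<in>below i. coef x k * coef \<phi> (i - k))" if "i \<in> G" for i
  proof -
    have "coef y i = (\<Sum>k\<in>F. coef x k * coef (shift k \<phi>) i)"
      unfolding y_def by simp
    also have "\<dots> = (\<Sum>k\<in>below i. coef x k * coef (shift k \<phi>) i)"
      using F that by (intro sum.mono_neutral_right) (auto simp: F_def coef_shift below_iff)
    finally show ?thesis by (simp add: coef_shift below_iff)
  qed
  have "(\<Sum>i\<in>G. (cmod (\<Sum>k\<in>below i. coef x k * coef \<phi> (i - k)))\<^sup>2) = (\<Sum>i\<in>G. (cmod (coef y i))\<^sup>2)"
    using c by simp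
  also have "\<dots> \<le> (norm y)\<^sup>2"
    unfolding norm_ell2_sum using G by (intro finite_sum_le_infsum square_summable_coef) auto
  also have "\<dots> = (\<Sum>k\<in>F. (cmod (coef x k))\<^sup>2)"
    unfolding y_def by (rule orthonormal_sum[OF \<phi> F]) simp
  also have "\<dots> \<le> (norm x)\<^sup>2"
    unfolding norm_ell2_sum using F by (intro finite_sum_le_infsum square_summable_coef) auto
  finally show ?thesis .
qed

lemma coef_multiplier:
  assumes \<phi>: "inner_vector \<phi>"
  shows "coef (multiplier \<phi> x) i = (\<Sum>k\<in>below i. coef x k * coef \<phi> (i - k))"
proof -
  have "(\<lambda>i. (cmod (\<Sum>k\<in>below i. coef x k * coef \<phi> (i - k)))\<^sup>2) summable_on UNIV"
    using multiplier_bound[OF \<phi>, of _ x] by (intro nonneg_bdd_above_summable_on) (auto intro!: bdd_aboveI2)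
  then show ?thesis unfolding multiplier_def by (subst Abs_ell2_inverse) auto
qed

definition clinear :: "('i ell2 \<Rightarrow> 'j ell2) \<Rightarrow> bool" where
  "clinear A \<longleftrightarrow> bounded_linear A \<and> (\<forall>c x. A (c *\<^sub>C x) = c *\<^sub>C A x)"

lemma clinear_multiplier:
  assumes \<phi>: "inner_vector \<phi>"
  shows "clinear (multiplier \<phi>)"
proof -
  have add: "multiplier \<phi> (x + y) = multiplier \<phi> x + multiplier \<phi> y" for x y
    by (rule ell2_eqI) (simp add: coef_multiplier[OF \<phi>] algebra_simps sum.distrib)
  have sc: "multiplier \<phi> (c *\<^sub>C x) = c *\<^sub>C multiplier \<phi> x" for c x
    by (rule ell2_eqI) (simp add: coef_multiplier[OF \<phi>] algebra_simps sum_distrib_left)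
  have "norm (multiplier \<phi> x) \<le> norm x" for x
  proof -
    have "(norm (multiplier \<phi> x))\<^sup>2 \<le> (norm x)\<^sup>2"
      unfolding norm_ell2_sum[of "multiplier \<phi> x"] using multiplier_bound[OF \<phi>, of _ x]
      by (intro infsum_le_finite_sums square_summable_coef) (auto simp: coef_multiplier[OF \<phi>])
    then show ?thesis by (rule power2_le_imp_le) simp
  qed
  then show ?thesis
    unfolding clinear_def by (auto intro!: bounded_linear_intro[of _ 1] simp: add sc scaleR_scaleC)
qed

lemma clinear_shift: "clinear (shift k)" and clinear_id: "clinear (\<lambda>x. x)"
  by (auto simp: clinear_def shift_linear intro: bounded_linear_shift)

lemma clinear_compose: "clinear A \<Longrightarrow> clinear B \<Longrightarrow> clinear (\<lambda>x. A (B x))"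
  by (auto simp: clinear_def intro: bounded_linear_compose)

lemma clinearD:
  assumes "clinear A"
  shows "bounded_linear A" "A (x + y) = A x + A y" "A (x - y) = A x - A y" "A (c *\<^sub>C x) = c *\<^sub>C A x" "A 0 = 0"
proof -
  interpret bounded_linear A using assms by (simp add: clinear_def)
  show "bounded_linear A" "A (x + y) = A x + A y" "A (x - y) = A x - A y" "A 0 = 0"
    by (rule bounded_linear_axioms add diff zero)+
  show "A (c *\<^sub>C x) = c *\<^sub>C A x" using assms by (simp add: clinear_def)
qed

lemma clinear_continuous: "clinear A \<Longrightarrow> continuous_on S A"
  by (auto simp: clinear_def intro: linear_continuous_on)

lemma clinear_eqI:
  assumes A: "clinear A" "clinear B" and eq: "\<And>k. A (delta k) = B (delta k)"
  shows "A x = B x"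
proof -
  have "x \<in> {x. A x = B x}"
  proof (rule total_delta)
    show "closed {x. A x = B x}" by (intro closed_Collect_eq clinear_continuous A)
    show "cvs.subspace {x. A x = B x}"
      by (auto simp: cvs.subspace_def clinearD[OF A(1)] clinearD[OF A(2)])
  qed (use eq in auto)
  then show ?thesis by simp
qed

lemma below_neutral: "(\<Sum>k\<in>below i. (if k = l then f k else 0)) = (if i \<in> range ((+) l) then f l else 0)"
  by (simp add: below_iff[symmetric])

lemma multiplier_delta [simp]:
  assumes "inner_vector \<phi>"
  shows "multiplier \<phi> (delta k) = shift k \<phi>"
proof (rule ell2_eqI)
  fix i
  have "coef (multiplier \<phi> (delta k)) i = (\<Sum>l\<in>below i. if l = k then coef \<phi> (i - l) else 0)"
    unfolding coef_multiplier[OF assms] by (intro sum.cong) auto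
  then show "coef (multiplier \<phi> (delta k)) i = coef (shift k \<phi>) i"
    by (simp only: below_neutral coef_shift)
qed

lemma multiplier_shift:
  assumes \<phi>: "inner_vector \<phi>"
  shows "multiplier \<phi> (shift k x) = shift k (multiplier \<phi> x)"
  by (rule clinear_eqI[OF clinear_compose[OF clinear_multiplier[OF \<phi>] clinear_shift] clinear_compose[OF clinear_shift clinear_multiplier[OF \<phi>]]])
     (simp add: \<phi> shift_shift)

lemma multiplier_sym:
  assumes "inner_vector \<phi>" "inner_vector \<psi>"
  shows "multiplier \<phi> \<psi> = multiplier \<psi> \<phi>"
proof (rule ell2_eqI)
  fix i
  have "(\<Sum>k\<in>below i. coef \<psi> k * coef \<phi> (i - k)) = (\<Sum>k\<in>below i. coef \<psi> (i - k) * coef \<phi> k)"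
    by (cases i, rule sum.reindex_bij_witness[of _ "\<lambda>k. i - k" "\<lambda>k. i - k"]) (auto simp: below_def)
  then show "coef (multiplier \<phi> \<psi>) i = coef (multiplier \<psi> \<phi>) i"
    by (simp add: coef_multiplier assms mult.commute)
qed

text \<open>Used with \<open>c = 1\<close> to see that multiplication by an inner vector is isometric, and with \<open>c = 0\<close>
  to see that two ranges are orthogonal.\<close>

lemma cinner_multiplier_eqI:
  assumes A: "clinear A" "clinear B" and eq: "\<And>k l. cinner (A (delta k)) (B (delta l)) = c * cinner (delta k) (delta l)"
  shows "cinner (A x) (B y) = c * cinner x y"
proof -
  have 1: "cinner (A x) (B (delta l)) = c * cinner x (delta l)" for x l
  proof -
    let ?E = "{x. cinner (A x) (B (delta l)) = c * cinner x (delta l)}"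
    have "x \<in> ?E"
    proof (rule total_delta)
      show "closed ?E"
        by (intro closed_Collect_eq continuous_intros cinner.continuous_on clinear_continuous A)
      show "cvs.subspace ?E"
        by (auto simp: cvs.subspace_def clinearD[OF A(1)] cinner_simps algebra_simps)
    qed (use eq in auto)
    then show ?thesis by simp
  qed
  let ?E = "{y. cinner (A x) (B y) = c * cinner x y}"
  have "y \<in> ?E"
  proof (rule total_delta)
    show "closed ?E"
      by (intro closed_Collect_eq continuous_intros cinner.continuous_on clinear_continuous A)
    show "cvs.subspace ?E"
      by (auto simp: cvs.subspace_def clinearD[OF A(2)] cinner_simps algebra_simps)
  qed (use 1 in auto)
  then show ?thesis by simp
qed

lemma cinner_multiplier_multiplier [simp]:
  assumes \<phi>: "inner_vector \<phi>"
  shows "cinner (multiplier \<phi> x) (multiplier \<phi> y) = cinner x y"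
proof -
  have "cinner (multiplier \<phi> x) (multiplier \<phi> y) = 1 * cinner x y"
    by (rule cinner_multiplier_eqI[OF clinear_multiplier[OF \<phi>] clinear_multiplier[OF \<phi>]]) (simp add: \<phi> inner_vectorD)
  then show ?thesis by simp
qed

lemma norm_multiplier: "inner_vector \<phi> \<Longrightarrow> norm (multiplier \<phi> x) = norm x"
  by (simp add: norm_ell2_def inner_ell2_def)

lemma inner_vector_multiplier:
  assumes "inner_vector \<phi>" "inner_vector \<psi>"
  shows "inner_vector (multiplier \<phi> \<psi>)"
  unfolding inner_vector_def multiplier_shift[OF assms(1), symmetric] cinner_multiplier_multiplier[OF assms(1)]
  by (simp add: inner_vectorD[OF assms(2)])

lemma multiplier_multiplier:
  assumes \<phi>: "inner_vector \<phi>" and \<psi>: "inner_vector \<psi>"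
  shows "multiplier (multiplier \<phi> \<psi>) x = multiplier \<phi> (multiplier \<psi> x)"
  by (rule clinear_eqI[OF clinear_multiplier[OF inner_vector_multiplier[OF \<phi> \<psi>]] clinear_compose[OF clinear_multiplier[OF \<phi>] clinear_multiplier[OF \<psi>]]])
     (simp add: \<phi> \<psi> inner_vector_multiplier multiplier_shift)

lemma closed_range_multiplier:
  assumes \<phi>: "inner_vector \<phi>"
  shows "closed (range (multiplier \<phi>))"
  using complete_isometric_image[of 1 UNIV "multiplier \<phi>"] clinearD(1)[OF clinear_multiplier[OF \<phi>]] \<phi>
  by (auto simp: norm_multiplier complete_UNIV complete_imp_closed)

lemma csubspace_range_clinear: "clinear A \<Longrightarrow> cvs.subspace (range A)"
proof -
  assume A: "clinear A"
  show ?thesis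
    unfolding cvs.subspace_def
  proof (intro conjI ballI allI)
    show "0 \<in> range A" using clinearD(5)[OF A] rangeI[of A 0] by simp
    show "x + y \<in> range A" if "x \<in> range A" "y \<in> range A" for x y
      using that clinearD(2)[OF A] by (auto simp flip: clinearD(2)[OF A])
    show "c *\<^sub>C x \<in> range A" if "x \<in> range A" for c x
      using that by (auto simp flip: clinearD(4)[OF A])
  qed
qed


section \<open>Beurling theorem for subspaces reducing one variable\<close>

text \<open>Shifts along different axes doubly commute, so one of them can be moved across as a backward
  shift.\<close>

lemma cinner_shift_cross:
  "cinner (shift (a, 0) x) (shift (0, b) y) = cinner (shift (a, 0) (coshift (0, b) x)) y"
  "cinner (shift (0, b) x) (shift (a, 0) y) = cinner (shift (0, b) (coshift (a, 0) x)) y"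
  by (simp_all add: coshift_shift_commute flip: cinner_coshift)

lemma coshift_eq_0:
  assumes "coshift k x = 0" "l \<in> range ((+) k)"
  shows "coshift l x = 0"
proof -
  obtain j where "l = j + k" using assms(2) by (auto simp: add.commute)
  then have "coshift l x = coshift j (coshift k x)" by (simp add: coshift_coshift)
  then show ?thesis using assms(1) coshift_linear(3)[of j 0 0] by simp
qed

text \<open>After cancelling common factors the two monomials are either equal, or one of them is
  constant, or they are powers of different variables.  In the last case one of them can be moved across as a
  backward shift in direction \<open>d\<close>, which annihilates \<open>\<xi>\<close>.\<close>

lemma inner_vectorI:
  assumes n: "norm \<xi> = 1" and perp: "\<And>k. k \<noteq> 0 \<Longrightarrow> cinner (shift k \<xi>) \<xi> = 0"
    and L: "coshift d \<xi> = 0" "d \<in> {ez, ew}"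
  shows "inner_vector \<xi>"
proof -
  have *: "cinner (shift i \<xi>) (shift j \<xi>) = 0" if ij: "i \<noteq> j" for i j
  proof -
    obtain a b where i1: "i = (a, b)" by (cases i)
    obtain a' b' where i2: "j = (a', b')" by (cases j)
    note i = i1 i2
    define m where "m = (min a a', min b b')"
    have im: "i = m + (a - a', b - b')" and jm: "j = m + (a' - a, b' - b)" by (auto simp: i m_def)
    have eq: "cinner (shift i \<xi>) (shift j \<xi>) = cinner (shift (a - a', b - b') \<xi>) (shift (a' - a, b' - b) \<xi>)"
      by (subst im, subst jm) (simp flip: shift_shift)
    have perp': "cinner \<xi> (shift k \<xi>) = 0" if "k \<noteq> 0" for k using perp[OF that] cinner_eq_0_sym by blast
    have cr: "cinner (shift (p, 0) \<xi>) (shift (0, q) \<xi>) = 0" if "p > 0" "q > 0" for p q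
    proof (cases "d = ew")
      case True
      have "coshift (0, q) \<xi> = 0"
        by (rule coshift_eq_0[of ew]) (use True L that rangeI[of "(+) ew" "(0, q - 1)"] in auto)
      then show ?thesis using shift_linear(3)[of _ 0 0] by (simp add: cinner_shift_cross)
    next
      case False
      have "coshift (p, 0) \<xi> = 0"
        by (rule coshift_eq_0[of ez]) (use False L that rangeI[of "(+) ez" "(p - 1, 0)"] in auto)
      then have "cinner (shift (0, q) \<xi>) (shift (p, 0) \<xi>) = 0"
        using shift_linear(3)[of _ 0 0] by (simp add: cinner_shift_cross)
      then show ?thesis using cinner_eq_0_sym by blast
    qed
    consider "a \<ge> a'" "b \<ge> b'" | "a \<le> a'" "b \<le> b'" | "a > a'" "b < b'" | "a < a'" "b > b'" by linarith
    then show ?thesis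
    proof cases
      case 1
      then have "(a - a', b - b') \<noteq> 0" "(a' - a, b' - b) = 0" using ij by (auto simp: i zero_prod_def)
      then show ?thesis using perp unfolding eq by simp
    next
      case 2
      then have "(a' - a, b' - b) \<noteq> 0" "(a - a', b - b') = 0" using ij by (auto simp: i zero_prod_def)
      then show ?thesis using perp' unfolding eq by simp
    next
      case 3
      then have "a' - a = 0" "b - b' = 0" "a - a' > 0" "b' - b > 0" by auto
      then show ?thesis unfolding eq using cr by metis
    next
      case 4
      then have "a - a' = 0" "b' - b = 0" "a' - a > 0" "b - b' > 0" by auto
      then show ?thesis unfolding eq using cr cinner_eq_0_sym by metis
    qed
  qed
  then show ?thesis using n by (simp add: inner_vector_def cinner_self_norm)
qed

text \<open>If only zero in \<open>V\<close> were orthogonal to \<open>z V + w V\<close>, this sum would be dense in \<open>V\<close>.  Then, if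
  all elements of \<open>V\<close> vanish to order \<open>n\<close> at the origin, they vanish to order \<open>n + 1\<close>, and so \<open>V = 0\<close>.\<close>

lemma wandering_exists:
  assumes V: "shift_invariant V" and ne: "V \<noteq> {0}"
  obtains \<xi> where "\<xi> \<in> V" "norm \<xi> = 1" "\<And>v d. v \<in> V \<Longrightarrow> d \<in> {ez, ew} \<Longrightarrow> cinner \<xi> (shift d v) = 0"
proof -
  note cV = shift_invariantD[OF V]
  have "\<exists>\<xi>\<in>V. \<xi> \<noteq> 0 \<and> (\<forall>v\<in>V. \<forall>d\<in>{ez, ew}. cinner \<xi> (shift d v) = 0)"
  proof (rule ccontr)
    assume none: "\<not> ?thesis"
    \<comment> \<open>Vectors that vanish to order \<open>n\<close> at the origin.\<close>
    define Z where "Z n = {x. \<forall>i. fst i + snd i < n \<longrightarrow> coef x i = 0}" for n :: nat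
    have Z: "closed (Z n)" "cvs.subspace (Z n)" for n
    proof -
      have "Z n = (\<Inter>i\<in>{i. fst i + snd i < n}. {x. cinner x (delta i) = 0})" by (auto simp: Z_def)
      moreover have "closed {x. cinner x (delta i) = 0}" for i :: "nat \<times> nat"
        by (intro closed_Collect_eq continuous_intros cinner.continuous_on)
      ultimately show "closed (Z n)" by auto
      show "cvs.subspace (Z n)" by (auto simp: Z_def cvs.subspace_def)
    qed
    have ShZ: "shift d v \<in> Z (Suc n)" if "v \<in> Z n" "d \<in> {ez, ew}" for d v n
      using that by (auto simp: Z_def coef_shift)
    have "V \<subseteq> Z n" for n
    proof (induction n)
      case 0
      show ?case by (auto simp: Z_def)
    next
      case (Suc n)
      have K: "closed (V \<inter> Z (Suc n))" "cvs.subspace (V \<inter> Z (Suc n))"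
        using Z cV by (auto intro: closed_Int cvs.subspace_inter)
      show ?case
      proof
        fix v assume v: "v \<in> V"
        let ?x = "v - proj (V \<inter> Z (Suc n)) v"
        have "?x \<in> V" using v proj_in[OF K, of v] cV(2) cvs.subspace_diff by blast
        moreover have "cinner ?x (shift d u) = 0" if "u \<in> V" "d \<in> {ez, ew}" for d u
          using proj_orth[OF K] ShZ Suc that cV(3) by blast
        ultimately have "?x = 0" using none by blast
        then show "v \<in> Z (Suc n)" using proj_in[OF K, of v] by simp
      qed
    qed
    then have "v = 0" if "v \<in> V" for v
      using that by (intro ell2_eqI) (auto simp: Z_def)
    then show False using ne cV(2) cvs.subspace_0 by blast
  qed
  then obtain \<xi> where \<xi>: "\<xi> \<in> V" "\<xi> \<noteq> 0" "\<forall>v\<in>V. \<forall>d\<in>{ez, ew}. cinner \<xi> (shift d v) = 0" by blast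
  define \<eta> where "\<eta> = of_real (1 / norm \<xi>) *\<^sub>C \<xi>"
  have "\<eta> \<in> V" using \<xi> cV(2) by (auto simp: \<eta>_def cvs.subspace_scale)
  moreover have "norm \<eta> = 1" using \<xi>(2) by (simp add: \<eta>_def norm_divide)
  moreover have "cinner \<eta> (shift d v) = 0" if "v \<in> V" "d \<in> {ez, ew}" for v d
    using bspec[OF bspec[OF \<xi>(3) that(1)] that(2)] by (simp add: \<eta>_def)
  ultimately show thesis using that by blast
qed

text \<open>The vector \<open>shift d (coshift d \<xi>)\<close> lies in the space to which \<open>\<xi>\<close> is orthogonal, so
  \<open>coshift d \<xi> = 0\<close>: a wandering vector depends only on the other variable.\<close>

lemma wandering_inner:
  assumes V: "shift_invariant V" and d: "d \<in> {ez, ew}" "coshift d ` V \<subseteq> V" and ne: "V \<noteq> {0}"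
  obtains \<xi> where "\<xi> \<in> V" "inner_vector \<xi>" "coshift d \<xi> = 0"
    "\<And>v d. v \<in> V \<Longrightarrow> d \<in> {ez, ew} \<Longrightarrow> cinner \<xi> (shift d v) = 0"
proof -
  obtain \<xi> where \<xi>: "\<xi> \<in> V" "norm \<xi> = 1"
    and perp: "\<And>v d. v \<in> V \<Longrightarrow> d \<in> {ez, ew} \<Longrightarrow> cinner \<xi> (shift d v) = 0"
    using wandering_exists[OF V ne] by metis
  have "cinner (coshift d \<xi>) (coshift d \<xi>) = 0" using perp[of "coshift d \<xi>" d] d \<xi>(1) by (auto simp: cinner_coshift)
  then have L: "coshift d \<xi> = 0" by (simp add: cinner_self_norm)
  have "cinner (shift k \<xi>) \<xi> = 0" if "k \<noteq> 0" for k
  proof -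
    have "\<exists>e\<in>{ez, ew}. \<exists>l. k = e + l"
    proof (cases "fst k = 0")
      case True
      then have "k = ew + (0, snd k - 1)" using \<open>k \<noteq> 0\<close> by (cases k) (auto simp: zero_prod_def)
      then show ?thesis by blast
    next
      case False
      then have "k = ez + (fst k - 1, snd k)" by (cases k) auto
      then show ?thesis by blast
    qed
    then obtain e l where e: "e \<in> {ez, ew}" "k = e + l" by blast
    have "cinner \<xi> (shift e (shift l \<xi>)) = 0" by (intro perp shift_invariant_shift V \<xi> e)
    then show ?thesis unfolding e(2) shift_shift using cinner_eq_0_sym by blast
  qed
  then have "inner_vector \<xi>" using \<xi>(2) L d(1) by (intro inner_vectorI) auto
  then show thesis using that \<xi>(1) L perp by blast
qed

definition axis_multiple :: "nat \<Rightarrow> nat \<times> nat \<Rightarrow> nat \<times> nat" where "axis_multiple n d = (n * fst d, n * snd d)"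

lemma axis_multiple_decomp:
  assumes de: "d = ez \<and> e = ew \<or> d = ew \<and> e = ez" and k: "\<nexists>l. k = e + l"
  shows "\<exists>b. k = axis_multiple b d"
proof -
  obtain p q where pq: "k = (p, q)" by (cases k)
  show ?thesis
    using de
  proof (elim disjE conjE)
    assume d: "d = ez" "e = ew"
    have "q = 0"
    proof (rule ccontr)
      assume "q \<noteq> 0"
      then have "k = e + (p, q - 1)" by (simp add: d pq)
      with k show False by blast
    qed
    then show ?thesis by (intro exI[of _ p]) (simp add: d pq axis_multiple_def)
  next
    assume d: "d = ew" "e = ez"
    have "p = 0"
    proof (rule ccontr)
      assume "p \<noteq> 0"
      then have "k = e + (p - 1, q)" by (simp add: d pq)
      with k show False by blast
    qed
    then show ?thesis by (intro exI[of _ q]) (simp add: d pq axis_multiple_def)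
  qed
qed

lemma coef_zero_of_coshift:
  assumes "coshift d x = 0"
  shows "coef x (d + k) = 0"
  using assms coef_coshift[of d x k] by simp

lemma coef_zero_off_axis:
  assumes de: "d = ez \<and> e = ew \<or> d = ew \<and> e = ez" and L: "coshift d \<xi> = 0"
    and k: "k \<notin> range (\<lambda>n. axis_multiple n e)"
  shows "coef \<xi> k = 0"
proof -
  have "\<exists>l. k = d + l" using axis_multiple_decomp[of e d k] de k by blast
  then show ?thesis using coef_zero_of_coshift[OF L] by blast
qed

text \<open>The part \<open>W\<close> of \<open>V\<close> orthogonal to all multiples of a wandering vector \<open>\<xi>\<close> has the same invariance
  properties as \<open>V\<close>.  A wandering vector \<open>\<eta>\<close> of \<open>W\<close> would make the ranges of multiplication by \<open>\<xi>\<close> and \<open>\<eta>\<close>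
  orthogonal, although both contain the unit vector \<open>\<xi> \<eta> = \<eta> \<xi>\<close>.\<close>

lemma beurling:
  assumes V: "shift_invariant V" and de: "{d, e} = {ez, ew}" and LV: "coshift d ` V \<subseteq> V" and ne: "V \<noteq> {0}"
  obtains \<xi> where "inner_vector \<xi>" "coshift d \<xi> = 0" "V = range (multiplier \<xi>)"
proof -
  have ed: "d \<in> {ez, ew}" "e \<in> {ez, ew}" using de by blast+
  have de': "d = ez \<and> e = ew \<or> d = ew \<and> e = ez" using de by (auto simp: doubleton_eq_iff)
  note cV = shift_invariantD[OF V]
  obtain \<xi> where \<xi>: "\<xi> \<in> V" "inner_vector \<xi>" "coshift d \<xi> = 0"
    and perp: "\<And>v d. v \<in> V \<Longrightarrow> d \<in> {ez, ew} \<Longrightarrow> cinner \<xi> (shift d v) = 0"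
    by (rule wandering_inner[OF V ed(1) LV ne]) (rule that)
  define W where "W = V \<inter> ortho (range (\<lambda>k. shift k \<xi>))"
  have Wiff: "g \<in> W \<longleftrightarrow> g \<in> V \<and> (\<forall>k. cinner g (shift k \<xi>) = 0)" for g by (auto simp: W_def ortho_def)
  have WL: "coshift d g \<in> W" if "g \<in> W" for g
    using that LV unfolding Wiff cinner_coshift shift_shift by blast
  have LdV: "coshift (axis_multiple b d) g \<in> V" if "g \<in> V" for b g
  proof (induction b)
    case (Suc b)
    have "coshift (axis_multiple (Suc b) d) g = coshift d (coshift (axis_multiple b d) g)" by (cases d) (simp add: coshift_coshift axis_multiple_def ac_simps)
    then show ?case using Suc LV by auto
  qed (use that in \<open>simp add: axis_multiple_def flip: zero_prod_def\<close>)
  have We: "shift e g \<in> W" if g: "g \<in> W" for g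
  proof -
    have "cinner (shift e g) (shift k \<xi>) = 0" for k
    proof (cases "\<exists>l. k = e + l")
      case True
      then obtain l where "k = e + l" by blast
      then have "cinner (shift e g) (shift k \<xi>) = cinner g (shift l \<xi>)" by (simp flip: shift_shift)
      then show ?thesis using g unfolding Wiff by simp
    next
      case False
      then obtain b where k: "k = axis_multiple b d" using axis_multiple_decomp[OF de'] by blast
      have "cinner (shift e g) (shift k \<xi>) = cinner (shift e (coshift k g)) \<xi>"
        using de' cinner_shift_cross(1)[of 1 g b \<xi>] cinner_shift_cross(2)[of 1 g b \<xi>] by (auto simp: k axis_multiple_def)
      also have "\<dots> = 0"
        using perp[of "coshift k g" e] LdV g ed(2) cinner_eq_0_sym unfolding k Wiff by blast
      finally show ?thesis .
    qed
    then show ?thesis using g cV(3)[of e] ed by (auto simp: Wiff)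
  qed
  have Wd: "shift d g \<in> W" if g: "g \<in> W" for g
  proof -
    have "cinner (shift d g) (shift k \<xi>) = 0" for k
    proof (cases "\<exists>l. k = d + l")
      case True
      then obtain l where "k = d + l" by blast
      then have "cinner (shift d g) (shift k \<xi>) = cinner g (shift l \<xi>)" by (simp flip: shift_shift)
      then show ?thesis using g unfolding Wiff by simp
    next
      case False
      then obtain b where k: "k = axis_multiple b e" using axis_multiple_decomp[of e d k] de' by blast
      have "coshift d (shift k \<xi>) = shift k (coshift d \<xi>)"
        using de' coshift_shift_commute(1)[of 1 b \<xi>] coshift_shift_commute(2)[of 1 b \<xi>] by (auto simp: k axis_multiple_def)
      then have "coshift d (shift k \<xi>) = 0" using \<xi>(3) shift_linear(3)[of k 0 0] by simp
      then show ?thesis by (simp add: cinner_shift cinner.zero_right)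
    qed
    then show ?thesis using g cV(3)[of d] ed by (auto simp: Wiff)
  qed
  have LW: "coshift d ` W \<subseteq> W" using WL by blast
  have W: "shift_invariant W"
    using cV(1,2) closed_ortho csubspace_ortho We Wd de'
    unfolding shift_invariant_def by (auto simp: W_def intro!: closed_Int cvs.subspace_inter)
  have "W = {0}"
  proof (rule ccontr)
    assume "W \<noteq> {0}"
    obtain \<eta> where \<eta>: "\<eta> \<in> W" "inner_vector \<eta>"
      by (rule wandering_inner[OF W ed(1) LW \<open>W \<noteq> {0}\<close>]) (rule that)
    have "cinner (shift j \<eta>) (shift k \<xi>) = 0" for j k
      using shift_invariant_shift[OF W \<eta>(1)] unfolding Wiff by blast
    then have "cinner (multiplier \<eta> \<xi>) (multiplier \<xi> \<eta>) = 0"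
      using cinner_multiplier_eqI[OF clinear_multiplier[OF \<eta>(2)] clinear_multiplier[OF \<xi>(2)], of 0 \<xi> \<eta>]
      by (simp add: \<eta>(2) \<xi>(2))
    then have "norm (multiplier \<eta> \<xi>) = 0" using multiplier_sym[OF \<eta>(2) \<xi>(2)] by (simp add: cinner_self_norm)
    then have "norm \<xi> = 0" by (simp add: norm_multiplier \<eta>(2))
    moreover have "cinner \<xi> \<xi> = 1" using inner_vectorD[OF \<xi>(2), of 0 0] by simp
    ultimately show False by simp
  qed
  have R: "closed (range (multiplier \<xi>))" "cvs.subspace (range (multiplier \<xi>))"
    using \<xi>(2) by (auto intro: closed_range_multiplier csubspace_range_clinear clinear_multiplier)
  have RV: "range (multiplier \<xi>) \<subseteq> V"
  proof -
    have "x \<in> multiplier \<xi> -` V" for x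
    proof (rule total_delta)
      show "closed (multiplier \<xi> -` V)" by (rule closed_vimage[OF cV(1) clinear_continuous[OF clinear_multiplier[OF \<xi>(2)]]])
      show "cvs.subspace (multiplier \<xi> -` V)"
        using cV(2) by (auto simp: cvs.subspace_def clinearD[OF clinear_multiplier[OF \<xi>(2)]])
    qed (use shift_invariant_shift[OF V \<xi>(1)] \<xi>(2) in auto)
    then show ?thesis by auto
  qed
  moreover have "V \<subseteq> range (multiplier \<xi>)"
  proof
    fix g assume g: "g \<in> V"
    have "g - proj (range (multiplier \<xi>)) g \<in> V" using g proj_in[OF R, of g] RV cV(2) cvs.subspace_diff by blast
    moreover have "cinner (g - proj (range (multiplier \<xi>)) g) (shift k \<xi>) = 0" for k
      by (rule proj_orth[OF R]) (metis multiplier_delta \<xi>(2) rangeI)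
    ultimately have "g - proj (range (multiplier \<xi>)) g \<in> W" unfolding Wiff by blast
    then show "g \<in> range (multiplier \<xi>)" using \<open>W = {0}\<close> proj_in[OF R, of g] by simp
  qed
  ultimately show thesis using that \<xi> by blast
qed


section \<open>A Hankel form attached to an inner vector\<close>

text \<open>The form \<open>\<langle>z w x y, \<Phi>\<rangle>\<close> cannot be defined through the product \<open>x y\<close>, which need not be square
  summable.  It is linear in \<open>x\<close>, and for inner \<open>\<Phi>\<close> this is the vector that represents it.\<close>

definition hankel_vec :: "(nat \<times> nat) ell2 \<Rightarrow> (nat \<times> nat) ell2 \<Rightarrow> (nat \<times> nat) ell2" where
  "hankel_vec \<Phi> y = Abs_ell2 (\<lambda>k. cinner \<Phi> (shift (k + (1, 1)) y))"

text \<open>Reversing the exponents at a large monomial \<open>z\<^sup>N\<close> turns \<open>\<langle>\<Phi>, z\<^sup>k\<^sup>+\<^sup>1 y\<rangle>\<close> into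
  \<open>\<langle>z\<^sup>N\<^sup>-\<^sup>k \<Phi>, z\<^sup>N\<^sup>+\<^sup>1 y\<rangle>\<close>, where the right argument no longer depends on \<open>k\<close> and the left ones are orthonormal.
  Bessel's inequality gives the bound.\<close>

lemma hankel_vec_bound:
  assumes \<Phi>: "inner_vector \<Phi>" and F: "finite F"
  shows "(\<Sum>k\<in>F. (cmod (cinner \<Phi> (shift (k + (1, 1)) y)))\<^sup>2) \<le> (norm y)\<^sup>2"
proof -
  define c where "c k = cinner \<Phi> (shift (k + (1, 1)) y)" for k
  \<comment> \<open>A common multiple of the finitely many exponents, at which they are reversed.\<close>
  define N where "N = (Max (insert 0 (fst ` F)), Max (insert 0 (snd ` F)))"
  have N: "fst k \<le> fst N" "snd k \<le> snd N" if "k \<in> F" for k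
    using that F by (auto simp: N_def)
  have split: "N = k + (N - k)" if "k \<in> F" for k
    using N[OF that] by (cases k; cases N) simp
  have inj: "inj_on (\<lambda>k. N - k) F"
  proof (rule inj_onI)
    fix k l assume "k \<in> F" "l \<in> F" "N - k = N - l"
    then have "k + (N - k) = l + (N - k)" using split by metis
    then show "k = l" by simp
  qed
  have ck: "c k = cinner (shift (N - k) \<Phi>) (shift (N + (1, 1)) y)" if "k \<in> F" for k
  proof -
    have "N + (1, 1) = (N - k) + (k + (1, 1))"
      by (subst split[OF that]) (simp only: ac_simps)
    then have "shift (N + (1, 1)) y = shift (N - k) (shift (k + (1, 1)) y)" by (simp only: shift_shift)
    then show ?thesis by (simp add: c_def)
  qed
  define s where "s = (\<Sum>k\<in>F. (cmod (c k))\<^sup>2)"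
  define u where "u = (\<Sum>k\<in>F. cnj (c k) *\<^sub>C shift (N - k) \<Phi>)"
  have s0: "s \<ge> 0" by (simp add: s_def sum_nonneg)
  have nu: "(norm u)\<^sup>2 = s"
    unfolding u_def s_def using orthonormal_sum[OF \<Phi> F inj, of "\<lambda>k. cnj (c k)"] by simp
  have "cinner u (shift (N + (1, 1)) y) = of_real s"
    unfolding u_def s_def cinner.sum_left of_real_sum
    by (intro sum.cong refl) (simp only: cinner_scaleC_left ck[symmetric] complex_norm_square mult.commute)
  then have "s = cmod (cinner u (shift (N + (1, 1)) y))" using s0 by simp
  also have "\<dots> \<le> norm u * norm y" using norm_cinner_le[of u "shift (N + (1, 1)) y"] by simp
  finally have le: "(norm u)\<^sup>2 \<le> norm u * norm y" by (simp add: nu)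
  have "norm u \<le> norm y"
  proof (cases "norm u = 0")
    case False
    then show ?thesis using le by (simp add: power2_eq_square)
  qed simp
  then have "(norm u)\<^sup>2 \<le> (norm y)\<^sup>2" by (intro power_mono) auto
  then show ?thesis unfolding nu s_def c_def .
qed

lemma coef_hankel_vec:
  assumes \<Phi>: "inner_vector \<Phi>"
  shows "coef (hankel_vec \<Phi> y) k = cinner \<Phi> (shift (k + (1, 1)) y)"
proof -
  have "(\<lambda>k. (cmod (cinner \<Phi> (shift (k + (1, 1)) y)))\<^sup>2) summable_on UNIV"
    using hankel_vec_bound[OF \<Phi>, of _ y] by (intro nonneg_bdd_above_summable_on) (auto intro!: bdd_aboveI2)
  then show ?thesis unfolding hankel_vec_def by (subst Abs_ell2_inverse) auto
qed

definition hankel_form :: "(nat \<times> nat) ell2 \<Rightarrow> (nat \<times> nat) ell2 \<Rightarrow> (nat \<times> nat) ell2 \<Rightarrow> complex" where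
  "hankel_form \<Phi> x y = cinner x (hankel_vec \<Phi> y)"

definition cbilinear :: "('i ell2 \<Rightarrow> 'j ell2 \<Rightarrow> complex) \<Rightarrow> bool" where
  "cbilinear B \<longleftrightarrow> bounded_bilinear B \<and> (\<forall>c x y. B (c *\<^sub>C x) y = c * B x y) \<and> (\<forall>c x y. B x (c *\<^sub>C y) = c * B x y)"

lemma cbilinearD:
  assumes "cbilinear B"
  shows "bounded_bilinear B" "B (c *\<^sub>C x) y = c * B x y" "B x (c *\<^sub>C y) = c * B x y"
    "B (x + x') y = B x y + B x' y" "B x (y + y') = B x y + B x y'"
    "B (x - x') y = B x y - B x' y" "B x (y - y') = B x y - B x y'"
    "B 0 y = 0" "B x 0 = 0"
proof -
  interpret bounded_bilinear B using assms by (simp add: cbilinear_def)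
  show "bounded_bilinear B" by (rule bounded_bilinear_axioms)
  show "B (c *\<^sub>C x) y = c * B x y" "B x (c *\<^sub>C y) = c * B x y" using assms by (auto simp: cbilinear_def)
  show "B (x + x') y = B x y + B x' y" "B x (y + y') = B x y + B x y'"
    "B (x - x') y = B x y - B x' y" "B x (y - y') = B x y - B x y'"
    "B 0 y = 0" "B x 0 = 0"
    by (rule add_left add_right diff_left diff_right zero_left zero_right)+
qed

lemma cbilinear_hankel_form:
  assumes \<Phi>: "inner_vector \<Phi>"
  shows "cbilinear (hankel_form \<Phi>)"
proof -
  have add: "hankel_vec \<Phi> (x + y) = hankel_vec \<Phi> x + hankel_vec \<Phi> y" for x y
    by (rule ell2_eqI) (simp add: coef_hankel_vec[OF \<Phi>] shift_linear cinner.add_right)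
  have sc: "hankel_vec \<Phi> (c *\<^sub>C x) = cnj c *\<^sub>C hankel_vec \<Phi> x" for c x
    by (rule ell2_eqI) (simp add: coef_hankel_vec[OF \<Phi>] shift_linear)
  have n: "norm (hankel_vec \<Phi> y) \<le> norm y" for y
  proof -
    have "(norm (hankel_vec \<Phi> y))\<^sup>2 \<le> (norm y)\<^sup>2"
      unfolding norm_ell2_sum[of "hankel_vec \<Phi> y"] using hankel_vec_bound[OF \<Phi>, of _ y]
      by (intro infsum_le_finite_sums square_summable_coef) (auto simp: coef_hankel_vec[OF \<Phi>])
    then show ?thesis by (rule power2_le_imp_le) simp
  qed
  have b: "cmod (hankel_form \<Phi> x y) \<le> norm x * norm y * 1" for x y
    using norm_cinner_le[of x "hankel_vec \<Phi> y"] mult_left_mono[OF n[of y], of "norm x"] by (simp add: hankel_form_def)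
  have "bounded_bilinear (hankel_form \<Phi>)"
  proof
    show "\<exists>K. \<forall>a b. cmod (hankel_form \<Phi> a b) \<le> norm a * norm b * K" using b by blast
  qed (simp_all add: hankel_form_def add sc cinner.add_left cinner.add_right scaleR_scaleC scaleR_conv_of_real)
  then show ?thesis by (simp add: cbilinear_def hankel_form_def sc)
qed

lemma cbilinear_left_total:
  assumes B: "cbilinear B" "cbilinear B'" and C: "closed V" "\<And>x. x \<in> C \<Longrightarrow> B x y = B' x y"
    and V: "V \<subseteq> closure (cvs.span C)" "x \<in> V"
  shows "B x y = B' x y"
proof -
  let ?E = "{x. B x y = B' x y}"
  have "closed ?E"
    by (intro closed_Collect_eq bounded_bilinear.continuous_on[OF cbilinearD(1)[OF B(1)]]
        bounded_bilinear.continuous_on[OF cbilinearD(1)[OF B(2)]] continuous_intros)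
  moreover have "cvs.subspace ?E"
    by (auto simp: cvs.subspace_def cbilinearD[OF B(1)] cbilinearD[OF B(2)])
  ultimately have "closure (cvs.span C) \<subseteq> ?E"
    using C(2) by (intro closure_minimal cvs.span_minimal) auto
  then show ?thesis using V by auto
qed

lemma cbilinear_swap: "cbilinear B \<Longrightarrow> cbilinear (\<lambda>x y. B y x)"
  by (auto simp: cbilinear_def bounded_bilinear.flip)

lemma cbilinear_comp:
  assumes B: "cbilinear B" and A: "clinear A" "clinear A'"
  shows "cbilinear (\<lambda>x y. B (A x) (A' y))"
  using bounded_bilinear.comp[OF cbilinearD(1)[OF B] clinearD(1)[OF A(1)] clinearD(1)[OF A(2)]]
  by (auto simp: cbilinear_def cbilinearD[OF B] clinearD[OF A(1)] clinearD[OF A(2)])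

lemma delta_dense: "UNIV \<subseteq> closure (cvs.span (range delta))"
proof -
  have "x \<in> closure (cvs.span (range delta))" for x :: "'i ell2"
  proof (rule total_delta)
    show "cvs.subspace (closure (cvs.span (range delta)) :: 'i ell2 set)"
    proof -
      let ?S = "cvs.span (range delta) :: 'i ell2 set"
      have S: "cvs.subspace ?S" by (rule cvs.subspace_span)
      show ?thesis
        unfolding cvs.subspace_def
      proof (intro conjI ballI allI)
        show "0 \<in> closure ?S" using S cvs.subspace_0 closure_subset by blast
        fix x y assume "x \<in> closure ?S" "y \<in> closure ?S"
        then obtain f g where "\<forall>n. f n \<in> ?S" "f \<longlonglongrightarrow> x" "\<forall>n. g n \<in> ?S" "g \<longlonglongrightarrow> y"
          unfolding closure_sequential by blast
        then show "x + y \<in> closure ?S" unfolding closure_sequential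
          using S by (intro exI[of _ "\<lambda>n. f n + g n"]) (auto intro: tendsto_add cvs.subspace_add)
      next
        fix c x assume "x \<in> closure ?S"
        then obtain f where "\<forall>n. f n \<in> ?S" "f \<longlonglongrightarrow> x"
          unfolding closure_sequential by blast
        then show "c *\<^sub>C x \<in> closure ?S" unfolding closure_sequential
          using S by (intro exI[of _ "\<lambda>n. c *\<^sub>C f n"])
            (auto intro: bounded_linear.tendsto[OF bounded_linear_scaleC] cvs.subspace_scale)
      qed
    qed
    show "delta k \<in> closure (cvs.span (range delta))" for k :: 'i
      by (meson closure_subset cvs.span_base rangeI subsetD)
  qed simp
  then show ?thesis by blast
qed

lemma cbilinear_eqI:
  assumes B: "cbilinear B" "cbilinear B'" and eq: "\<And>k l. B (delta k) (delta l) = B' (delta k) (delta l)"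
  shows "B x y = B' x y"
proof -
  have "B x (delta l) = B' x (delta l)" for x l
    by (rule cbilinear_left_total[OF B closed_UNIV _ delta_dense]) (use eq in auto)
  then have "B x y = B' x y" for x y
    using cbilinear_left_total[OF cbilinear_swap[OF B(1)] cbilinear_swap[OF B(2)] closed_UNIV _ delta_dense, of x y] by auto
  then show ?thesis .
qed

lemma hankel_form_delta_delta:
  assumes "inner_vector \<Phi>"
  shows "hankel_form \<Phi> (delta k) (delta l) = cnj (coef \<Phi> (k + (1, 1) + l))"
  by (simp add: hankel_form_def coef_hankel_vec[OF assms])

lemma hankel_form_sym:
  assumes \<Phi>: "inner_vector \<Phi>"
  shows "hankel_form \<Phi> x y = hankel_form \<Phi> y x"
  by (rule cbilinear_eqI[OF cbilinear_hankel_form[OF \<Phi>] cbilinear_swap[OF cbilinear_hankel_form[OF \<Phi>]]])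
     (simp add: hankel_form_delta_delta[OF \<Phi>] ac_simps)

lemma hankel_form_shift:
  assumes \<Phi>: "inner_vector \<Phi>"
  shows "hankel_form \<Phi> (shift k x) y = hankel_form \<Phi> x (shift k y)"
  by (rule cbilinear_eqI[OF cbilinear_comp[OF cbilinear_hankel_form[OF \<Phi>] clinear_shift clinear_id] cbilinear_comp[OF cbilinear_hankel_form[OF \<Phi>] clinear_id clinear_shift]])
     (simp add: hankel_form_delta_delta[OF \<Phi>] ac_simps)

text \<open>If \<open>x\<close> is inner, the product \<open>x y\<close> is square summable and the form has its naive value.\<close>

lemma hankel_form_multiplier:
  assumes \<Phi>: "inner_vector \<Phi>" and x: "inner_vector x"
  shows "hankel_form \<Phi> (shift k x) (shift l y) = cinner (shift (k + l + (1, 1)) (multiplier x y)) \<Phi>"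
proof -
  let ?E = "{y. hankel_form \<Phi> x y = cinner (shift (1, 1) (multiplier x y)) \<Phi>}"
  have "y \<in> ?E" for y
  proof (rule total_delta)
    show "closed ?E"
      by (intro closed_Collect_eq bounded_bilinear.continuous_on[OF cbilinearD(1)[OF cbilinear_hankel_form[OF \<Phi>]]]
          cinner.continuous_on clinear_continuous clinear_compose[OF clinear_shift clinear_multiplier[OF x]] continuous_intros)
    show "cvs.subspace ?E"
      by (auto simp: cvs.subspace_def cbilinearD[OF cbilinear_hankel_form[OF \<Phi>]] clinearD[OF clinear_multiplier[OF x]]
          shift_linear clinearD(5)[OF clinear_shift] cinner.add_left cinner.zero_left)
    fix l
    have "hankel_form \<Phi> x (delta l) = hankel_form \<Phi> (delta 0) (shift l x)"
      using hankel_form_shift[OF \<Phi>, of l x "delta 0"] hankel_form_sym[OF \<Phi>, of "shift l x"] by simp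
    also have "\<dots> = cnj (cinner \<Phi> (shift (0 + (1, 1)) (shift l x)))"
      unfolding hankel_form_def cinner_delta_left coef_hankel_vec[OF \<Phi>] ..
    finally show "delta l \<in> ?E" using x by (simp add: cnj_cinner)
  qed
  then have *: "hankel_form \<Phi> x y = cinner (shift (1, 1) (multiplier x y)) \<Phi>" for y by simp
  show ?thesis
    unfolding hankel_form_shift[OF \<Phi>] * multiplier_shift[OF x] shift_shift by (simp add: ac_simps)
qed


section \<open>Singly generated submodules\<close>

text \<open>Cancelling \<open>\<phi>\<^sup>2\<close> by isometry, \<open>\<langle>z w \<phi>\<^sup>2 a b, \<phi>\<^sup>2 \<psi>\<^sup>2\<rangle> = \<langle>z w a b, \<psi>\<^sup>2\<rangle>\<close>.  The monomials of
  \<open>z w a b\<close> contain both variables, those of \<open>\<psi>\<^sup>2\<close> only one.\<close>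

lemma hankel_form_vanishes:
  assumes \<phi>: "inner_vector \<phi>" and \<psi>: "inner_vector \<psi>" and d: "coshift d \<psi> = 0" "d \<in> {ez, ew}"
  defines "P \<equiv> multiplier \<phi> \<psi>"
  shows "hankel_form (multiplier P P) (multiplier \<phi> a) (multiplier \<phi> b) = 0"
proof -
  have P: "inner_vector P" unfolding P_def by (rule inner_vector_multiplier[OF \<phi> \<psi>])
  have \<Phi>: "inner_vector (multiplier P P)" by (rule inner_vector_multiplier[OF P P])
  have comm: "multiplier \<psi> (multiplier \<phi> x) = multiplier \<phi> (multiplier \<psi> x)" for x
    using multiplier_multiplier[OF \<phi> \<psi>, of x] multiplier_multiplier[OF \<psi> \<phi>, of x] multiplier_sym[OF \<phi> \<psi>] by simp
  \<comment> \<open>The order matters: the two factors \<open>\<phi>\<close> have to come first to be cancelled below.\<close>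
  have PP: "multiplier P P = multiplier \<phi> (multiplier \<phi> (multiplier \<psi> \<psi>))"
    unfolding P_def multiplier_multiplier[OF \<phi> \<psi>] comm ..
  have c0: "coef (multiplier \<psi> \<psi>) (d + k) = 0" for k
    unfolding coef_multiplier[OF \<psi>]
  proof (rule sum.neutral, rule ballI)
    fix l assume l: "l \<in> below (d + k)"
    obtain a b where l': "l = (a, b)" by (cases l)
    obtain p q where k': "k = (p, q)" by (cases k)
    have "(\<exists>j. l = d + j) \<or> (\<exists>j. d + k - l = d + j)"
    proof (cases "d = ez")
      case True
      then show ?thesis
      proof (cases a)
        case 0
        then have "d + k - l = d + (p, q - b)" using True by (simp add: l' k')
        then show ?thesis by blast
      next
        case (Suc a')
        then have "l = d + (a', b)" using True by (simp add: l')
        then show ?thesis by blast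
      qed
    next
      case False
      then have d': "d = ew" using d(2) by simp
      show ?thesis
      proof (cases b)
        case 0
        then have "d + k - l = d + (p - a, q)" using d' by (simp add: l' k')
        then show ?thesis by blast
      next
        case (Suc b')
        then have "l = d + (a, b')" using d' by (simp add: l')
        then show ?thesis by blast
      qed
    qed
    then show "coef \<psi> l * coef \<psi> (d + k - l) = 0"
      using coef_zero_of_coshift[OF d(1)] by auto
  qed
  have z: "hankel_form (multiplier P P) (shift i \<phi>) (shift j \<phi>) = 0" for i j
  proof -
    have e: "\<exists>j. i + j' + (1, 1) = d + j" for i j' :: "nat \<times> nat"
    proof -
      have "(1, 1) = ez + ew" by simp
      then have "i + j' + (1, 1) = d + (i + j' + (if d = ez then ew else ez))"
        using d(2) by (auto simp: ac_simps)
      then show ?thesis by blast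
    qed
    have "hankel_form (multiplier P P) (shift i \<phi>) (shift j \<phi>) = cinner (multiplier \<phi> (multiplier \<phi> (delta (i + j + (1, 1))))) (multiplier P P)"
      by (simp add: hankel_form_multiplier[OF \<Phi> \<phi>] \<phi> multiplier_shift)
    also have "\<dots> = cnj (coef (multiplier \<psi> \<psi>) (i + j + (1, 1)))"
      unfolding PP by (simp only: cinner_multiplier_multiplier[OF \<phi>] cinner_delta_left)
    also have "\<dots> = 0" using e[of i j] c0 by auto
    finally show ?thesis .
  qed
  have zero: "cbilinear (\<lambda>x y. 0)" by (simp add: cbilinear_def bounded_bilinear_def exI[of _ 0])
  show ?thesis
    by (rule cbilinear_eqI[OF cbilinear_comp[OF cbilinear_hankel_form[OF \<Phi>] clinear_multiplier[OF \<phi>] clinear_multiplier[OF \<phi>]] zero])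
       (simp add: \<phi> z)
qed

text \<open>The form \<open>\<omega>(g, h) = N(A g, h)\<close> with \<open>A\<close> the difference of the projections onto \<open>V\<^sub>1\<close> and \<open>V\<^sub>2\<close>
  picks out the mixed terms of \<open>N\<close> with opposite signs.  Vectors in both \<open>V\<^sub>1\<close> and \<open>V\<^sub>2\<close> pair to zero with all of
  \<open>T\<close> under \<open>N\<close>, so any decomposition \<open>g = u + v\<close> with \<open>u\<close> in \<open>V\<^sub>1\<close> and \<open>v\<close> in \<open>V\<^sub>2\<close> computes \<open>\<omega>\<close>.  For the
  multiples of \<open>f = x\<^sub>0 + y\<^sub>0\<close> this gives \<open>N(p x\<^sub>0, q y\<^sub>0) - N(p y\<^sub>0, q x\<^sub>0) = 0\<close>, since both terms are
  \<open>N(x\<^sub>0, p q y\<^sub>0)\<close>.\<close>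

lemma cyclic_hankel_form_vanishes:
  assumes T: "closed T" "cvs.subspace T" "f \<in> T" "T \<subseteq> closure (cvs.span (range (\<lambda>k. shift k f)))"
    and V: "shift_invariant V1" "shift_invariant V2" "V1 \<subseteq> T" "V2 \<subseteq> T"
    and p12: "\<And>x. x \<in> T \<Longrightarrow> (\<And>v. v \<in> V1 \<Longrightarrow> cinner x v = 0) \<Longrightarrow> x \<in> V2"
    and p21: "\<And>x. x \<in> T \<Longrightarrow> (\<And>v. v \<in> V2 \<Longrightarrow> cinner x v = 0) \<Longrightarrow> x \<in> V1"
    and \<Phi>: "inner_vector \<Phi>"
    and z1: "\<And>x y. x \<in> V1 \<Longrightarrow> y \<in> V1 \<Longrightarrow> hankel_form \<Phi> x y = 0"
    and z2: "\<And>x y. x \<in> V2 \<Longrightarrow> y \<in> V2 \<Longrightarrow> hankel_form \<Phi> x y = 0"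
    and xy: "x \<in> V1" "y \<in> V2"
  shows "hankel_form \<Phi> x y = 0"
proof -
  note V1 = shift_invariantD(1,2)[OF V(1)] and V2 = shift_invariantD(1,2)[OF V(2)]
  note F = cbilinearD[OF cbilinear_hankel_form[OF \<Phi>]]
  have r1: "x - proj V1 x \<in> V2" if "x \<in> T" for x
    using that T(2) V(3) proj_in[OF V1] proj_orth[OF V1] by (intro p12 cvs.subspace_diff) auto
  have r2: "x - proj V2 x \<in> V1" if "x \<in> T" for x
    using that T(2) V(4) proj_in[OF V2] proj_orth[OF V2] by (intro p21 cvs.subspace_diff) auto
  have p1: "proj V1 x \<in> V2" if "x \<in> V2" for x
  proof -
    have "x - (x - proj V1 x) \<in> V2" by (rule cvs.subspace_diff[OF V2(2) that r1]) (use that V(4) in blast)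
    then show ?thesis by (simp only: diff_diff_eq2 add_diff_cancel_left')
  qed
  have p2: "proj V2 x \<in> V1" if "x \<in> V1" for x
  proof -
    have "x - (x - proj V2 x) \<in> V1" by (rule cvs.subspace_diff[OF V1(2) that r2]) (use that V(3) in blast)
    then show ?thesis by (simp only: diff_diff_eq2 add_diff_cancel_left')
  qed
  \<comment> \<open>Splitting \<open>g\<close> along \<open>V\<^sub>1\<close> and \<open>V\<^sub>2\<close> shows that \<open>t\<close>, lying in both, pairs to zero with either part.\<close>
  have both: "hankel_form \<Phi> t g = 0" if t: "t \<in> V1" "t \<in> V2" and g: "g \<in> T" for t g
  proof -
    have "hankel_form \<Phi> t g = hankel_form \<Phi> t (proj V1 g) + hankel_form \<Phi> t (g - proj V1 g)" by (simp flip: F(5))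
    then show ?thesis using z1[OF t(1) proj_in[OF V1, of g]] z2[OF t(2) r1[OF g]] by simp
  qed
  define A where "A x = proj V1 x - proj V2 x" for x
  have A: "clinear A"
    unfolding clinear_def A_def
    by (auto intro: bounded_linear_sub bounded_linear_proj V1 V2
        simp: proj_scaleC[OF V1] proj_scaleC[OF V2] cvs.scale_right_diff_distrib)
  have AT: "hankel_form \<Phi> (A x) g = hankel_form \<Phi> u g - hankel_form \<Phi> v g" if x: "x = u + v" "u \<in> V1" "v \<in> V2" and g: "g \<in> T" for x u v g
  proof -
    have "A x = (u - v) + (proj V1 v - proj V2 u)"
      using x by (simp add: A_def proj_add[OF V1] proj_add[OF V2] proj_id[OF V1] proj_id[OF V2])
    moreover have "hankel_form \<Phi> (proj V1 v) g = 0" "hankel_form \<Phi> (proj V2 u) g = 0"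
      using x g p1 p2 proj_in[OF V1] proj_in[OF V2] by (auto intro: both)
    ultimately show ?thesis by (simp add: F)
  qed
  define x0 y0 where "x0 = proj V1 f" and "y0 = f - proj V1 f"
  have xy0: "f = x0 + y0" "x0 \<in> V1" "y0 \<in> V2" using r1[OF T(3)] proj_in[OF V1] by (auto simp: x0_def y0_def)
  have sx: "shift k x0 \<in> V1" "shift k y0 \<in> V2" "shift k f = shift k x0 + shift k y0" for k
    using shift_invariant_shift[OF V(1)] shift_invariant_shift[OF V(2)] xy0 by (auto simp: shift_linear)
  have ShT: "shift k f \<in> T" for k using sx V(3,4) T(2) by (metis cvs.subspace_add subsetD)
  have base: "hankel_form \<Phi> (A (shift k f)) (shift l f) = 0" for k l
  proof -
    have "hankel_form \<Phi> (A (shift k f)) (shift l f) = hankel_form \<Phi> (shift k x0) (shift l f) - hankel_form \<Phi> (shift k y0) (shift l f)"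
      by (rule AT[OF sx(3,1,2) ShT])
    also have "\<dots> = hankel_form \<Phi> (shift k x0) (shift l y0) - hankel_form \<Phi> (shift k y0) (shift l x0)"
      by (simp add: sx(3)[of l] F z1[OF sx(1) sx(1)] z2[OF sx(2) sx(2)])
    also have "hankel_form \<Phi> (shift k y0) (shift l x0) = hankel_form \<Phi> (shift k x0) (shift l y0)"
      using hankel_form_sym[OF \<Phi>, of "shift k y0" "shift l x0"] by (simp add: hankel_form_shift[OF \<Phi>] shift_shift ac_simps)
    finally show ?thesis by simp
  qed
  have zero: "cbilinear (\<lambda>x y. 0)" by (simp add: cbilinear_def bounded_bilinear_def exI[of _ 0])
  have om: "cbilinear (\<lambda>x y. hankel_form \<Phi> (A x) y)"
    by (rule cbilinear_comp[OF cbilinear_hankel_form[OF \<Phi>] A clinear_id])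
  have "hankel_form \<Phi> (A h) (shift l f) = 0" if "h \<in> T" for h l
    by (rule cbilinear_left_total[OF om zero T(1) _ T(4) that]) (metis base rangeE)
  then have "hankel_form \<Phi> (A h) g = 0" if "h \<in> T" "g \<in> T" for h g
    using cbilinear_left_total[OF cbilinear_swap[OF om] cbilinear_swap[OF zero] T(1) _ T(4) that(2), of h] that(1)
    by (metis rangeE)
  then have "hankel_form \<Phi> (A x) y = 0" using xy V by blast
  moreover have "hankel_form \<Phi> (A x) y = hankel_form \<Phi> x y - hankel_form \<Phi> 0 y"
    using xy V(4) cvs.subspace_0[OF V2(2)] by (intro AT) auto
  ultimately show ?thesis by (simp add: F)
qed

text \<open>If neither reducing part is all of \<open>T\<close>, then both are nonzero and given by inner vectors \<open>\<phi>\<close>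
  and \<open>\<psi>\<close> of one variable each.  The vanishing of the form makes all coefficients of \<open>\<phi> \<psi>\<close> at monomials
  divisible by \<open>z w\<close> zero, so \<open>\<phi>\<close> or \<open>\<psi>\<close> is constant and the corresponding part is the whole space.\<close>

theorem cyclic_structure:
  assumes T: "shift_invariant T" "T \<noteq> {0}" and c: "cross_condition ew ez (ortho T)"
    and f: "f \<in> T" "T \<subseteq> closure (cvs.span (range (\<lambda>k. shift k f)))"
  obtains \<xi> d where "inner_vector \<xi>" "d \<in> {ez, ew}" "coshift d \<xi> = 0" "T = range (multiplier \<xi>)"
proof -
  have de: "{ew, ez} = {ez, ew}" "{ez, ew} = {ez, ew}" by auto
  have c': "cross_condition ez ew (ortho T)" by (rule cross_condition_sym[OF T(1) de(1) c])
  define V1 where "V1 = reducing_core ew T"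
  define V2 where "V2 = reducing_core ez T"
  have V: "shift_invariant V1" "shift_invariant V2" "V1 \<subseteq> T" "V2 \<subseteq> T"
    unfolding V1_def V2_def using shift_invariant_reducing_core[OF T(1)] de reducing_core_subset by auto
  note V1 = shift_invariantD(1,2)[OF V(1)] and V2 = shift_invariantD(1,2)[OF V(2)]
  have p12: "x \<in> V2" if "x \<in> T" "\<And>v. v \<in> V1 \<Longrightarrow> cinner x v = 0" for x
    unfolding V2_def by (rule orthogonal_reducing_core_in_reducing_core[OF T(1) de(1) c that(1)]) (use that(2) V1_def in auto)
  have p21: "x \<in> V1" if "x \<in> T" "\<And>v. v \<in> V2 \<Longrightarrow> cinner x v = 0" for x
    unfolding V1_def by (rule orthogonal_reducing_core_in_reducing_core[OF T(1) de(2) c' that(1)]) (use that(2) V2_def in auto)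
  have L: "coshift ew ` V1 \<subseteq> V1" "coshift ez ` V2 \<subseteq> V2" unfolding V1_def V2_def using coshift_reducing_core by blast+
  show thesis
  proof (cases "V1 = T \<or> V2 = T")
    case True
    then show ?thesis
    proof
      assume "V1 = T"
      then obtain \<xi> where "inner_vector \<xi>" "coshift ew \<xi> = 0" "T = range (multiplier \<xi>)"
        using beurling[OF V(1) de(1) L(1)] T(2) by metis
      then show ?thesis by (intro that[of \<xi> ew]) auto
    next
      assume "V2 = T"
      then obtain \<xi> where "inner_vector \<xi>" "coshift ez \<xi> = 0" "T = range (multiplier \<xi>)"
        using beurling[OF V(2) de(2) L(2)] T(2) by metis
      then show ?thesis by (intro that[of \<xi> ez]) auto
    qed
  next
    case False
    have "V1 \<noteq> {0}"
    proof
      assume "V1 = {0}"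
      then have "x \<in> V2" if "x \<in> T" for x by (intro p12 that) (simp add: cinner.zero_right)
      then show False using False V(4) by blast
    qed
    then obtain \<phi> where \<phi>: "inner_vector \<phi>" "coshift ew \<phi> = 0" "V1 = range (multiplier \<phi>)"
      using beurling[OF V(1) de(1) L(1)] by metis
    have "V2 \<noteq> {0}"
    proof
      assume "V2 = {0}"
      then have "x \<in> V1" if "x \<in> T" for x by (intro p21 that) (simp add: cinner.zero_right)
      then show False using False V(3) by blast
    qed
    then obtain \<psi> where \<psi>: "inner_vector \<psi>" "coshift ez \<psi> = 0" "V2 = range (multiplier \<psi>)"
      using beurling[OF V(2) de(2) L(2)] by metis
    define P where "P = multiplier \<phi> \<psi>"
    have P: "inner_vector P" unfolding P_def by (rule inner_vector_multiplier[OF \<phi>(1) \<psi>(1)])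
    have P': "P = multiplier \<psi> \<phi>" unfolding P_def by (rule multiplier_sym[OF \<phi>(1) \<psi>(1)])
    have \<Phi>: "inner_vector (multiplier P P)" by (rule inner_vector_multiplier[OF P P])
    have z1: "hankel_form (multiplier P P) x y = 0" if "x \<in> V1" "y \<in> V1" for x y
      using that hankel_form_vanishes[OF \<phi>(1) \<psi>(1,2)] unfolding \<phi>(3) P_def by auto
    have z2: "hankel_form (multiplier P P) x y = 0" if "x \<in> V2" "y \<in> V2" for x y
      using that hankel_form_vanishes[OF \<psi>(1) \<phi>(1,2)] unfolding \<psi>(3) P' by auto
    have in1: "shift k \<phi> \<in> V1" for k unfolding \<phi>(3) by (metis multiplier_delta \<phi>(1) rangeI)
    have in2: "shift k \<psi> \<in> V2" for k unfolding \<psi>(3) by (metis multiplier_delta \<psi>(1) rangeI)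
    have coefP: "coef P (k + (1, 1)) = 0" for k
    proof -
      have "0 = hankel_form (multiplier P P) (shift k \<phi>) (shift 0 \<psi>)"
        by (rule cyclic_hankel_form_vanishes[OF shift_invariantD(1,2)[OF T(1)] f V p12 p21 \<Phi> z1 z2 in1 in2, symmetric])
      also have "\<dots> = cinner (multiplier P (delta (k + (1, 1)))) (multiplier P P)"
        by (simp only: hankel_form_multiplier[OF \<Phi> \<phi>(1)] P_def[symmetric] multiplier_delta[OF P]) simp
      also have "\<dots> = cnj (coef P (k + (1, 1)))" by (simp only: cinner_multiplier_multiplier[OF P] cinner_delta_left)
      finally show ?thesis by simp
    qed
    have prod: "coef \<phi> (Suc a, 0) * coef \<psi> (0, Suc b) = 0" for a b
    proof -
      have "coef P (Suc a, Suc b) = (\<Sum>k\<in>{(0, Suc b)}. coef \<psi> k * coef \<phi> ((Suc a, Suc b) - k))"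
        unfolding P_def coef_multiplier[OF \<phi>(1)]
      proof (rule sum.mono_neutral_right)
        show "{(0, Suc b)} \<subseteq> below (Suc a, Suc b)" by (auto simp: below_def)
        show "\<forall>k\<in>below (Suc a, Suc b) - {(0, Suc b)}. coef \<psi> k * coef \<phi> ((Suc a, Suc b) - k) = 0"
        proof
          fix k assume k: "k \<in> below (Suc a, Suc b) - {(0, Suc b)}"
          obtain p q where pq: "k = (p, q)" by (cases k)
          show "coef \<psi> k * coef \<phi> ((Suc a, Suc b) - k) = 0"
          proof (cases p)
            case 0
            then have "(Suc a, Suc b) - k = ew + (Suc a, b - q)" using k by (auto simp: pq below_def)
            then have "coef \<phi> ((Suc a, Suc b) - k) = 0" using coef_zero_of_coshift[OF \<phi>(2)] by metis
            then show ?thesis by (simp only: mult_zero_right)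
          next
            case (Suc p')
            then have "k = ez + (p', q)" by (simp add: pq)
            then have "coef \<psi> k = 0" using coef_zero_of_coshift[OF \<psi>(2)] by metis
            then show ?thesis by (simp only: mult_zero_left)
          qed
        qed
      qed simp
      moreover have "coef P (Suc a, Suc b) = 0" using coefP[of "(a, b)"] by simp
      ultimately show ?thesis by (simp add: mult.commute)
    qed
    have const: "delta 0 \<in> V" if "inner_vector \<theta>" "\<And>k. k \<noteq> 0 \<Longrightarrow> coef \<theta> k = 0" "\<theta> \<in> V" "cvs.subspace V" for \<theta> V
    proof -
      have "\<theta> = coef \<theta> 0 *\<^sub>C delta 0" using that(2) by (intro ell2_eqI) auto
      moreover have "\<theta> \<noteq> 0" using inner_vectorD[OF that(1), of 0 0] by (auto simp: cinner.zero_left)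
      ultimately have "coef \<theta> 0 \<noteq> 0" "inverse (coef \<theta> 0) *\<^sub>C \<theta> = delta 0"
        by (metis cvs.scale_zero_left) (metis \<open>\<theta> = _\<close> \<open>\<theta> \<noteq> 0\<close> cvs.scale_scale cvs.scale_one cvs.scale_zero_left left_inverse)
      then show ?thesis using cvs.subspace_scale[OF that(4,3)] by metis
    qed
    have full: "V = UNIV" if "shift_invariant V" "delta 0 \<in> V" for V
    proof -
      have "x \<in> V" for x
        by (rule total_delta[OF shift_invariantD(1,2)[OF that(1)]])
           (use shift_invariant_shift[OF that, of] in \<open>simp\<close>)
      then show ?thesis by blast
    qed
    have "V1 = UNIV \<or> V2 = UNIV"
    proof (cases "\<exists>a. coef \<phi> (Suc a, 0) \<noteq> 0")
      case False
      have "coef \<phi> k = 0" if "k \<noteq> 0" for k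
      proof (cases "k \<in> range (\<lambda>n. axis_multiple n ez)")
        case True
        then obtain n where "k = (n, 0)" by (auto simp: axis_multiple_def)
        moreover from this obtain a where "n = Suc a" using \<open>k \<noteq> 0\<close> by (cases n) (auto simp: zero_prod_def)
        ultimately show ?thesis using False by blast
      qed (use coef_zero_off_axis[OF _ \<phi>(2)] in blast)
      then show ?thesis using const[OF \<phi>(1) _ _ V1(2)] full[OF V(1)] in1[of 0] by auto
    next
      case True
      then have b0: "coef \<psi> (0, Suc b) = 0" for b using prod by auto
      have "coef \<psi> k = 0" if "k \<noteq> 0" for k
      proof (cases "k \<in> range (\<lambda>n. axis_multiple n ew)")
        case True
        then obtain n where "k = (0, n)" by (auto simp: axis_multiple_def)
        moreover from this obtain b where "n = Suc b" using \<open>k \<noteq> 0\<close> by (cases n) (auto simp: zero_prod_def)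
        ultimately show ?thesis using b0 by blast
      qed (use coef_zero_off_axis[OF _ \<psi>(2)] in blast)
      then show ?thesis using const[OF \<psi>(1) _ _ V2(2)] full[OF V(2)] in2[of 0] by auto
    qed
    then show thesis using False V by blast
  qed
qed


section \<open>Functions on the bidisc and their coefficients\<close>

lemma szego_summable:
  assumes "cmod z < 1" "cmod w < 1"
  shows "(\<lambda>(m, n). (cmod (cnj z ^ m * cnj w ^ n))\<^sup>2) summable_on UNIV"
proof -
  have g: "((\<lambda>n. ((cmod z)\<^sup>2) ^ n) has_sum (1 / (1 - (cmod z)\<^sup>2))) UNIV" if "cmod z < 1" for z
  proof -
    have "(cmod z)\<^sup>2 < 1" using that by (simp add: power_less_one_iff abs_square_less_1)
    then have "(\<lambda>n. ((cmod z)\<^sup>2) ^ n) sums (1 / (1 - (cmod z)\<^sup>2))" by (intro geometric_sums) simp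
    then show ?thesis by (intro norm_summable_imp_has_sum) (auto simp: sums_iff)
  qed
  have "(\<lambda>i. ((cmod z)\<^sup>2) ^ fst i * ((cmod w)\<^sup>2) ^ snd i) summable_on Sigma UNIV (\<lambda>_. UNIV)"
  proof (rule summable_on_SigmaI)
    show "((\<lambda>n. ((cmod z)\<^sup>2) ^ fst (m, n) * ((cmod w)\<^sup>2) ^ snd (m, n)) has_sum
        ((cmod z)\<^sup>2) ^ m * (1 / (1 - (cmod w)\<^sup>2))) UNIV" for m
      unfolding fst_conv snd_conv by (rule has_sum_cmult_right[OF g[OF assms(2)]])
    show "(\<lambda>m. ((cmod z)\<^sup>2) ^ m * (1 / (1 - (cmod w)\<^sup>2))) summable_on UNIV"
      using g[OF assms(1)] by (intro summable_on_cmult_left) (auto simp: summable_on_def)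
  qed auto
  then show ?thesis
    by (simp add: case_prod_unfold norm_mult norm_power power_mult_distrib mult.commute flip: power_mult)
qed

text \<open>The reproducing kernel: evaluation at \<open>p\<close> is the inner product with this vector.\<close>

definition szego :: "complex \<times> complex \<Rightarrow> (nat \<times> nat) ell2" where
  "szego p = Abs_ell2 (\<lambda>(m, n). cnj (fst p) ^ m * cnj (snd p) ^ n)"

lemma bidisc_iff: "(z, w) \<in> bidisc \<longleftrightarrow> cmod z < 1 \<and> cmod w < 1"
  by (simp add: bidisc_def)

lemma coef_szego:
  assumes "(z, w) \<in> bidisc"
  shows "coef (szego (z, w)) (m, n) = cnj z ^ m * cnj w ^ n"
  unfolding szego_def using szego_summable[of z w] assms
  by (subst Abs_ell2_inverse) (auto simp: bidisc_iff case_prod_unfold)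

definition hfun :: "(nat \<times> nat) ell2 \<Rightarrow> complex \<times> complex \<Rightarrow> complex" where
  "hfun x p = (if p \<in> bidisc then cinner x (szego p) else 0)"

lemma has_power_series_hfun: "has_power_series (hfun x) (coef x)"
proof -
  have "((\<lambda>(m, n). coef x (m, n) * z ^ m * w ^ n) has_sum hfun x (z, w)) UNIV" if "(z, w) \<in> bidisc" for z w
  proof -
    have "((\<lambda>i. coef x i * cnj (coef (szego (z, w)) i)) has_sum hfun x (z, w)) UNIV"
      using has_sum_infsum[OF summable_cinner[of x "szego (z, w)"]] that by (simp add: hfun_def cinner_eq_infsum)
    moreover have "(\<lambda>i. coef x i * cnj (coef (szego (z, w)) i)) = (\<lambda>(m, n). coef x (m, n) * z ^ m * w ^ n)"
      by (auto simp: fun_eq_iff coef_szego[OF that])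
    ultimately show ?thesis by simp
  qed
  then show ?thesis by (auto simp: has_power_series_def)
qed

lemma hcoeff_hfun [simp]: "hcoeff (hfun x) = coef x"
  by (rule hcoeff_eq[OF has_power_series_hfun])

lemma hfun_in_hardy2 [simp]: "hfun x \<in> hardy2"
  using has_power_series_hfun square_summable_coef by (auto simp: hardy2_def hfun_def)

lemma hardy2_eq_range_hfun: "hardy2 = range hfun"
proof
  show "hardy2 \<subseteq> range hfun"
  proof
    fix f assume f: "f \<in> hardy2"
    define x where "x = Abs_ell2 (hcoeff f)"
    have x: "coef x = hcoeff f" unfolding x_def using f by (subst Abs_ell2_inverse) (auto simp: hardy2_iff)
    have "f p = hfun x p" for p
    proof (cases "p \<in> bidisc")
      case True
      then obtain z w where p: "p = (z, w)" "(z, w) \<in> bidisc" by (cases p) auto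
      have "has_power_series f (coef x)" using f x by (simp add: hardy2_iff)
      then show ?thesis
        using has_power_series_hfun[of x] has_sum_unique p unfolding has_power_series_def by blast
    next
      case False
      then have "f p = 0" using f unfolding hardy2_iff by blast
      then show ?thesis using False by (simp add: hfun_def)
    qed
    then have "f = hfun x" by (rule ext)
    then show "f \<in> range hfun" by blast
  qed
qed auto

lemma inj_hfun: "hfun x = hfun y \<longleftrightarrow> x = y"
  by (metis coef_inject hcoeff_hfun)

lemma hfun_add: "hfun (x + y) = hfun x + hfun y"
  and hfun_scaleC: "hfun (c *\<^sub>C x) = cscale c (hfun x)"
  and hfun_diff: "hfun (x - y) = hfun x - hfun y"
  and hfun_0: "hfun 0 = 0"
  by (auto simp: fun_eq_iff hfun_def cscale_def cinner_simps)

lemma hinner_hfun [simp]: "hinner (hfun x) (hfun y) = cinner x y"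
  by (simp add: hinner_def cinner_eq_infsum)

lemma hdist_hfun [simp]: "hdist (hfun x) (hfun y) = dist x y"
  by (simp add: hdist_eq dist_norm norm_ell2_def inner_ell2_def cinner_self flip: hfun_diff)

lemma hfun_span: "module.span cscale (hfun ` A) = hfun ` cvs.span A"
proof -
  interpret c: vector_space cscale by (rule vector_space_cscale)
  interpret h: module_hom scaleC cscale hfun
    by unfold_locales (simp_all add: hfun_add hfun_scaleC)
  show ?thesis by (rule h.span_image)
qed

lemma hfun_shift:
  assumes "(z, w) \<in> bidisc"
  shows "hfun (shift (a, b) x) (z, w) = z ^ a * w ^ b * hfun x (z, w)"
proof -
  have "coshift (a, b) (szego (z, w)) = (cnj z ^ a * cnj w ^ b) *\<^sub>C szego (z, w)"
    by (rule ell2_eqI) (auto simp: coef_szego[OF assms] power_add)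
  then show ?thesis using assms by (simp add: hfun_def cinner_shift)
qed

lemma M_z_hfun: "M_z (hfun x) = hfun (shift ez x)" and M_w_hfun: "M_w (hfun x) = hfun (shift ew x)"
proof -
  have "M_z (hfun x) (z, w) = hfun (shift ez x) (z, w)" "M_w (hfun x) (z, w) = hfun (shift ew x) (z, w)" for z w
    by (cases "(z, w) \<in> bidisc"; simp add: M_z_def M_w_def hfun_shift; simp add: hfun_def)+
  then show "M_z (hfun x) = hfun (shift ez x)" "M_w (hfun x) = hfun (shift ew x)" by auto
qed

lemma hfun_multiplier:
  assumes \<phi>: "inner_vector \<phi>"
  shows "hfun (multiplier \<phi> x) p = hfun \<phi> p * hfun x p"
proof (cases "p \<in> bidisc")
  case True
  then obtain z w where p: "p = (z, w)" "(z, w) \<in> bidisc" by (cases p) auto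
  let ?E = "{x. cinner (multiplier \<phi> x) (szego p) = cinner \<phi> (szego p) * cinner x (szego p)}"
  have "x \<in> ?E"
  proof (rule total_delta)
    show "closed ?E"
      by (intro closed_Collect_eq continuous_intros cinner.continuous_on clinear_continuous clinear_multiplier \<phi>)
    show "cvs.subspace ?E"
      by (auto simp: cvs.subspace_def clinearD[OF clinear_multiplier[OF \<phi>]] cinner_simps algebra_simps)
    fix k :: "nat \<times> nat"
    obtain a b where k: "k = (a, b)" by (cases k)
    show "delta k \<in> ?E"
      using hfun_shift[OF p(2), of a b \<phi>] p by (simp add: \<phi> hfun_def k coef_szego)
  qed
  then show ?thesis using True by (simp add: hfun_def)
qed (simp add: hfun_def)

text \<open>Multiplication by \<open>\<phi>\<close> is isometric and \<open>\<langle>\<phi> k, k\<rangle> = \<phi>(p) \<parallel>k\<parallel>\<^sup>2\<close> for the kernel \<open>k\<close> at \<open>p\<close>.\<close>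

lemma cmod_hfun_inner_le:
  assumes \<phi>: "inner_vector \<phi>"
  shows "cmod (hfun \<phi> p) \<le> 1"
proof (cases "p \<in> bidisc")
  case True
  let ?k = "szego p"
  have "coef ?k (0, 0) = 1" using True by (cases p) (simp add: coef_szego)
  then have k: "norm ?k > 0" by auto
  have "hfun \<phi> p * of_real ((norm ?k)\<^sup>2) = cinner (multiplier \<phi> ?k) ?k"
    using hfun_multiplier[OF \<phi>, of ?k p] True cinner_self_norm[of ?k] by (simp add: hfun_def)
  then have "cmod (hfun \<phi> p) * (norm ?k)\<^sup>2 = cmod (cinner (multiplier \<phi> ?k) ?k)"
    by (metis abs_power2 norm_mult norm_of_real)
  also have "\<dots> \<le> (norm ?k)\<^sup>2"
    using norm_cinner_le[of "multiplier \<phi> ?k" ?k] by (simp add: norm_multiplier \<phi> power2_eq_square)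
  finally show ?thesis using k by (simp add: field_simps)
qed (simp add: hfun_def)

text \<open>Restricting \<open>f\<close> to this slice gives \<open>f - M M\<^sup>* f\<close>, where \<open>M\<close> is multiplication by the coordinate
  that is set to zero.\<close>

definition coord_slice :: "nat \<times> nat \<Rightarrow> complex \<times> complex \<Rightarrow> complex \<times> complex" where
  "coord_slice d p = (if d = ew then (fst p, 0) else (0, snd p))"

lemma coord_slice_bidisc: "p \<in> bidisc \<Longrightarrow> coord_slice d p \<in> bidisc"
  by (auto simp: coord_slice_def bidisc_def)

lemma shift_coshift_szego:
  assumes p: "p \<in> bidisc" and d: "d \<in> {ez, ew}"
  shows "shift d (coshift d (szego p)) = szego p - szego (coord_slice d p)"
proof (rule ell2_eqI)
  fix i :: "nat \<times> nat"
  obtain z w where zw: "p = (z, w)" by (cases p)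
  obtain m n where i: "i = (m, n)" by (cases i)
  have c: "coef (szego (z, w)) (m, n) = cnj z ^ m * cnj w ^ n" for m n using coef_szego p zw by simp
  have cs: "coef (szego (z, 0)) (m, n) = cnj z ^ m * 0 ^ n" "coef (szego (0, w)) (m, n) = 0 ^ m * cnj w ^ n" for m n
    using coef_szego[of z 0 m n] coef_szego[of 0 w m n] p zw by (auto simp: bidisc_iff)
  have r: "(m, n) \<in> range ((+) (a, b)) \<longleftrightarrow> a \<le> m \<and> b \<le> n" for m n a b :: nat
    by (auto simp: image_iff le_iff_add)
  show "coef (shift d (coshift d (szego p))) i = coef (szego p - szego (coord_slice d p)) i"
  proof (cases "d = ew")
    case True
    then show ?thesis by (cases n) (simp_all add: coord_slice_def zw i coef_shift r c cs)
  next
    case False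
    then have "d = ez" using d by simp
    then show ?thesis by (cases m) (simp_all add: coord_slice_def zw i coef_shift r c cs)
  qed
qed

lemma hfun_shift_coshift:
  assumes p: "p \<in> bidisc" and d: "d \<in> {ez, ew}"
  shows "hfun (shift d (coshift d y)) p = hfun y p - hfun y (coord_slice d p)"
  using p coord_slice_bidisc[OF p] shift_coshift_szego[OF p d] by (simp add: hfun_def cinner_shift cinner_coshift cinner.diff_right)

lemma hfun_coord_slice:
  assumes p: "p \<in> bidisc" and d: "d \<in> {ez, ew}" "coshift d \<xi> = 0"
  shows "hfun \<xi> p = hfun \<xi> (coord_slice d p)"
  using hfun_shift_coshift[OF p d(1), of \<xi>] d(2) clinearD(5)[OF clinear_shift, of d] by (simp add: hfun_0)


section \<open>Submodules in terms of coefficients\<close>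

definition coeff_space :: "(complex \<times> complex \<Rightarrow> complex) set \<Rightarrow> (nat \<times> nat) ell2 set" where
  "coeff_space S = hfun -` S"

lemma hfun_coeff_space: "S \<subseteq> hardy2 \<Longrightarrow> S = hfun ` coeff_space S"
  by (auto simp: coeff_space_def hardy2_eq_range_hfun)

lemma mem_coeff_space [simp]: "x \<in> coeff_space S \<longleftrightarrow> hfun x \<in> S"
  by (simp add: coeff_space_def)

lemma closed_coeff_space:
  assumes "closed_subspace S"
  shows "closed (coeff_space S)" "cvs.subspace (coeff_space S)"
proof -
  interpret Metric_space hardy2 hdist by (rule Metric_space_hardy2)
  interpret c: vector_space cscale by (rule vector_space_cscale)
  have S: "closedin mtopology S" "c.subspace S" using assms by (auto simp: closed_subspace_def)
  show "cvs.subspace (coeff_space S)"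
    using S(2) by (auto simp: cvs.subspace_def c.subspace_def hfun_add hfun_scaleC hfun_0)
  show "closed (coeff_space S)"
    unfolding closed_def open_dist
  proof (intro ballI)
    fix x assume "x \<in> - coeff_space S"
    then have "hfun x \<in> hardy2 - S" by auto
    then obtain r where r: "r > 0" "disjnt S (mball (hfun x) r)"
      using S(1) unfolding closedin_metric by blast
    have "y \<in> - coeff_space S" if "dist y x < r" for y
    proof -
      have "hfun y \<in> mball (hfun x) r" using that by (simp add: dist_commute)
      then have "hfun y \<notin> S" using r(2) unfolding disjnt_iff by blast
      then show ?thesis by simp
    qed
    then show "\<exists>e>0. \<forall>y. dist y x < e \<longrightarrow> y \<in> - coeff_space S" using r(1) by blast
  qed
qed

lemma shift_invariant_coeff_space:
  assumes "submodule S"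
  shows "shift_invariant (coeff_space S)"
proof -
  have "hfun (shift ez x) \<in> S" "hfun (shift ew x) \<in> S" if "hfun x \<in> S" for x
    using that assms unfolding M_z_hfun[symmetric] M_w_hfun[symmetric] submodule_def by blast+
  then show ?thesis using assms closed_coeff_space[of S] unfolding submodule_def shift_invariant_def by auto
qed

lemma coeff_space_orth_compl:
  assumes "S \<subseteq> hardy2"
  shows "coeff_space (orth_compl S) = ortho (coeff_space S)"
proof -
  have "(\<forall>g\<in>S. hinner (hfun x) g = 0) \<longleftrightarrow> (\<forall>v\<in>coeff_space S. cinner x v = 0)" for x
    using hfun_coeff_space[OF assms] by (metis hinner_hfun image_iff)
  then show ?thesis by (auto simp: orth_compl_def ortho_def)
qed

lemma orth_proj_hfun:
  assumes Q: "closed (coeff_space Q)" "cvs.subspace (coeff_space Q)" "Q \<subseteq> hardy2"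
  shows "orth_proj Q (hfun x) = hfun (proj (coeff_space Q) x)"
  unfolding orth_proj_def
proof (rule the_equality)
  show "hfun (proj (coeff_space Q) x) \<in> Q \<and> (\<forall>h\<in>Q. hinner (hfun x - hfun (proj (coeff_space Q) x)) h = 0)"
    using proj_in[OF Q(1,2), of x] proj_orth[OF Q(1,2)] Q(3)
    by (auto simp: hardy2_eq_range_hfun simp flip: hfun_diff)
  fix g assume g: "g \<in> Q \<and> (\<forall>h\<in>Q. hinner (hfun x - g) h = 0)"
  then obtain y where y: "g = hfun y" using Q(3) by (auto simp: hardy2_eq_range_hfun)
  have "proj (coeff_space Q) x = y"
  proof (rule proj_eqI[OF Q(1,2)])
    show "cinner (x - y) v = 0" if "v \<in> coeff_space Q" for v
      using g that hinner_hfun[of "x - y" v] by (simp add: y hfun_diff)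
  qed (use g y in simp)
  then show "g = hfun (proj (coeff_space Q) x)" using y by simp
qed

lemma adjoint_on_hfun:
  assumes Q: "Q \<subseteq> hardy2" "cvs.subspace (coeff_space Q)" and q: "r \<in> coeff_space Q" and A: "\<And>x. hfun x \<in> Q \<Longrightarrow> A (hfun x) = hfun (B x)"
    and adj: "\<And>x. x \<in> coeff_space Q \<Longrightarrow> cinner (B x) q = cinner x r"
  shows "adjoint_on Q A (hfun q) = hfun r"
  unfolding adjoint_on_def
proof (rule the_equality)
  show "hfun r \<in> Q \<and> (\<forall>h\<in>Q. hinner (A h) (hfun q) = hinner h (hfun r))"
    using q A adj Q(1) by (auto simp: hardy2_eq_range_hfun)
  fix g assume g: "g \<in> Q \<and> (\<forall>h\<in>Q. hinner (A h) (hfun q) = hinner h g)"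
  then obtain y where y: "g = hfun y" using Q(1) by (auto simp: hardy2_eq_range_hfun)
  have "cinner x y = cinner x r" if "x \<in> coeff_space Q" for x
    using g that A[of x] adj[OF that] by (auto simp: y)
  then have "cinner (y - r) (y - r) = 0"
    using cvs.subspace_diff[OF Q(2) _ q, of y] g y by (simp add: cinner.diff_right)
  then show "g = hfun r" by (simp add: y cinner_self_norm)
qed

text \<open>The complement of a submodule is invariant under the backward shifts, so on it the adjoint of
  the compression of \<open>M\<^sub>w\<close> is the backward shift itself.\<close>

lemma cross_condition_of_doubly_commuting:
  assumes S: "co_doubly_commuting S"
  shows "cross_condition ew ez (ortho (coeff_space S))"
proof -
  have sub: "submodule S" "S \<subseteq> hardy2" using S by (auto simp: co_doubly_commuting_def submodule_def closed_subspace_def)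
  note T = shift_invariant_coeff_space[OF sub(1)]
  define Q where "Q = orth_compl S"
  have pQ: "coeff_space Q = ortho (coeff_space S)" unfolding Q_def by (rule coeff_space_orth_compl[OF sub(2)])
  have Q: "closed (coeff_space Q)" "cvs.subspace (coeff_space Q)" "Q \<subseteq> hardy2"
    unfolding pQ using closed_ortho csubspace_ortho by (auto simp: Q_def orth_compl_def)
  have Cz: "compression Q M_z (hfun x) = hfun (proj (coeff_space Q) (shift ez x))"
    and Cw: "compression Q M_w (hfun x) = hfun (proj (coeff_space Q) (shift ew x))" for x
    by (simp_all add: compression_def M_z_hfun M_w_hfun orth_proj_hfun[OF Q])
  have LQ: "coshift d q \<in> coeff_space Q" if "q \<in> coeff_space Q" "d \<in> {ez, ew}" for q d
    using coshift_ortho[OF T] that unfolding pQ by blast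
  have ad: "adjoint_on Q (compression Q M_w) (hfun q) = hfun (coshift ew q)" if q: "q \<in> coeff_space Q" for q
  proof (rule adjoint_on_hfun[where B = "\<lambda>x. proj (coeff_space Q) (shift ew x)", OF Q(3,2)])
    show "compression Q M_w (hfun x) = hfun (proj (coeff_space Q) (shift ew x))" for x by (rule Cw)
    show "coshift ew q \<in> coeff_space Q" using LQ q by blast
    show "cinner (proj (coeff_space Q) (shift ew x)) q = cinner x (coshift ew q)" if "x \<in> coeff_space Q" for x
      using cinner_proj_swap[OF Q(1,2), of "shift ew x" q] proj_id[OF Q(1,2) q] by (simp add: cinner_shift)
  qed
  have dc: "compression Q M_z (adjoint_on Q (compression Q M_w) f) = adjoint_on Q (compression Q M_w) (compression Q M_z f)"
    if "f \<in> Q" for f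
    using S that unfolding co_doubly_commuting_def doubly_commuting_def Q_def Let_def by blast
  show ?thesis
    unfolding cross_condition_def pQ[symmetric]
  proof
    fix q assume q: "q \<in> coeff_space Q"
    have "hfun (proj (coeff_space Q) (shift ez (coshift ew q))) = hfun (coshift ew (proj (coeff_space Q) (shift ez q)))"
      using dc[of "hfun q"] q by (simp add: ad Cz proj_in[OF Q(1,2), unfolded mem_coeff_space] proj_in[OF Q(1,2)])
    then show "proj (coeff_space Q) (shift ez (coshift ew q)) = coshift ew (proj (coeff_space Q) (shift ez q))" by (simp only: inj_hfun)
  qed
qed

lemma funpow_M: "(M_z ^^ k) ((M_w ^^ l) (hfun x)) = hfun (shift (k, l) x)"
proof -
  have w: "(M_w ^^ l) (hfun x) = hfun (shift (0, l) x)" for x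
    by (induction l) (simp_all add: M_w_hfun shift_shift flip: zero_prod_def)
  have z: "(M_z ^^ k) (hfun x) = hfun (shift (k, 0) x)" for x
    by (induction k) (simp_all add: M_z_hfun shift_shift flip: zero_prod_def)
  show ?thesis by (simp add: w z shift_shift)
qed

lemma generated_hfun:
  assumes S: "S \<subseteq> hardy2"
  shows "generated S M_z M_w (hfun ` F) = S \<longleftrightarrow>
    (\<forall>x\<in>coeff_space S. \<forall>r>0. \<exists>y\<in>cvs.span (\<Union>f\<in>F. range (\<lambda>k. shift k f)). hfun y \<in> S \<and> dist x y < r)"
proof -
  interpret S: Metric_space S hdist
    by (rule Metric_space.subspace[OF Metric_space_hardy2 S])
  have set: "{(M_z ^^ k) ((M_w ^^ l) g) | k l g. g \<in> hfun ` F} = hfun ` (\<Union>f\<in>F. range (\<lambda>k. shift k f))"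
  proof (intro set_eqI iffI)
    fix h assume "h \<in> hfun ` (\<Union>f\<in>F. range (\<lambda>k. shift k f))"
    then obtain f k where "f \<in> F" "h = hfun (shift k f)" by auto
    then have "h = (M_z ^^ fst k) ((M_w ^^ snd k) (hfun f))" "hfun f \<in> hfun ` F" by (simp_all add: funpow_M)
    then show "h \<in> {(M_z ^^ k) ((M_w ^^ l) g) | k l g. g \<in> hfun ` F}" by blast
  next
    fix h assume "h \<in> {(M_z ^^ k) ((M_w ^^ l) g) | k l g. g \<in> hfun ` F}"
    then obtain k l f where "f \<in> F" "h = hfun (shift (k, l) f)" by (auto simp: funpow_M)
    then show "h \<in> hfun ` (\<Union>f\<in>F. range (\<lambda>k. shift k f))" by blast
  qed
  have ball: "(\<forall>g\<in>S. P g) \<longleftrightarrow> (\<forall>x\<in>coeff_space S. P (hfun x))" for P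
    using S unfolding hardy2_eq_range_hfun coeff_space_def by blast
  have "generated S M_z M_w (hfun ` F)
      = {g \<in> S. \<forall>r>0. \<exists>y\<in>cvs.span (\<Union>f\<in>F. range (\<lambda>k. shift k f)). hfun y \<in> S.mball g r}"
    unfolding generated_def set hfun_span S.metric_closure_of by auto
  also have "\<dots> = S \<longleftrightarrow> (\<forall>g\<in>S. \<forall>r>0. \<exists>y\<in>cvs.span (\<Union>f\<in>F. range (\<lambda>k. shift k f)). hfun y \<in> S.mball g r)"
    by auto
  also have "\<dots> \<longleftrightarrow> (\<forall>x\<in>coeff_space S. \<forall>r>0. \<exists>y\<in>cvs.span (\<Union>f\<in>F. range (\<lambda>k. shift k f)). hfun y \<in> S.mball (hfun x) r)"
    by (rule ball)
  also have "\<dots> \<longleftrightarrow> (\<forall>x\<in>coeff_space S. \<forall>r>0. \<exists>y\<in>cvs.span (\<Union>f\<in>F. range (\<lambda>k. shift k f)). hfun y \<in> S \<and> dist x y < r)"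
    by simp
  finally show ?thesis .
qed

lemma generated_empty_iff:
  assumes S: "submodule S"
  shows "generated S M_z M_w {} = S \<longleftrightarrow> coeff_space S = {0}"
proof -
  have sub: "S \<subseteq> hardy2" "0 \<in> coeff_space S"
    using S cvs.subspace_0[OF closed_coeff_space(2)[of S]] unfolding submodule_def closed_subspace_def by blast+
  have "generated S M_z M_w {} = S \<longleftrightarrow> (\<forall>x\<in>coeff_space S. \<forall>r>0. norm x < r)"
    using generated_hfun[OF sub(1), of "{}"] sub(2) by (simp add: cvs.span_empty)
  also have "\<dots> \<longleftrightarrow> coeff_space S = {0}"
  proof
    assume *: "\<forall>x\<in>coeff_space S. \<forall>r>0. norm x < r"
    have "x = 0" if "x \<in> coeff_space S" for x
      using bspec[OF * that] by (metis less_irrefl zero_less_norm_iff)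
    then show "coeff_space S = {0}" using sub(2) by blast
  qed auto
  finally show ?thesis .
qed

text \<open>The empty set generates the zero space, so rank one means that a single vector generates a
  nonzero space.\<close>

lemma rank_one_iff:
  assumes S: "submodule S"
  shows "submodule_rank S = 1 \<longleftrightarrow> coeff_space S \<noteq> {0} \<and>
    (\<exists>f\<in>coeff_space S. coeff_space S \<subseteq> closure (cvs.span (range (\<lambda>k. shift k f))))"
proof -
  have sub: "S \<subseteq> hardy2" using S by (auto simp: submodule_def closed_subspace_def)
  note T = shift_invariant_coeff_space[OF S]
  define G where "G = {E. E \<subseteq> S \<and> generated S M_z M_w E = S}"
  define v where "v E = (if finite E then enat (card E) else \<infinity>)" for E :: "(complex \<times> complex \<Rightarrow> complex) set"
  have rank: "submodule_rank S = (INF E\<in>G. v E)"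
    by (simp add: submodule_rank_def pair_rank_def G_def v_def)
  have v0: "v E = 0 \<longleftrightarrow> E = {}" for E
    unfolding v_def zero_enat_def by (cases "finite E") auto
  have single: "{hfun f} \<in> G \<longleftrightarrow> f \<in> coeff_space S \<and> coeff_space S \<subseteq> closure (cvs.span (range (\<lambda>k. shift k f)))" for f
  proof (cases "f \<in> coeff_space S")
    case True
    have "cvs.span (range (\<lambda>k. shift k f)) \<subseteq> coeff_space S"
      using shift_invariant_shift[OF T True] shift_invariantD(2)[OF T] by (intro cvs.span_minimal) auto
    then have *: "hfun y \<in> S" if "y \<in> cvs.span (range (\<lambda>k. shift k f))" for y using that by auto
    have "{hfun f} \<in> G \<longleftrightarrow> generated S M_z M_w (hfun ` {f}) = S" using True by (simp add: G_def)
    also have "\<dots> \<longleftrightarrow> (\<forall>x\<in>coeff_space S. \<forall>r>0. \<exists>y\<in>cvs.span (range (\<lambda>k. shift k f)). hfun y \<in> S \<and> dist x y < r)"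
      unfolding generated_hfun[OF sub] by simp
    also have "\<dots> \<longleftrightarrow> coeff_space S \<subseteq> closure (cvs.span (range (\<lambda>k. shift k f)))"
      unfolding subset_iff closure_approachable using * by (metis dist_commute)
    finally show ?thesis using True by simp
  qed (simp add: G_def)
  have empty: "{} \<in> G \<longleftrightarrow> coeff_space S = {0}"
    using generated_empty_iff[OF S] by (simp add: G_def)
  show ?thesis
  proof
    assume r1: "submodule_rank S = 1"
    have ne: "coeff_space S \<noteq> {0}"
    proof
      assume "coeff_space S = {0}"
      then have "(INF E\<in>G. v E) \<le> v {}" using empty by (intro INF_lower) auto
      then show False using r1 rank v0[of "{}"] by simp
    qed
    have "\<exists>E\<in>G. v E < 2"
    proof (rule ccontr)
      assume "\<not> ?thesis"
      then have "2 \<le> (INF E\<in>G. v E)" by (intro INF_greatest) (auto simp: not_less)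
      then show False using r1 rank by simp
    qed
    then obtain E where E: "E \<in> G" "v E < 2" by blast
    then have fin: "finite E" by (auto simp: v_def split: if_splits)
    then have "card E < 2" using E(2) by (simp add: v_def numeral_eq_enat)
    moreover have "E \<noteq> {}" using E(1) ne empty by blast
    ultimately have "card E = 1" using fin by (metis One_nat_def card_gt_0_iff less_2_cases not_less_zero)
    then obtain g where g: "E = {g}" by (auto simp: card_1_singleton_iff)
    then have "g \<in> S" using E(1) by (simp add: G_def)
    then obtain f where "g = hfun f" using sub by (auto simp: hardy2_eq_range_hfun)
    then show "coeff_space S \<noteq> {0} \<and> (\<exists>f\<in>coeff_space S. coeff_space S \<subseteq> closure (cvs.span (range (\<lambda>k. shift k f))))"
      using E(1) g single ne by blast
  next
    assume r: "coeff_space S \<noteq> {0} \<and> (\<exists>f\<in>coeff_space S. coeff_space S \<subseteq> closure (cvs.span (range (\<lambda>k. shift k f))))"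
    then obtain f where f: "{hfun f} \<in> G" using single by blast
    have "(INF E\<in>G. v E) \<le> v {hfun f}" using f by (rule INF_lower)
    then have "submodule_rank S \<le> 1" by (simp add: rank v_def one_enat_def)
    moreover have "1 \<le> (INF E\<in>G. v E)"
    proof (rule INF_greatest)
      fix E assume "E \<in> G"
      then have "E \<noteq> {}" using empty r by metis
      then have "0 < v E" by (simp add: zero_less_iff_neq_zero v0)
      then show "1 \<le> v E" using ileI1[of 0 "v E"] by (simp only: one_eSuc)
    qed
    ultimately show "submodule_rank S = 1" using rank by simp
  qed
qed

text \<open>Since \<open>G\<close> does not depend on the coordinate that \<open>d\<close> shifts, the backward shift in direction \<open>d\<close>
  passes through multiplication by \<open>G\<close>: after multiplying by the coordinate both sides become
  \<open>G (f - f\<^sub>0)\<close> with \<open>f\<^sub>0\<close> the restriction to the slice.  Hence the Beurling theorem applies, and the isometric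
  multiplier that it provides carries the dense polynomials to dense multiples of a single vector.\<close>

lemma multiplier_submodule:
  assumes S: "submodule S" and d: "d \<in> {ez, ew}"
    and G: "\<And>p. p \<in> bidisc \<Longrightarrow> G p = G (coord_slice d p)" and SG: "S = {\<lambda>p. G p * f p | f. f \<in> hardy2}"
    and ne: "p0 \<in> bidisc" "G p0 \<noteq> 0"
  shows "coeff_space S \<noteq> {0}" "\<exists>f\<in>coeff_space S. coeff_space S \<subseteq> closure (cvs.span (range (\<lambda>k. shift k f)))"
proof -
  note T = shift_invariant_coeff_space[OF S]
  have mem: "y \<in> coeff_space S \<longleftrightarrow> (\<exists>x. \<forall>p. hfun y p = G p * hfun x p)" for y
  proof -
    have "y \<in> coeff_space S \<longleftrightarrow> (\<exists>x. hfun y = (\<lambda>p. G p * hfun x p))"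
      unfolding mem_coeff_space by (subst SG) (unfold hardy2_eq_range_hfun, blast)
    then show ?thesis by (simp only: fun_eq_iff)
  qed
  have sub: "S \<subseteq> hardy2" using S by (auto simp: submodule_def closed_subspace_def)
  have ex: "\<exists>y\<in>coeff_space S. \<forall>p. hfun y p = G p * hfun x p" for x
  proof -
    have in_S: "(\<lambda>p. G p * hfun x p) \<in> S" by (subst SG) (use hfun_in_hardy2 in blast)
    then obtain y where y: "(\<lambda>p. G p * hfun x p) = hfun y" using sub unfolding hardy2_eq_range_hfun by blast
    have "y \<in> coeff_space S" using in_S unfolding y by simp
    moreover have "\<forall>p. hfun y p = G p * hfun x p" using y by metis
    ultimately show ?thesis by blast
  qed
  obtain y where y: "y \<in> coeff_space S" "\<forall>p. hfun y p = G p * hfun (delta 0) p" using ex by blast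
  have "hfun (delta 0) p0 = 1" using ne(1) by (cases p0) (simp add: hfun_def zero_prod_def coef_szego)
  then have "hfun y p0 \<noteq> 0" using y(2)[rule_format, of p0] ne by simp
  then have "y \<noteq> 0" using hfun_0 by auto
  then show ne0: "coeff_space S \<noteq> {0}" using y(1) by blast
  have LS: "coshift d ` coeff_space S \<subseteq> coeff_space S"
  proof
    fix u assume "u \<in> coshift d ` coeff_space S"
    then obtain y where y: "y \<in> coeff_space S" "u = coshift d y" by blast
    obtain x where x: "\<forall>p. hfun y p = G p * hfun x p" using y(1) mem by blast
    obtain v where v: "v \<in> coeff_space S" "\<forall>p. hfun v p = G p * hfun (coshift d x) p" using ex by blast
    have mult: "\<exists>c. \<forall>x. hfun (shift d x) p = c * hfun x p" if "p \<in> bidisc" for p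
      using that by (cases p; cases d) (auto simp: hfun_shift)
    have "hfun (shift d v) p = hfun (shift d (coshift d y)) p" for p
    proof (cases "p \<in> bidisc")
      case True
      obtain c where c: "hfun (shift d x) p = c * hfun x p" for x using mult[OF True] by blast
      have "hfun (shift d v) p = G p * hfun (shift d (coshift d x)) p" using v(2)[rule_format, of p] by (simp add: c)
      also have "\<dots> = G p * hfun x p - G (coord_slice d p) * hfun x (coord_slice d p)"
        using G[OF True] by (simp add: hfun_shift_coshift[OF True d] right_diff_distrib)
      also have "\<dots> = hfun (shift d (coshift d y)) p" using x[rule_format] by (simp only: hfun_shift_coshift[OF True d])
      finally show ?thesis .
    qed (simp add: hfun_def)
    then have "shift d v = shift d (coshift d y)" using inj_hfun by blast
    then have "v = u" using coshift_shift y(2) by metis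
    then show "u \<in> coeff_space S" using v by simp
  qed
  obtain e where e: "{d, e} = {ez, ew}" using d by blast
  obtain \<xi> where \<xi>: "inner_vector \<xi>" "coshift d \<xi> = 0" "coeff_space S = range (multiplier \<xi>)"
    by (rule beurling[OF T e LS ne0]) (rule that)
  have "multiplier \<xi> x \<in> closure (cvs.span (range (\<lambda>k. shift k \<xi>)))" for x
  proof -
    have "multiplier \<xi> ` closure (cvs.span (range delta)) \<subseteq> closure (multiplier \<xi> ` cvs.span (range delta))"
      by (intro image_closure_subset clinear_continuous clinear_multiplier \<xi> closed_closure closure_subset)
    moreover have "multiplier \<xi> ` cvs.span (range delta) \<subseteq> cvs.span (range (\<lambda>k. shift k \<xi>))"
    proof
      fix u assume "u \<in> multiplier \<xi> ` cvs.span (range delta)"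
      then obtain t where t: "t \<in> cvs.span (range delta)" "u = multiplier \<xi> t" by blast
      have "multiplier \<xi> t \<in> cvs.span (range (\<lambda>k. shift k \<xi>))"
        using t(1)
      proof (induction rule: cvs.span_induct_alt)
        case base
        show ?case by (simp add: clinearD(5)[OF clinear_multiplier[OF \<xi>(1)]] cvs.span_zero)
      next
        case (step c x y)
        then obtain k where "x = delta k" by blast
        then have "multiplier \<xi> (c *\<^sub>C x + y) = c *\<^sub>C shift k \<xi> + multiplier \<xi> y"
          by (simp only: clinearD(2,4)[OF clinear_multiplier[OF \<xi>(1)]] multiplier_delta[OF \<xi>(1)])
        then show ?case
          using cvs.span_add[OF cvs.span_scale[OF cvs.span_base[OF rangeI[of "\<lambda>k. shift k \<xi>" k]]] step(2)]
          by (simp only:)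
      qed
      then show "u \<in> cvs.span (range (\<lambda>k. shift k \<xi>))" using t by simp
    qed
    ultimately have "multiplier \<xi> ` closure (cvs.span (range delta)) \<subseteq> closure (cvs.span (range (\<lambda>k. shift k \<xi>)))"
      using closure_mono by blast
    then show ?thesis using delta_dense by blast
  qed
  moreover have "\<xi> \<in> coeff_space S" unfolding \<xi>(3) using multiplier_delta[OF \<xi>(1), of 0] by (metis shift_0 rangeI)
  ultimately show "\<exists>f\<in>coeff_space S. coeff_space S \<subseteq> closure (cvs.span (range (\<lambda>k. shift k f)))"
    unfolding \<xi>(3) by blast
qed


section \<open>Poisson integrals and a weak type maximal inequality\<close>

lemma antiderivative_exists:
  fixes u :: "real \<Rightarrow> real"
  assumes "\<And>x. isCont u x"
  obtains V where "\<And>x. (V has_real_derivative u x) (at x)"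
  using einterval_antiderivative[of "-\<infinity>" \<infinity> u] assms
  by (auto simp: has_real_derivative_iff_has_vector_derivative)

lemma ftc_real:
  fixes V :: "real \<Rightarrow> real"
  assumes "\<And>x. (V has_real_derivative u x) (at x)" "a \<le> b"
  shows "(u has_integral (V b - V a)) {a..b}"
  using assms by (intro fundamental_theorem_of_calculus)
    (auto simp: has_real_derivative_iff_has_vector_derivative intro: has_vector_derivative_at_within)

text \<open>Averages are written as increments of an antiderivative.  A disjoint subfamily of the intervals
  with large average has total length at most the integral of \<open>u\<close> divided by \<open>l\<close>, and its fivefold
  enlargements cover \<open>E\<close>.  All intervals stay in \<open>[-\<pi>, 3\<pi>]\<close>.\<close>

lemma vitali_weak_maximal:
  fixes u V :: "real \<Rightarrow> real"
  assumes V: "\<And>x. (V has_real_derivative u x) (at x)" and u: "\<And>x. u x \<ge> 0" and l: "l > 0"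
    and E: "E \<subseteq> {0..2*pi}" "\<And>t. t \<in> E \<Longrightarrow> \<exists>h. 0 < h \<and> h \<le> pi \<and> 2 * h * l < V (t + h) - V (t - h)"
  obtains W where "W \<in> lmeasurable" "E \<subseteq> W" "measure lebesgue W \<le> 5 * (V (3*pi) - V (-pi)) / l"
proof -
  obtain h where h: "\<And>t. t \<in> E \<Longrightarrow> 0 < h t \<and> h t \<le> pi" "\<And>t. t \<in> E \<Longrightarrow> 2 * h t * l < V (t + h t) - V (t - h t)"
    using E(2) by metis
  have cov: "E \<subseteq> (\<Union>t\<in>E. cball t (h t))"
  proof
    fix t assume "t \<in> E"
    then show "t \<in> (\<Union>t\<in>E. cball t (h t))" using h(1)[of t] by (intro UN_I[of t]) auto
  qed
  obtain C where C: "countable C" "C \<subseteq> E" "pairwise (\<lambda>i j. disjnt (cball i (h i)) (cball j (h j))) C"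
    "E \<subseteq> (\<Union>i\<in>C. cball i (5 * h i))"
    using Vitali_covering_lemma_cballs[OF cov h(1)] by blast
  have bd: "measure lebesgue (\<Union>i\<in>I. cball i (5 * h i)) \<le> 5 * (V (3*pi) - V (-pi)) / l"
    if I: "I \<subseteq> C" "finite I" for I
  proof -
    have "(u has_integral (\<Sum>i\<in>I. V (i + h i) - V (i - h i))) (\<Union>i\<in>I. cball i (h i))"
    proof (rule has_integral_UN[OF I(2)])
      show "(u has_integral V (i + h i) - V (i - h i)) (cball i (h i))" if "i \<in> I" for i
        unfolding cball_eq_atLeastAtMost using that I C(2) h(1)[of i] by (intro ftc_real V) auto
      show "pairwise (\<lambda>i i'. negligible (cball i (h i) \<inter> cball i' (h i'))) I"
      proof (rule pairwiseI)
        fix i i' assume "i \<in> I" "i' \<in> I" "i \<noteq> i'"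
        then have "cball i (h i) \<inter> cball i' (h i') = {}" using C(3) I(1) unfolding pairwise_def disjnt_def by blast
        then show "negligible (cball i (h i) \<inter> cball i' (h i'))" by simp
      qed
    qed
    moreover have "(\<Union>i\<in>I. cball i (h i)) \<subseteq> {-pi..3*pi}"
    proof
      fix x assume "x \<in> (\<Union>i\<in>I. cball i (h i))"
      then obtain i where i: "i \<in> I" "x \<in> cball i (h i)" by blast
      then have "i \<in> E" using I C(2) by blast
      then have "0 \<le> i" "i \<le> 2*pi" "h i \<le> pi" using E(1) h(1)[of i] by auto
      then show "x \<in> {-pi..3*pi}" using i(2) unfolding cball_eq_atLeastAtMost by auto
    qed
    moreover have "(u has_integral (V (3*pi) - V (-pi))) {-pi..3*pi}"
      by (intro ftc_real V) (use pi_gt_zero in linarith)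
    ultimately have le: "(\<Sum>i\<in>I. V (i + h i) - V (i - h i)) \<le> V (3*pi) - V (-pi)"
      using u by (intro has_integral_subset_le) auto
    have "measure lebesgue (\<Union>i\<in>I. cball i (5 * h i)) \<le> (\<Sum>i\<in>I. measure lebesgue (cball i (5 * h i)))"
      using I(2) by (intro measure_UNION_le) auto
    also have "\<dots> = (\<Sum>i\<in>I. 10 * h i)"
    proof (rule sum.cong[OF refl])
      fix i assume "i \<in> I"
      then have "0 < h i" using I C(2) h(1)[of i] by blast
      then show "measure lebesgue (cball i (5 * h i)) = 10 * h i" unfolding cball_eq_atLeastAtMost by simp
    qed
    also have "\<dots> \<le> (\<Sum>i\<in>I. 5 / l * (V (i + h i) - V (i - h i)))"
    proof (rule sum_mono)
      fix i assume "i \<in> I"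
      then have "2 * h i * l < V (i + h i) - V (i - h i)" using I C(2) h(2)[of i] by blast
      then show "10 * h i \<le> 5 / l * (V (i + h i) - V (i - h i))" using l by (simp add: field_simps)
    qed
    also have "\<dots> = 5 / l * (\<Sum>i\<in>I. V (i + h i) - V (i - h i))" by (simp add: sum_distrib_left)
    also have "\<dots> \<le> 5 / l * (V (3*pi) - V (-pi))" using le l by (intro mult_left_mono) auto
    finally show ?thesis by simp
  qed
  show thesis
  proof (rule that[of "\<Union>i\<in>C. cball i (5 * h i)"])
    show "(\<Union>i\<in>C. cball i (5 * h i)) \<in> lmeasurable"
      by (rule fmeasurable_UN_bound[OF C(1) _ bd]) auto
    show "measure lebesgue (\<Union>i\<in>C. cball i (5 * h i)) \<le> 5 * (V (3*pi) - V (-pi)) / l"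
      by (rule measure_UN_bound[OF C(1) _ bd]) auto
  qed (rule C(4))
qed

text \<open>Differentiating \<open>V s - V (2\<pi> - s)\<close>, with \<open>V\<close> an antiderivative of \<open>w\<close>, replaces a change of
  variables.\<close>

lemma integral_fold:
  fixes w :: "real \<Rightarrow> real"
  assumes w: "\<And>x. isCont w x" "\<And>s. w (2*pi - s) = w (-s)" and I: "(w has_integral I) {0..2*pi}"
  shows "((\<lambda>s. w s + w (-s)) has_integral I) {0..pi}"
proof -
  obtain V where V: "\<And>x. (V has_real_derivative w x) (at x)" using antiderivative_exists[OF w(1)] by blast
  have "(w has_integral (V (2*pi) - V 0)) {0..2*pi}" by (intro ftc_real V) simp
  then have I': "I = V (2*pi) - V 0" using I has_integral_unique by blast
  have "((\<lambda>s. V s - V (2*pi - s)) has_real_derivative (w s + w (-s))) (at s)" for s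
  proof -
    have "((\<lambda>s. V (2*pi - s)) has_real_derivative (w (2*pi - s) * (-1))) (at s)"
      by (rule DERIV_chain2[OF V]) (auto intro!: derivative_eq_intros)
    from DERIV_diff[OF V[of s] this] show ?thesis by (simp add: w(2))
  qed
  from ftc_real[OF this, of 0 pi] show ?thesis by (simp add: I')
qed

definition poisson :: "real \<Rightarrow> real \<Rightarrow> real" where
  "poisson \<rho> s = (1 - \<rho>\<^sup>2) / (1 - 2 * \<rho> * cos s + \<rho>\<^sup>2)"

lemma poisson_denom_pos:
  fixes \<rho> s :: real
  assumes "0 \<le> \<rho>" "\<rho> < 1"
  shows "1 - 2 * \<rho> * cos s + \<rho>\<^sup>2 > 0"
proof -
  have "2 * \<rho> * cos s \<le> 2 * \<rho> * 1" using assms by (intro mult_left_mono) auto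
  moreover have "(1 - \<rho>)\<^sup>2 > 0" using assms by simp
  ultimately show ?thesis by (simp add: power2_diff)
qed

lemma poisson_nonneg: "0 \<le> \<rho> \<Longrightarrow> \<rho> < 1 \<Longrightarrow> poisson \<rho> s \<ge> 0"
  using poisson_denom_pos[of \<rho> s] by (auto simp: poisson_def abs_square_le_1 intro!: divide_nonneg_pos)

text \<open>Cauchy's formula for \<open>f(R e\<^sup>i\<^sup>t \<zeta>)\<^sup>2 / (1 - \<rho> \<zeta>)\<close> at \<open>\<zeta> = \<rho>\<close>: on the unit circle
  \<open>(1 - \<rho> \<zeta>) (\<zeta> - \<rho>) = \<zeta> |1 - \<rho> \<zeta>|\<^sup>2\<close>.\<close>

lemma poisson_formula:
  assumes f: "f holomorphic_on ball 0 1" and R: "0 \<le> R" "R < 1" and \<rho>: "0 \<le> \<rho>" "\<rho> < 1"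
  shows "((\<lambda>s. of_real (poisson \<rho> s) * (f (of_real R * cis (t + s)))\<^sup>2)
      has_integral (2 * of_real pi * (f (of_real (R * \<rho>) * cis t))\<^sup>2)) {0..2*pi}"
proof -
  define k where "k \<zeta> = (f (of_real R * cis t * \<zeta>))\<^sup>2" for \<zeta>
  define H where "H \<zeta> = k \<zeta> / (1 - of_real \<rho> * \<zeta>)" for \<zeta> :: complex
  have sub: "of_real R * cis t * \<zeta> \<in> ball 0 1" if "\<zeta> \<in> cball 0 1" for \<zeta>
  proof -
    have "R * cmod \<zeta> \<le> R * 1" using that R by (intro mult_left_mono) auto
    then show ?thesis using R by (simp add: norm_mult)
  qed
  have nz: "1 - of_real \<rho> * \<zeta> \<noteq> 0" if "\<zeta> \<in> cball 0 1" for \<zeta> :: complex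
  proof
    assume "1 - of_real \<rho> * \<zeta> = 0"
    then have "cmod (of_real \<rho> * \<zeta>) = 1" by (metis eq_iff_diff_eq_0 norm_one)
    moreover have "\<rho> * cmod \<zeta> \<le> \<rho> * 1" using that \<rho> by (intro mult_left_mono) auto
    ultimately show False using \<rho> by (simp add: norm_mult)
  qed
  have "(f \<circ> (\<lambda>\<zeta>. of_real R * cis t * \<zeta>)) holomorphic_on cball 0 1"
    by (rule holomorphic_on_compose_gen[OF _ f]) (use sub in \<open>auto intro!: holomorphic_intros\<close>)
  then have "H holomorphic_on cball 0 1"
    unfolding H_def k_def using nz by (intro holomorphic_intros) (auto simp: o_def)
  then have "((\<lambda>u. H u / (u - of_real \<rho>)) has_contour_integral (2 * of_real pi * \<i> * H (of_real \<rho>))) (circlepath 0 1)"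
    using \<rho> by (intro Cauchy_integral_circlepath_simple) auto
  then have "((\<lambda>s. H (cis s) / (cis s - of_real \<rho>) * \<i> * cis s) has_integral (2 * of_real pi * \<i> * H (of_real \<rho>))) {0..2*pi}"
    unfolding circlepath_def by (subst (asm) has_contour_integral_part_circlepath_iff) auto
  from has_integral_mult_right[OF this, of "(1 - (of_real \<rho>)\<^sup>2) / \<i>"]
  have "((\<lambda>s. (1 - (of_real \<rho>)\<^sup>2) / \<i> * (H (cis s) / (cis s - of_real \<rho>) * \<i> * cis s)) has_integral
      (1 - (of_real \<rho>)\<^sup>2) / \<i> * (2 * of_real pi * \<i> * H (of_real \<rho>))) {0..2*pi}" .
  moreover have "(1 - (of_real \<rho>)\<^sup>2) / \<i> * (2 * of_real pi * \<i> * H (of_real \<rho>)) = 2 * of_real pi * k (of_real \<rho>)"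
  proof -
    have "1 - (complex_of_real \<rho>)\<^sup>2 \<noteq> 0" using nz[of "of_real \<rho>"] \<rho> by (simp add: power2_eq_square)
    then show ?thesis by (simp add: H_def field_simps power2_eq_square)
  qed
  moreover have "(1 - (of_real \<rho>)\<^sup>2) / \<i> * (H (cis s) / (cis s - of_real \<rho>) * \<i> * cis s)
      = of_real (poisson \<rho> s) * k (cis s)" for s
  proof -
    let ?c = "cis s" and ?d = "1 - 2 * of_real \<rho> * of_real (cos s) + (of_real \<rho>)\<^sup>2 :: complex"
    have c: "?c * cnj ?c = 1" "?c + cnj ?c = 2 * of_real (cos s)"
      by (simp_all add: cis_mult cis_cnj complex_eq_iff)
    have "?c * ?d = ?c * (1 - of_real \<rho> * (?c + cnj ?c) + (of_real \<rho>)\<^sup>2)" by (simp add: c(2))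
    also have "\<dots> = ?c - of_real \<rho> * ?c * ?c - of_real \<rho> * (?c * cnj ?c) + (of_real \<rho>)\<^sup>2 * ?c" by (simp add: algebra_simps)
    also have "\<dots> = (1 - of_real \<rho> * ?c) * (?c - of_real \<rho>)" by (simp add: c(1) algebra_simps power2_eq_square)
    finally have e: "(1 - of_real \<rho> * ?c) * (?c - of_real \<rho>) = ?c * ?d" by simp
    have d: "?d = of_real (1 - 2 * \<rho> * cos s + \<rho>\<^sup>2)" by simp
    have d0: "?d \<noteq> 0" unfolding d using poisson_denom_pos[OF \<rho>, of s] by (simp only: of_real_eq_0_iff)
    have "(1 - (of_real \<rho>)\<^sup>2) / \<i> * (H ?c / (?c - of_real \<rho>) * \<i> * ?c)
        = (1 - (of_real \<rho>)\<^sup>2) * k ?c * ?c / ((1 - of_real \<rho> * ?c) * (?c - of_real \<rho>))"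
    proof -
      have "x / \<i> * (y * \<i> * z) = x * y * z" for x y z :: complex by (simp add: field_simps)
      then show ?thesis by (simp add: H_def)
    qed
    also have "\<dots> = (1 - (of_real \<rho>)\<^sup>2) * k ?c / ?d" unfolding e using d0 by simp
    also have "\<dots> = of_real (poisson \<rho> s) * k ?c" unfolding poisson_def d of_real_divide by simp
    finally show ?thesis .
  qed
  moreover have "k (cis s) = (f (of_real R * cis (t + s)))\<^sup>2" for s
    by (simp add: k_def mult.assoc cis_mult)
  moreover have "k (of_real \<rho>) = (f (of_real (R * \<rho>) * cis t))\<^sup>2"
    by (simp add: k_def mult.commute mult.left_commute)
  ultimately show ?thesis by (simp only:)
qed

context
  fixes f :: "complex \<Rightarrow> complex" and R :: real and V u :: "real \<Rightarrow> real"
  assumes f: "f holomorphic_on ball 0 1" and R: "0 \<le> R" "R < 1"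
    and u_def: "u = (\<lambda>s. (cmod (f (of_real R * cis s)))\<^sup>2)"
    and V: "\<And>x. (V has_real_derivative u x) (at x)"
begin

lemma isCont_circle_values: "isCont u s"
proof -
  have "continuous_on UNIV (\<lambda>s. f (of_real R * cis s))"
    by (rule continuous_on_compose2[OF holomorphic_on_imp_continuous_on[OF f]])
       (use R in \<open>auto intro!: continuous_intros simp: norm_mult\<close>)
  then have "continuous_on UNIV u" unfolding u_def by (intro continuous_intros)
  then show ?thesis by (simp add: continuous_on_eq_continuous_at)
qed

lemma circle_values_periodic: "u (s + 2 * pi) = u s"
  by (simp add: u_def flip: cis_mult)

lemma antiderivative_periodic: "V (3*pi) - V (-pi) = 2 * (V (2*pi) - V 0)"
proof -
  have d: "((\<lambda>x. V (x + 2*pi) - V x) has_real_derivative 0) (at x)" for x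
  proof -
    have "((\<lambda>x. V (x + 2*pi)) has_real_derivative (u (x + 2*pi) * 1)) (at x)"
      by (rule DERIV_chain2[OF V]) (auto intro!: derivative_eq_intros)
    from DERIV_diff[OF this V[of x]] show ?thesis by (simp add: circle_values_periodic)
  qed
  have "V (x + 2*pi) - V x = V (0 + 2*pi) - V 0" for x
    by (rule DERIV_isconst_all[of "\<lambda>x. V (x + 2*pi) - V x"]) (use d in auto)
  from this[of pi] this[of "-pi"] show ?thesis by simp
qed

text \<open>Fold the Poisson integral of \<open>u\<close> to \<open>[0, \<pi>]\<close> and integrate by parts against
  \<open>B s = 2 s A - (V (t + s) - V (t - s))\<close>.  Here \<open>B\<close> is nonnegative by the bound on the averages and the Poisson
  kernel is decreasing, so the Poisson integral of \<open>u\<close> is at most that of the constant \<open>A\<close>.\<close>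

lemma maximal_controls_radial:
  assumes \<rho>: "0 \<le> \<rho>" "\<rho> < 1" and A: "\<And>h. 0 < h \<Longrightarrow> h \<le> pi \<Longrightarrow> V (t + h) - V (t - h) \<le> 2 * h * A"
  shows "(cmod (f (of_real (R * \<rho>) * cis t)))\<^sup>2 \<le> A"
proof -
  define D where "D s = 1 - 2 * \<rho> * cos s + \<rho>\<^sup>2" for s
  have D: "D s > 0" for s unfolding D_def by (rule poisson_denom_pos[OF \<rho>])
  define P where "P = poisson \<rho>"
  have PD: "P s = (1 - \<rho>\<^sup>2) / D s" for s by (simp add: P_def poisson_def D_def)
  have P0: "P s \<ge> 0" for s unfolding P_def by (rule poisson_nonneg[OF \<rho>])
  define P' where "P' s = - ((1 - \<rho>\<^sup>2) * (2 * \<rho> * sin s)) / (D s)\<^sup>2" for s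
  have dP: "(P has_real_derivative P' s) (at s)" for s
  proof -
    have "((\<lambda>s. (1 - \<rho>\<^sup>2) / (1 - 2 * \<rho> * cos s + \<rho>\<^sup>2)) has_real_derivative P' s) (at s)"
      using D[of s] unfolding D_def P'_def
      by (auto intro!: derivative_eq_intros simp: power2_eq_square)
    moreover have "P = (\<lambda>s. (1 - \<rho>\<^sup>2) / (1 - 2 * \<rho> * cos s + \<rho>\<^sup>2))" by (auto simp: PD D_def)
    ultimately show ?thesis by simp
  qed
  have P'0: "P' s \<le> 0" if "s \<in> {0..pi}" for s
  proof -
    have "\<rho>\<^sup>2 \<le> 1" using \<rho> by (simp add: abs_square_le_1)
    then show ?thesis using that \<rho> sin_ge_zero[of s] by (auto simp: P'_def intro!: divide_nonneg_nonneg)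
  qed
  have contP: "isCont P s" for s using dP DERIV_isCont by blast
  have Pper: "P (2*pi - s) = P (-s)" for s by (simp add: PD D_def)
  have Pev: "P (-s) = P s" for s by (simp add: PD D_def)
  \<comment> \<open>The mass of the kernel is the case of the constant function one.\<close>
  have "((\<lambda>s. of_real (poisson \<rho> s) * ((\<lambda>_. 1) (of_real 0 * cis (0 + s)))\<^sup>2)
      has_integral (2 * of_real pi * ((\<lambda>_. 1 :: complex) (of_real (0 * \<rho>) * cis 0))\<^sup>2)) {0..2*pi}"
    by (rule poisson_formula) (use \<rho> in auto)
  then have "((\<lambda>s. complex_of_real (P s)) has_integral of_real (2 * pi)) {0..2*pi}" by (simp add: P_def)
  then have "(P has_integral 2 * pi) {0..2*pi}"
    by (auto dest: has_integral_Re)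
  from integral_fold[OF contP Pper this]
  have massP: "((\<lambda>s. 2 * P s) has_integral 2 * pi) {0..pi}" by (simp add: Pev)
  define w where "w s = P s * u (t + s)" for s
  have contw: "isCont w s" for s
    unfolding w_def by (intro continuous_mult contP isCont_o2[OF _ isCont_circle_values] continuous_intros)
  have wper: "w (2*pi - s) = w (-s)" for s
  proof -
    have "u (t + (2*pi - s)) = u (t - s)" using circle_values_periodic[of "t - s"] by (simp add: algebra_simps)
    then show ?thesis by (simp add: w_def Pper)
  qed
  define I where "I = integral {0..2*pi} w"
  have I: "(w has_integral I) {0..2*pi}"
    unfolding I_def by (intro integrable_integral integrable_continuous_real continuous_at_imp_continuous_on ballI contw)
  have "cmod (2 * of_real pi * (f (of_real (R * \<rho>) * cis t))\<^sup>2) \<le> I"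
  proof -
    have F: "((\<lambda>s. of_real (poisson \<rho> s) * (f (of_real R * cis (t + s)))\<^sup>2)
      has_integral (2 * of_real pi * (f (of_real (R * \<rho>) * cis t))\<^sup>2)) {0..2*pi}"
      by (rule poisson_formula[OF f R \<rho>])
    have "norm (integral {0..2*pi} (\<lambda>s. of_real (poisson \<rho> s) * (f (of_real R * cis (t + s)))\<^sup>2)) \<le> integral {0..2*pi} w"
    proof (rule integral_norm_bound_integral)
      show "w integrable_on {0..2*pi}" using I by blast
      show "(\<lambda>s. of_real (poisson \<rho> s) * (f (of_real R * cis (t + s)))\<^sup>2) integrable_on {0..2*pi}" using F by blast
      show "norm (of_real (poisson \<rho> s) * (f (of_real R * cis (t + s)))\<^sup>2) \<le> w s" for s
        using P0[of s] by (simp add: norm_mult norm_power w_def u_def P_def)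
    qed
    then show ?thesis unfolding integral_unique[OF F] I_def .
  qed
  then have fI: "2 * pi * (cmod (f (of_real (R * \<rho>) * cis t)))\<^sup>2 \<le> I"
    by (simp add: norm_mult norm_power)
  have wI: "((\<lambda>s. P s * (u (t + s) + u (t - s))) has_integral I) {0..pi}"
    using integral_fold[OF contw wper I] by (simp add: w_def Pev distrib_left)
  define B where "B s = 2 * s * A - (V (t + s) - V (t - s))" for s
  have B0: "B s \<ge> 0" if "s \<in> {0..pi}" for s
    using A[of s] that by (cases "s = 0") (auto simp: B_def)
  have dB: "(B has_real_derivative (2 * A - (u (t + s) + u (t - s)))) (at s)" for s
  proof -
    have "((\<lambda>s. V (t + s)) has_real_derivative (u (t + s) * 1)) (at s)"
      by (rule DERIV_chain2[OF V]) (auto intro!: derivative_eq_intros)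
    moreover have "((\<lambda>s. V (t - s)) has_real_derivative (u (t - s) * (-1))) (at s)"
      by (rule DERIV_chain2[OF V]) (auto intro!: derivative_eq_intros)
    ultimately show ?thesis unfolding B_def
      by (auto intro!: derivative_eq_intros)
  qed
  have "((\<lambda>s. P s * B s) has_real_derivative (P' s * B s + P s * (2 * A - (u (t + s) + u (t - s))))) (at s)" for s
    using DERIV_mult[OF dP[of s] dB[of s]] by (simp add: algebra_simps)
  from ftc_real[OF this, of 0 pi]
  have PB: "((\<lambda>s. P' s * B s + P s * (2 * A - (u (t + s) + u (t - s)))) has_integral (P pi * B pi - P 0 * B 0)) {0..pi}"
    by simp
  have "((\<lambda>s. A * (2 * P s) - P s * (u (t + s) + u (t - s))) has_integral (A * (2 * pi) - I)) {0..pi}"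
    by (intro has_integral_diff has_integral_mult_right massP wI)
  moreover have "P' s * B s + P s * (2 * A - (u (t + s) + u (t - s))) \<le> A * (2 * P s) - P s * (u (t + s) + u (t - s))"
    if "s \<in> {0..pi}" for s
    using mult_nonpos_nonneg[OF P'0[OF that] B0[OF that]] by (simp add: algebra_simps)
  ultimately have "P pi * B pi - P 0 * B 0 \<le> A * (2 * pi) - I" by (intro has_integral_le[OF PB])
  moreover have "P pi * B pi - P 0 * B 0 \<ge> 0" using P0 B0[of pi] by (simp add: B_def[of 0])
  ultimately have "I \<le> A * (2 * pi)" by linarith
  from order_trans[OF fI this]
  have "(2 * pi) * (cmod (f (of_real (R * \<rho>) * cis t)))\<^sup>2 \<le> (2 * pi) * A" by (simp only: mult.commute[of A])
  then show ?thesis by (rule mult_left_le_imp_le) simp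
qed

end

section \<open>Radial limits\<close>

lemma integral_cis:
  "((\<lambda>t. cis (of_int k * t)) has_integral (if k = 0 then of_real (2 * pi) else 0)) {0..2*pi}"
proof (cases "k = 0")
  case True
  then show ?thesis using has_integral_const_real[of "1 :: complex" 0 "2 * pi"] by (simp add: scaleR_conv_of_real)
next
  case False
  have "((\<lambda>t. cis (of_int k * t) / (\<i> * of_int k)) has_vector_derivative cis (of_int k * t)) (at t within {0..2*pi})" for t
  proof -
    have "((\<lambda>z. exp (\<i> * of_int k * z) / (\<i> * of_int k)) has_field_derivative exp (\<i> * of_int k * of_real t)) (at (of_real t))"
      using False by (auto intro!: derivative_eq_intros)
    from has_vector_derivative_real_field[OF this]
    show ?thesis by (simp add: cis_conv_exp mult.assoc)
  qed
  from fundamental_theorem_of_calculus[OF _ this] False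
  have "((\<lambda>t. cis (of_int k * t)) has_integral (cis (of_int k * (2*pi)) / (\<i> * of_int k) - 1 / (\<i> * of_int k))) {0..2*pi}" by simp
  moreover have "cis (of_int k * (2*pi)) = 1"
    using cis_multiple_2pi[of "of_int k"] by (simp add: mult.commute mult.left_commute)
  ultimately show ?thesis using False by simp
qed

lemma parseval_finite:
  "((\<lambda>t. (cmod (\<Sum>n<N. c n * cis (real n * t)))\<^sup>2) has_integral (2 * pi * (\<Sum>n<N. (cmod (c n))\<^sup>2))) {0..2*pi}"
proof -
  have "((\<lambda>t. \<Sum>n<N. \<Sum>m<N. c n * cnj (c m) * cis (of_int (int n - int m) * t)) has_integral
      (\<Sum>n<N. \<Sum>m<N. c n * cnj (c m) * (if int n - int m = 0 then of_real (2 * pi) else 0))) {0..2*pi}"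
    by (intro has_integral_sum has_integral_mult_right integral_cis) auto
  moreover have "(\<Sum>n<N. \<Sum>m<N. c n * cnj (c m) * (if int n - int m = 0 then of_real (2 * pi) else 0))
      = of_real (2 * pi * (\<Sum>n<N. (cmod (c n))\<^sup>2))"
  proof -
    have "(\<Sum>m<N. c n * cnj (c m) * (if int n - int m = 0 then of_real (2 * pi) else 0))
        = of_real (2 * pi * (cmod (c n))\<^sup>2)" if "n < N" for n
    proof -
      have "(\<Sum>m<N. c n * cnj (c m) * (if int n - int m = 0 then of_real (2 * pi) else 0))
          = (\<Sum>m<N. if m = n then c n * cnj (c m) * of_real (2 * pi) else 0)"
        by (intro sum.cong) auto
      also have "\<dots> = of_real (2 * pi * (cmod (c n))\<^sup>2)"
        using that by (simp add: complex_norm_square[of "c n", symmetric] flip: of_real_power)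
      finally show ?thesis .
    qed
    then show ?thesis by (simp add: sum_distrib_left)
  qed
  moreover have "(\<Sum>n<N. \<Sum>m<N. c n * cnj (c m) * cis (of_int (int n - int m) * t))
      = of_real ((cmod (\<Sum>n<N. c n * cis (real n * t)))\<^sup>2)" for t
  proof -
    have "cis (of_int (int n - int m) * t) = cis (real n * t) * cnj (cis (real m * t))" for n m
      by (simp add: cis_cnj cis_mult algebra_simps)
    then have "(\<Sum>n<N. \<Sum>m<N. c n * cnj (c m) * cis (of_int (int n - int m) * t))
        = (\<Sum>n<N. c n * cis (real n * t)) * cnj (\<Sum>n<N. c n * cis (real n * t))"
      by (simp add: sum_product algebra_simps)
    then show ?thesis by (simp only: complex_norm_square)
  qed
  ultimately have "((\<lambda>t. complex_of_real ((cmod (\<Sum>n<N. c n * cis (real n * t)))\<^sup>2)) has_integral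
      of_real (2 * pi * (\<Sum>n<N. (cmod (c n))\<^sup>2))) {0..2*pi}" by simp
  from has_integral_Re[OF this] show ?thesis by simp
qed

lemma parseval:
  assumes f: "\<And>z. cmod z < 1 \<Longrightarrow> (\<lambda>n. a n * z ^ n) sums f z" and R: "0 \<le> R" "R < 1"
  shows "summable (\<lambda>n. (cmod (a n * of_real R ^ n))\<^sup>2)"
    and "((\<lambda>t. (cmod (f (of_real R * cis t)))\<^sup>2) has_integral (2 * pi * (\<Sum>n. (cmod (a n * of_real R ^ n))\<^sup>2))) {0..2*pi}"
proof -
  define c where "c n = a n * of_real R ^ n" for n
  \<comment> \<open>Convergence at a slightly larger radius gives absolute convergence at radius \<open>R\<close>.\<close>
  define R' where "R' = (1 + R) / 2"
  have R': "R < R'" "R' < 1" "0 < R'" using R by (auto simp: R'_def)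
  have "summable (\<lambda>n. norm (a n * of_real R ^ n))"
    by (rule powser_insidea[of a "of_real R'"]) (use f[of "of_real R'"] R R' in \<open>auto simp: sums_iff\<close>)
  then have nc: "summable (\<lambda>n. cmod (c n))" by (simp add: c_def)
  define M where "M = (\<Sum>n. cmod (c n))"
  have trm: "a n * (of_real R * cis t) ^ n = c n * cis (real n * t)" for n t
    by (simp add: c_def power_mult_distrib Complex.DeMoivre)
  define s where "s N t = (\<Sum>n<N. c n * cis (real n * t))" for N t
  have lim: "(\<lambda>N. s N t) \<longlonglongrightarrow> f (of_real R * cis t)" for t
    using f[of "of_real R * cis t"] R unfolding sums_def s_def trm by (simp add: norm_mult)
  have sM: "cmod (s N t) \<le> M" for N t
  proof -
    have "cmod (s N t) \<le> (\<Sum>n<N. cmod (c n))"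
      unfolding s_def by (rule order_trans[OF norm_sum]) (simp add: norm_mult)
    also have "\<dots> \<le> M" unfolding M_def using nc by (intro sum_le_suminf) auto
    finally show ?thesis .
  qed
  have fin: "((\<lambda>t. (cmod (s N t))\<^sup>2) has_integral (2 * pi * (\<Sum>n<N. (cmod (c n))\<^sup>2))) {0..2*pi}" for N
    unfolding s_def by (rule parseval_finite)
  have dc: "(\<lambda>t. (cmod (f (of_real R * cis t)))\<^sup>2) integrable_on {0..2*pi}"
    "(\<lambda>N. integral {0..2*pi} (\<lambda>t. (cmod (s N t))\<^sup>2)) \<longlonglongrightarrow> integral {0..2*pi} (\<lambda>t. (cmod (f (of_real R * cis t)))\<^sup>2)"
  proof -
    have "(\<lambda>N. (cmod (s N t))\<^sup>2) \<longlonglongrightarrow> (cmod (f (of_real R * cis t)))\<^sup>2" for t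
      by (intro tendsto_intros lim)
    moreover have "norm ((cmod (s N t))\<^sup>2) \<le> M\<^sup>2" for N t using sM[of N t] by (simp add: power_mono)
    moreover have "(\<lambda>t. M\<^sup>2) integrable_on {0..2*pi}" by (rule integrable_const_ivl)
    ultimately show "(\<lambda>t. (cmod (f (of_real R * cis t)))\<^sup>2) integrable_on {0..2*pi}"
      "(\<lambda>N. integral {0..2*pi} (\<lambda>t. (cmod (s N t))\<^sup>2)) \<longlonglongrightarrow> integral {0..2*pi} (\<lambda>t. (cmod (f (of_real R * cis t)))\<^sup>2)"
      using dominated_convergence[of "\<lambda>N t. (cmod (s N t))\<^sup>2" "{0..2*pi}" "\<lambda>t. M\<^sup>2" "\<lambda>t. (cmod (f (of_real R * cis t)))\<^sup>2"] fin
      by blast+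
  qed
  have sq: "summable (\<lambda>n. (cmod (c n))\<^sup>2)"
  proof (rule summable_comparison_test')
    show "summable (\<lambda>n. M * cmod (c n))" using nc by (rule summable_mult)
    show "norm ((cmod (c n))\<^sup>2) \<le> M * cmod (c n)" for n
    proof -
      have "cmod (c n) \<le> M" unfolding M_def using nc sum_le_suminf[OF nc, of "{n}"] by simp
      then show ?thesis by (simp add: power2_eq_square mult_right_mono)
    qed
  qed
  then show "summable (\<lambda>n. (cmod (a n * of_real R ^ n))\<^sup>2)" by (simp add: c_def)
  have "(\<lambda>N. 2 * pi * (\<Sum>n<N. (cmod (c n))\<^sup>2)) \<longlonglongrightarrow> 2 * pi * (\<Sum>n. (cmod (c n))\<^sup>2)"
    by (intro tendsto_intros summable_LIMSEQ sq)
  moreover have "(\<lambda>N. 2 * pi * (\<Sum>n<N. (cmod (c n))\<^sup>2)) \<longlonglongrightarrow> integral {0..2*pi} (\<lambda>t. (cmod (f (of_real R * cis t)))\<^sup>2)"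
    using dc(2) by (simp add: integral_unique[OF fin])
  ultimately have "integral {0..2*pi} (\<lambda>t. (cmod (f (of_real R * cis t)))\<^sup>2) = 2 * pi * (\<Sum>n. (cmod (c n))\<^sup>2)"
    using LIMSEQ_unique by blast
  then show "((\<lambda>t. (cmod (f (of_real R * cis t)))\<^sup>2) has_integral (2 * pi * (\<Sum>n. (cmod (a n * of_real R ^ n))\<^sup>2))) {0..2*pi}"
    using integrable_integral[OF dc(1)] by (simp add: c_def)
qed

lemma powser_holomorphic:
  assumes "\<And>z. cmod z < 1 \<Longrightarrow> (\<lambda>n. a n * z ^ n) sums f z"
  shows "f holomorphic_on ball 0 1"
  using power_series_holomorphic[of 0 1 a f] assms by simp

text \<open>On each smaller disc the boundary values are continuous, so the maximal inequality applies to
  them; the resulting exceptional sets increase with the radius.  The constant is five times \<open>4\<pi>\<close>, since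
  \<open>[-\<pi>, 3\<pi>]\<close> covers the circle twice.\<close>

lemma radial_maximal_estimate:
  assumes f: "\<And>z. cmod z < 1 \<Longrightarrow> (\<lambda>n. a n * z ^ n) sums f z"
    and a: "summable (\<lambda>n. (cmod (a n))\<^sup>2)" and \<eta>: "\<eta> > 0"
  obtains W where "W \<in> lmeasurable" "measure lebesgue W \<le> 20 * pi * (\<Sum>n. (cmod (a n))\<^sup>2) / \<eta>\<^sup>2"
    "\<And>t r. t \<in> {0<..<2*pi} \<Longrightarrow> 0 \<le> r \<Longrightarrow> r < 1 \<Longrightarrow> cmod (f (of_real r * cis t)) > \<eta> \<Longrightarrow> t \<in> W"
proof -
  note hol = powser_holomorphic[OF f]
  define K where "K = 20 * pi * (\<Sum>n. (cmod (a n))\<^sup>2) / \<eta>\<^sup>2"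
  define R where "R j = 1 - 1 / real (j + 2)" for j
  have R: "0 \<le> R j" "R j < 1" "0 < R j" for j by (auto simp: R_def field_simps)
  have Rmono: "i \<le> j \<Longrightarrow> R i \<le> R j" for i j by (auto simp: R_def field_simps)
  define S where "S j = {t \<in> {0<..<2*pi}. \<exists>r\<in>{0..<R j}. cmod (f (of_real r * cis t)) > \<eta>}" for j
  have cont: "continuous_on UNIV (\<lambda>t. cmod (f (of_real r * cis t)))" if "0 \<le> r" "r < 1" for r
    by (intro continuous_on_norm continuous_on_compose2[OF holomorphic_on_imp_continuous_on[OF hol]])
       (use that in \<open>auto intro!: continuous_intros simp: norm_mult\<close>)
  have opn: "open (S j)" for j
  proof -
    have "S j = {0<..<2*pi} \<inter> (\<Union>r\<in>{0..<R j}. {t. \<eta> < cmod (f (of_real r * cis t))})" by (auto simp: S_def)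
    moreover have "open {t. \<eta> < cmod (f (of_real r * cis t))}" if "r \<in> {0..<R j}" for r
      using that R(2)[of j] by (intro open_Collect_less cont continuous_intros) auto
    ultimately show ?thesis by (auto intro!: open_Int open_UN)
  qed
  have Sm: "S j \<in> lmeasurable" for j
    using opn[of j] by (intro lmeasurable_open) (auto simp: S_def intro: bounded_subset[OF bounded_closed_interval[of 0 "2*pi"]])
  have mS: "measure lebesgue (S j) \<le> K" for j
  proof -
    define u where "u = (\<lambda>s. (cmod (f (of_real (R j) * cis s)))\<^sup>2)"
    have "isCont u s" for s
      using cont[OF R(1,2), of j] unfolding u_def
      by (intro continuous_power) (simp add: continuous_on_eq_continuous_at)
    then obtain V where V: "\<And>x. (V has_real_derivative u x) (at x)" using antiderivative_exists by blast
    have ex: "\<exists>h. 0 < h \<and> h \<le> pi \<and> 2 * h * \<eta>\<^sup>2 < V (t + h) - V (t - h)" if t: "t \<in> S j" for t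
    proof (rule ccontr)
      assume "\<not> ?thesis"
      then have A: "V (t + h) - V (t - h) \<le> 2 * h * \<eta>\<^sup>2" if "0 < h" "h \<le> pi" for h using that by force
      obtain r where r: "0 \<le> r" "r < R j" "cmod (f (of_real r * cis t)) > \<eta>" using t by (auto simp: S_def)
      have "(cmod (f (of_real (R j * (r / R j)) * cis t)))\<^sup>2 \<le> \<eta>\<^sup>2"
        using r R[of j] by (intro maximal_controls_radial[OF hol R(1,2) u_def V _ _ A]) auto
      then have "(cmod (f (of_real r * cis t)))\<^sup>2 \<le> \<eta>\<^sup>2" using R(3)[of j] by simp
      then have "cmod (f (of_real r * cis t)) \<le> \<eta>" by (rule power2_le_imp_le) (use \<eta> in auto)
      then show False using r(3) by simp
    qed
    have prem: "0 \<le> u s" "0 < \<eta>\<^sup>2" "S j \<subseteq> {0..2*pi}" for s using \<eta> by (auto simp: u_def S_def)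
    obtain W where W: "W \<in> lmeasurable" "S j \<subseteq> W" "measure lebesgue W \<le> 5 * (V (3*pi) - V (-pi)) / \<eta>\<^sup>2"
      by (rule vitali_weak_maximal[where E = "S j", OF V prem ex]; (assumption | rule that))
    have p: "summable (\<lambda>n. (cmod (a n * of_real (R j) ^ n))\<^sup>2)"
      "(u has_integral (2 * pi * (\<Sum>n. (cmod (a n * of_real (R j) ^ n))\<^sup>2))) {0..2*pi}"
      unfolding u_def by (rule parseval[OF f R(1,2)]; assumption)+
    have "V (2*pi) - V 0 = 2 * pi * (\<Sum>n. (cmod (a n * of_real (R j) ^ n))\<^sup>2)"
      using ftc_real[OF V, of 0 "2*pi"] p(2) by (intro has_integral_unique) auto
    also have "\<dots> \<le> 2 * pi * (\<Sum>n. (cmod (a n))\<^sup>2)"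
    proof (intro mult_left_mono suminf_le p(1) a)
      show "(cmod (a n * of_real (R j) ^ n))\<^sup>2 \<le> (cmod (a n))\<^sup>2" for n
        using R[of j] by (intro power_mono) (auto simp: norm_mult norm_power intro!: mult_right_le_one_le power_le_one)
    qed auto
    finally have "V (3*pi) - V (-pi) \<le> 2 * (2 * pi * (\<Sum>n. (cmod (a n))\<^sup>2))"
      using antiderivative_periodic[OF hol R(1,2) u_def V] by simp
    then have "5 * (V (3*pi) - V (-pi)) / \<eta>\<^sup>2 \<le> K" unfolding K_def by (intro divide_right_mono) auto
    moreover have "measure lebesgue (S j) \<le> measure lebesgue W"
      using W Sm by (intro measure_mono_fmeasurable) auto
    ultimately show ?thesis using W(3) by linarith
  qed
  have mono: "(\<Union>i\<le>n. S i) = S n" for n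
  proof -
    have "S i \<subseteq> S n" if "i \<le> n" for i using Rmono[OF that] by (fastforce simp: S_def)
    then show ?thesis by auto
  qed
  show thesis
  proof (rule that[of "\<Union>j. S j"])
    show "(\<Union>j. S j) \<in> lmeasurable" by (rule fmeasurable_countable_Union[OF Sm, where B = K]) (simp add: mono mS)
    show "measure lebesgue (\<Union>j. S j) \<le> 20 * pi * (\<Sum>n. (cmod (a n))\<^sup>2) / \<eta>\<^sup>2"
      unfolding K_def[symmetric] by (rule measure_countable_Union_le[OF Sm]) (simp add: mono mS)
    fix t r :: real assume t: "t \<in> {0<..<2*pi}" "0 \<le> r" "r < 1" "cmod (f (of_real r * cis t)) > \<eta>"
    obtain j where j: "inverse (real (Suc j)) < 1 - r" using reals_Archimedean[of "1 - r"] t by auto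
    have "1 / real (j + 2) \<le> inverse (real (Suc j))" by (simp add: field_simps)
    then have "r < R j" using j by (simp add: R_def)
    then have "t \<in> S j" using t by (auto simp: S_def)
    then show "t \<in> (\<Union>j. S j)" by blast
  qed
qed

lemma AE_lebesgue_onI:
  assumes "negligible N" "S \<in> sets lebesgue" "\<And>t. t \<in> S \<Longrightarrow> t \<notin> N \<Longrightarrow> P t"
  shows "AE t in lebesgue_on S. P t"
proof -
  have "AE t in lebesgue. t \<in> S \<longrightarrow> P t"
    by (rule AE_I'[of N]) (use assms in \<open>auto simp: negligible_iff_null_sets\<close>)
  then show ?thesis using assms(2) by (simp add: AE_restrict_space_iff)
qed

text \<open>Subtracting a Taylor polynomial, which is continuous up to the circle, leaves a tail of small
  norm.  Outside a set of small measure the tail stays below \<open>\<epsilon> / 3\<close> along the whole radius.\<close>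

lemma radial_oscillation_negligible:
  assumes f: "\<And>z. cmod z < 1 \<Longrightarrow> (\<lambda>n. a n * z ^ n) sums f z"
    and a: "summable (\<lambda>n. (cmod (a n))\<^sup>2)" and \<epsilon>: "\<epsilon> > 0"
  shows "negligible {t \<in> {0<..<2*pi}. \<forall>\<delta><1. \<exists>r s. 0 \<le> r \<and> \<delta> < r \<and> r < 1 \<and> 0 \<le> s \<and> \<delta> < s \<and> s < 1 \<and>
    cmod (f (of_real r * cis t) - f (of_real s * cis t)) \<ge> \<epsilon>}" (is "negligible ?B")
  unfolding negligible_outer_le
proof (intro allI impI)
  fix e :: real assume e: "e > 0"
  define \<eta> where "\<eta> = \<epsilon> / 3"
  have \<eta>: "\<eta> > 0" using \<epsilon> by (simp add: \<eta>_def)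
  obtain N where N: "norm (\<Sum>i. (cmod (a (i + N)))\<^sup>2) < e * \<eta>\<^sup>2 / (20 * pi)"
    using suminf_exist_split[OF _ a, of "e * \<eta>\<^sup>2 / (20 * pi)"] e \<eta> by auto
  define b where "b n = (if n < N then 0 else a n)" for n
  define p where "p z = (\<Sum>n<N. a n * z ^ n)" for z
  define g where "g z = f z - p z" for z
  have g: "(\<lambda>n. b n * z ^ n) sums g z" if "cmod z < 1" for z
  proof -
    have "(\<lambda>n. if n \<in> {..<N} then a n * z ^ n else 0) sums p z"
      unfolding p_def by (rule sums_If_finite_set) simp
    from sums_diff[OF f[OF that] this] show ?thesis
      unfolding g_def by (rule sums_cong[THEN iffD1, rotated]) (simp add: b_def)
  qed
  have "summable (\<lambda>n. (cmod (b (n + N)))\<^sup>2)"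
    using a by (simp add: b_def summable_iff_shift[of "\<lambda>n. (cmod (a n))\<^sup>2"])
  then have b: "summable (\<lambda>n. (cmod (b n))\<^sup>2)" by (simp only: summable_iff_shift[of "\<lambda>n. (cmod (b n))\<^sup>2"])
  have "(\<Sum>n. (cmod (b n))\<^sup>2) = (\<Sum>n. (cmod (a (n + N)))\<^sup>2)"
    using suminf_split_initial_segment[OF b, of N] by (simp add: b_def)
  then have small: "20 * pi * (\<Sum>n. (cmod (b n))\<^sup>2) / \<eta>\<^sup>2 \<le> e"
  proof -
    have "(\<Sum>n. (cmod (b n))\<^sup>2) < e * \<eta>\<^sup>2 / (20 * pi)"
      using N \<open>(\<Sum>n. (cmod (b n))\<^sup>2) = _\<close> by (simp only: real_norm_def abs_less_iff)
    then show ?thesis using \<eta> by (simp add: field_simps)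
  qed
  obtain W where W: "W \<in> lmeasurable" "measure lebesgue W \<le> 20 * pi * (\<Sum>n. (cmod (b n))\<^sup>2) / \<eta>\<^sup>2"
    "\<And>t r. t \<in> {0<..<2*pi} \<Longrightarrow> 0 \<le> r \<Longrightarrow> r < 1 \<Longrightarrow> cmod (g (of_real r * cis t)) > \<eta> \<Longrightarrow> t \<in> W"
    using radial_maximal_estimate[OF g b \<eta>] by metis
  have "?B \<subseteq> W"
  proof
    fix t assume t: "t \<in> ?B"
    show "t \<in> W"
    proof (rule ccontr)
      assume "t \<notin> W"
      then have gle: "cmod (g (of_real r * cis t)) \<le> \<eta>" if "0 \<le> r" "r < 1" for r
        using W(3)[of t r] t that by force
      have "isCont (\<lambda>r. p (of_real r * cis t)) (1 :: real)" unfolding p_def by (intro continuous_intros)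
      then obtain d where d: "d > 0" "\<And>r. dist r 1 < d \<Longrightarrow> dist (p (of_real r * cis t)) (p (of_real 1 * cis t)) < \<eta> / 2"
        using \<eta> unfolding continuous_at_eps_delta by (metis half_gt_zero)
      have "1 - d < 1" using d(1) by simp
      then obtain r s where rs: "0 \<le> r" "1 - d < r" "r < 1" "0 \<le> s" "1 - d < s" "s < 1"
        "cmod (f (of_real r * cis t) - f (of_real s * cis t)) \<ge> \<epsilon>"
        using t by blast
      let ?r = "of_real r * cis t" and ?s = "of_real s * cis t" and ?o = "of_real 1 * cis t"
      have "cmod (p ?r - p ?o) < \<eta> / 2" "cmod (p ?s - p ?o) < \<eta> / 2"
        using d(2)[of r] d(2)[of s] rs by (auto simp: dist_norm)
      moreover have "f ?r - f ?s = (g ?r - g ?s) + ((p ?r - p ?o) - (p ?s - p ?o))" by (simp add: g_def)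
      then have "cmod (f ?r - f ?s) \<le> (cmod (g ?r) + cmod (g ?s)) + (cmod (p ?r - p ?o) + cmod (p ?s - p ?o))"
        by (metis norm_triangle_mono norm_triangle_ineq4)
      ultimately have "cmod (f ?r - f ?s) < 3 * \<eta>" using gle[of r] gle[of s] rs by linarith
      then show False using rs(7) by (simp add: \<eta>_def)
    qed
  qed
  then show "\<exists>T. ?B \<subseteq> T \<and> T \<in> lmeasurable \<and> measure lebesgue T \<le> e"
    using W(1,2) small by (meson order_trans)
qed

theorem fatou_radial_limits:
  assumes f: "\<And>z. cmod z < 1 \<Longrightarrow> (\<lambda>n. a n * z ^ n) sums f z"
    and a: "summable (\<lambda>n. (cmod (a n))\<^sup>2)"
  shows "AE t in lebesgue_on {0..2*pi}. \<exists>b. ((\<lambda>r. f (of_real r * cis t)) \<longlongrightarrow> b) (at_left 1)"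
proof -
  define B where "B \<epsilon> = {t \<in> {0<..<2*pi}. \<forall>\<delta><1. \<exists>r s. 0 \<le> r \<and> \<delta> < r \<and> r < 1 \<and> 0 \<le> s \<and> \<delta> < s \<and> s < 1 \<and>
    cmod (f (of_real r * cis t) - f (of_real s * cis t)) \<ge> \<epsilon>}" for \<epsilon> :: real
  have "negligible (B (inverse (real (Suc k))))" for k
    unfolding B_def by (rule radial_oscillation_negligible[OF f a]) simp_all
  then have N: "negligible ((\<Union>k. B (inverse (real (Suc k)))) \<union> {0, 2*pi})"
    by (intro negligible_Un negligible_countable_Union) auto
  show ?thesis
  proof (rule AE_lebesgue_onI[OF N])
    fix t assume t: "t \<in> {0..2*pi}" "t \<notin> (\<Union>k. B (inverse (real (Suc k)))) \<union> {0, 2*pi}"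
    define F where "F r = f (of_real r * cis t)" for r
    have osc: "\<exists>\<delta><1. \<delta> \<ge> 0 \<and> (\<forall>r s. \<delta> < r \<longrightarrow> r < 1 \<longrightarrow> \<delta> < s \<longrightarrow> s < 1 \<longrightarrow> dist (F r) (F s) < e)" if e: "e > 0" for e
    proof -
      obtain k where k: "inverse (real (Suc k)) < e" using reals_Archimedean[OF e] by auto
      have "t \<notin> B (inverse (real (Suc k)))" "t \<in> {0<..<2*pi}" using t by auto
      then obtain \<delta> where \<delta>: "\<delta> < 1" "\<And>r s. 0 \<le> r \<Longrightarrow> \<delta> < r \<Longrightarrow> r < 1 \<Longrightarrow> 0 \<le> s \<Longrightarrow> \<delta> < s \<Longrightarrow> s < 1 \<Longrightarrow>
          \<not> cmod (F r - F s) \<ge> inverse (real (Suc k))"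
        unfolding B_def F_def by blast
      show ?thesis
      proof (intro exI[of _ "max 0 \<delta>"] conjI allI impI)
        fix r s assume "max 0 \<delta> < r" "r < 1" "max 0 \<delta> < s" "s < 1"
        then have "cmod (F r - F s) < inverse (real (Suc k))" using \<delta>(2)[of r s] by simp
        then show "dist (F r) (F s) < e" using k by (simp add: dist_norm)
      qed (use \<delta>(1) in auto)
    qed
    define R where "R j = 1 - inverse (real (Suc j))" for j
    have R1: "R j < 1" for j by (simp add: R_def)
    have "R \<longlonglongrightarrow> 1 - 0" unfolding R_def by (intro tendsto_diff tendsto_const LIMSEQ_inverse_real_of_nat)
    then have Rlim: "eventually (\<lambda>j. R j > \<delta>) sequentially" if "\<delta> < 1" for \<delta>
      using order_tendstoD(1)[of R 1 sequentially \<delta>] that by simp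
    have "Cauchy (\<lambda>j. F (R j))"
    proof (rule metric_CauchyI)
      fix e :: real assume "e > 0"
      then obtain \<delta> where \<delta>: "\<delta> < 1" "\<And>r s. \<delta> < r \<Longrightarrow> r < 1 \<Longrightarrow> \<delta> < s \<Longrightarrow> s < 1 \<Longrightarrow> dist (F r) (F s) < e" using osc by blast
      obtain M where "\<And>j. j \<ge> M \<Longrightarrow> R j > \<delta>" using Rlim[OF \<delta>(1)] unfolding eventually_sequentially by blast
      then show "\<exists>M. \<forall>m\<ge>M. \<forall>n\<ge>M. dist (F (R m)) (F (R n)) < e" using \<delta>(2) R1 by blast
    qed
    then obtain b where b: "(\<lambda>j. F (R j)) \<longlonglongrightarrow> b" using Cauchy_convergent convergent_def by blast
    have "(F \<longlongrightarrow> b) (at_left 1)"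
    proof (rule tendstoI)
      fix e :: real assume "e > 0"
      then obtain \<delta> where \<delta>: "\<delta> < 1" "\<And>r s. \<delta> < r \<Longrightarrow> r < 1 \<Longrightarrow> \<delta> < s \<Longrightarrow> s < 1 \<Longrightarrow> dist (F r) (F s) < e / 2"
        using osc[of "e / 2"] by auto
      have "dist (F r) b < e" if r: "\<delta> < r" "r < 1" for r
      proof -
        have "(\<lambda>j. dist (F r) (F (R j))) \<longlonglongrightarrow> dist (F r) b" by (intro tendsto_intros b)
        moreover have "eventually (\<lambda>j. dist (F r) (F (R j)) \<le> e / 2) sequentially"
          using Rlim[OF \<delta>(1)] by eventually_elim (use \<delta>(2) r R1 in \<open>auto intro: less_imp_le\<close>)
        ultimately have "dist (F r) b \<le> e / 2" by (intro tendsto_upperbound) auto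
        then show ?thesis using \<open>e > 0\<close> by simp
      qed
      then show "\<forall>\<^sub>F r in at_left 1. dist (F r) b < e"
        using \<delta>(1) unfolding eventually_at_left_field by blast
    qed
    then show "\<exists>b. ((\<lambda>r. f (of_real r * cis t)) \<longlongrightarrow> b) (at_left 1)" unfolding F_def by blast
  qed simp
qed

text \<open>By Parseval the integrals of \<open>1 - |f|\<^sup>2\<close> over circles tend to zero, and these functions are
  nonnegative.  By Fatou's lemma their limit inferior vanishes almost everywhere, and it equals \<open>1 - |b|\<^sup>2\<close>
  wherever the radial limit \<open>b\<close> exists.\<close>

lemma inner_functionI:
  assumes f: "\<And>z. cmod z < 1 \<Longrightarrow> (\<lambda>n. a n * z ^ n) sums f z"
    and a: "(\<lambda>n. (cmod (a n))\<^sup>2) sums 1" and le: "\<And>z. cmod z < 1 \<Longrightarrow> cmod (f z) \<le> 1"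
  shows "inner_function f"
proof -
  note hol = powser_holomorphic[OF f]
  have as: "summable (\<lambda>n. (cmod (a n))\<^sup>2)" "(\<Sum>n. (cmod (a n))\<^sup>2) = 1" using a by (auto simp: sums_iff)
  define R where "R j = 1 - inverse (real (Suc j))" for j
  have R: "0 \<le> R j" "R j < 1" for j by (auto simp: R_def field_simps)
  have R1: "R \<longlonglongrightarrow> 1"
    using tendsto_diff[OF tendsto_const LIMSEQ_inverse_real_of_nat, of 1] by (simp add: R_def[abs_def])
  define S where "S j = (\<Sum>n. (cmod (a n * of_real (R j) ^ n))\<^sup>2)" for j
  have "(\<lambda>j. S j) \<longlonglongrightarrow> (\<Sum>n. (cmod (a n * of_real 1 ^ n))\<^sup>2)"
  proof -
    have "(\<lambda>j. (cmod (a n * of_real (R j) ^ n))\<^sup>2) \<longlonglongrightarrow> (cmod (a n * of_real 1 ^ n))\<^sup>2" for n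
      by (intro tendsto_intros R1)
    moreover have "norm ((cmod (a n * of_real (R j) ^ n))\<^sup>2) \<le> (cmod (a n))\<^sup>2" for n j
    proof -
      have "(cmod (a n * of_real (R j) ^ n))\<^sup>2 \<le> (cmod (a n))\<^sup>2"
        using R[of j] by (intro power_mono) (auto simp: norm_mult norm_power intro!: mult_right_le_one_le power_le_one)
      then show ?thesis by simp
    qed
    ultimately show ?thesis
      unfolding S_def using tannerys_theorem[of "\<lambda>n j. (cmod (a n * of_real (R j) ^ n))\<^sup>2" _ sequentially "\<lambda>n. (cmod (a n))\<^sup>2"] as(1)
      by (simp add: always_eventually)
  qed
  then have S: "S \<longlonglongrightarrow> 1" using as(2) by simp
  define M where "M = lebesgue_on {0..2*pi}"
  define q where "q j t = 1 - (cmod (f (of_real (R j) * cis t)))\<^sup>2" for j t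
  have q0: "q j t \<ge> 0" for j t
    using le[of "of_real (R j) * cis t"] R[of j] by (simp add: q_def norm_mult abs_square_le_1)
  have cont: "continuous_on {0..2*pi} (q j)" for j
    unfolding q_def
    by (intro continuous_intros continuous_on_compose2[OF holomorphic_on_imp_continuous_on[OF hol]])
       (use R[of j] in \<open>auto intro!: continuous_intros simp: norm_mult\<close>)
  have int: "integrable M (q j)" for j unfolding M_def by (rule continuous_imp_integrable_real[OF cont])
  have nn: "(\<integral>\<^sup>+t. ennreal (q j t) \<partial>M) = ennreal (2 * pi * (1 - S j))" for j
  proof -
    have "(q j has_integral (1 * (2 * pi) - 2 * pi * S j)) {0..2*pi}"
      unfolding q_def S_def using has_integral_const_real[of "1::real" 0 "2*pi"]
      by (intro has_integral_diff parseval(2)[OF f R]) auto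
    then have "integral\<^sup>L M (q j) = 2 * pi * (1 - S j)"
      using lebesgue_integral_eq_integral[of "{0..2*pi}" "q j"] int[of j] unfolding M_def
      by (simp add: integral_unique right_diff_distrib)
    then show ?thesis using nn_integral_eq_integral[OF int[of j]] q0 by simp
  qed
  have meas: "(\<lambda>t. ennreal (q j t)) \<in> borel_measurable M" for j
    using int[of j] by (intro measurable_compose[OF _ measurable_ennreal]) auto
  have "(\<integral>\<^sup>+t. liminf (\<lambda>j. ennreal (q j t)) \<partial>M) \<le> liminf (\<lambda>j. \<integral>\<^sup>+t. ennreal (q j t) \<partial>M)"
    by (rule nn_integral_liminf[OF meas])
  also have "\<dots> = 0"
  proof -
    have "(\<lambda>j. ennreal (2 * pi * (1 - S j))) \<longlonglongrightarrow> ennreal (2 * pi * (1 - 1))"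
      by (intro tendsto_ennrealI tendsto_intros S)
    then show ?thesis unfolding nn using lim_imp_Liminf[of sequentially] by fastforce
  qed
  finally have "(\<integral>\<^sup>+t. liminf (\<lambda>j. ennreal (q j t)) \<partial>M) = 0" by simp
  then have ae0: "AE t in M. liminf (\<lambda>j. ennreal (q j t)) = 0"
    by (subst (asm) nn_integral_0_iff_AE) (auto intro: borel_measurable_liminf meas)
  have "AE t in M. \<exists>b. ((\<lambda>r. f (of_real r * cis t)) \<longlongrightarrow> b) (at_left 1)"
    unfolding M_def by (rule fatou_radial_limits[OF f as(1)])
  then have "AE t in M. \<exists>b. ((\<lambda>r. f (of_real r * cis t)) \<longlongrightarrow> b) (at_left 1) \<and> cmod b = 1"
    using ae0
  proof eventually_elim
    case (elim t)
    then obtain b where b: "((\<lambda>r. f (of_real r * cis t)) \<longlongrightarrow> b) (at_left 1)" by blast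
    have "filterlim R (at_left 1) sequentially"
      using R1 R(2) by (intro tendsto_imp_filterlim_at_left) (auto intro: always_eventually)
    from filterlim_compose[OF b this] have lb: "(\<lambda>j. f (of_real (R j) * cis t)) \<longlonglongrightarrow> b" .
    then have "(\<lambda>j. ennreal (q j t)) \<longlonglongrightarrow> ennreal (1 - (cmod b)\<^sup>2)"
      unfolding q_def by (intro tendsto_ennrealI tendsto_intros)
    then have "ennreal (1 - (cmod b)\<^sup>2) = 0" using elim lim_imp_Liminf[of sequentially] by fastforce
    then have "(cmod b)\<^sup>2 \<ge> 1" by (simp add: ennreal_eq_0_iff)
    moreover have "(\<lambda>j. q j t) \<longlonglongrightarrow> 1 - (cmod b)\<^sup>2" using lb unfolding q_def by (intro tendsto_intros)
    then have "1 - (cmod b)\<^sup>2 \<ge> 0" using q0 by (intro LIMSEQ_le_const) auto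
    ultimately have "(cmod b)\<^sup>2 = 1\<^sup>2" by simp
    then have "cmod b = 1" by (rule power2_eq_imp_eq) auto
    with b show ?case by blast
  qed
  moreover have "bounded (f ` ball 0 1)" using le by (auto simp: bounded_iff intro!: exI[of _ 1])
  ultimately show ?thesis using hol unfolding inner_function_def M_def by blast
qed

lemma inner_function_nonzero:
  assumes "inner_function \<Theta>"
  obtains z where "cmod z < 1" "\<Theta> z \<noteq> 0"
proof -
  have "\<exists>t. \<exists>b. ((\<lambda>r. \<Theta> (of_real r * cis t)) \<longlongrightarrow> b) (at_left 1) \<and> cmod b = 1"
  proof (rule ccontr)
    assume "\<not> ?thesis"
    then have "AE t in lebesgue_on {0..2*pi}. False"
      using assms unfolding inner_function_def by auto
    then have "emeasure (lebesgue_on {0..2*pi}) (space (lebesgue_on {0..2*pi})) = 0"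
      by (simp only: ae_filter_eq_bot_iff[symmetric] eventually_False)
    then show False by (simp add: emeasure_restrict_space space_restrict_space)
  qed
  then obtain t b where b: "((\<lambda>r. \<Theta> (of_real r * cis t)) \<longlongrightarrow> b) (at_left 1)" "cmod b = 1" by blast
  have "\<exists>r. 0 \<le> r \<and> r < 1 \<and> \<Theta> (of_real r * cis t) \<noteq> 0"
  proof (rule ccontr)
    assume none: "\<not> ?thesis"
    have "\<forall>\<^sub>F r in at_left 1. \<Theta> (of_real r * cis t) = 0"
      unfolding eventually_at_left_field using none by (intro exI[of _ 0]) auto
    then have "((\<lambda>r. \<Theta> (of_real r * cis t)) \<longlongrightarrow> 0) (at_left 1)" by (rule tendsto_eventually)
    then have "b = 0" using b(1) tendsto_unique trivial_limit_at_left_real by blast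
    then show False using b(2) by simp
  qed
  then obtain r where "0 \<le> r" "r < 1" "\<Theta> (of_real r * cis t) \<noteq> 0" by blast
  then show thesis by (intro that[of "of_real r * cis t"]) (auto simp: norm_mult)
qed

section \<open>Rank one and one variable inner functions\<close>

lemma one_variable_coefficients:
  assumes \<xi>: "inner_vector \<xi>" and d: "d \<in> {ez, ew}" "coshift d \<xi> = 0"
  obtains j where "inj j" "\<And>k. k \<notin> range j \<Longrightarrow> coef \<xi> k = 0"
    "\<And>n z. cmod z < 1 \<Longrightarrow> cnj (coef (szego (if d = ew then (z, 0) else (0, z))) (j n)) = z ^ n"
proof -
  define e where "e = (if d = ew then ez else ew)"
  define j where "j n = axis_multiple n e" for n
  have "inj j" by (auto simp: inj_on_def j_def e_def axis_multiple_def)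
  moreover have "coef \<xi> k = 0" if "k \<notin> range j" for k
    by (rule coef_zero_off_axis[OF _ d(2)]) (use d(1) that in \<open>auto simp: e_def j_def[abs_def]\<close>)
  moreover have "cnj (coef (szego (if d = ew then (z, 0) else (0, z))) (j n)) = z ^ n" if "cmod z < 1" for n z
    using that by (simp add: j_def e_def axis_multiple_def coef_szego bidisc_iff)
  ultimately show thesis using that by blast
qed

lemma inner_function_of_inner_vector:
  assumes \<xi>: "inner_vector \<xi>" and d: "d \<in> {ez, ew}" "coshift d \<xi> = 0"
  shows "inner_function (\<lambda>z. hfun \<xi> (if d = ew then (z, 0) else (0, z)))"
proof -
  obtain j where j: "inj j" "\<And>k. k \<notin> range j \<Longrightarrow> coef \<xi> k = 0"
    and jk: "\<And>n z. cmod z < 1 \<Longrightarrow> cnj (coef (szego (if d = ew then (z, 0) else (0, z))) (j n)) = z ^ n"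
    by (rule one_variable_coefficients[OF \<xi> d]) (rule that)
  show ?thesis
  proof (rule inner_functionI[where a = "\<lambda>n. coef \<xi> (j n)"])
    fix z :: complex assume z: "cmod z < 1"
    define p where "p = (if d = ew then (z, 0) else (0, z))"
    have p: "p \<in> bidisc" using z by (auto simp: p_def bidisc_iff)
    have "((\<lambda>i. coef \<xi> i * cnj (coef (szego p) i)) has_sum hfun \<xi> p) UNIV"
      using has_sum_infsum[OF summable_cinner[of \<xi> "szego p"]] p by (simp add: hfun_def cinner_eq_infsum)
    then have "((\<lambda>i. coef \<xi> i * cnj (coef (szego p) i)) has_sum hfun \<xi> p) (range j)"
      by (rule has_sum_cong_neutral[THEN iffD1, rotated -1]) (use j(2) in auto)
    then have "((\<lambda>n. coef \<xi> (j n) * cnj (coef (szego p) (j n))) has_sum hfun \<xi> p) UNIV"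
      by (subst (asm) has_sum_reindex[OF j(1)]) (simp add: o_def)
    then have "((\<lambda>n. coef \<xi> (j n) * z ^ n) has_sum hfun \<xi> p) UNIV"
      using jk[OF z] by (simp only: p_def)
    then show "(\<lambda>n. coef \<xi> (j n) * z ^ n) sums hfun \<xi> (if d = ew then (z, 0) else (0, z))"
      unfolding p_def by (rule has_sum_imp_sums)
    show "cmod (hfun \<xi> (if d = ew then (z, 0) else (0, z))) \<le> 1"
      by (rule cmod_hfun_inner_le[OF \<xi>])
  next
    have n1: "(norm \<xi>)\<^sup>2 = 1"
      using inner_vectorD[OF \<xi>, of 0 0] cinner_self_norm[of \<xi>] by (metis shift_0 of_real_eq_1_iff)
    have "((\<lambda>i. (cmod (coef \<xi> i))\<^sup>2) has_sum 1) UNIV"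
      using has_sum_infsum[OF square_summable_coef[of \<xi>]] by (simp only: norm_ell2_sum[symmetric] n1)
    then have "((\<lambda>i. (cmod (coef \<xi> i))\<^sup>2) has_sum 1) (range j)"
      by (rule has_sum_cong_neutral[THEN iffD1, rotated -1]) (use j(2) in auto)
    then have "((\<lambda>n. (cmod (coef \<xi> (j n)))\<^sup>2) has_sum 1) UNIV"
      by (subst (asm) has_sum_reindex[OF j(1)]) (simp add: o_def)
    then show "(\<lambda>n. (cmod (coef \<xi> (j n)))\<^sup>2) sums 1" by (rule has_sum_imp_sums)
  qed
qed

theorem corollary2p2:
  fixes S :: "(complex \<times> complex \<Rightarrow> complex) set"
  assumes "co_doubly_commuting S"
  shows "submodule_rank S = 1 \<longleftrightarrow>
    (\<exists>\<Theta>. inner_function \<Theta> \<and>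
      (S = {\<lambda>(z, w). \<Theta> z * f (z, w) | f. f \<in> hardy2} \<or>
       S = {\<lambda>(z, w). \<Theta> w * f (z, w) | f. f \<in> hardy2}))"
proof
  have sub: "submodule S" "S \<subseteq> hardy2"
    using assms by (auto simp: co_doubly_commuting_def submodule_def closed_subspace_def)
  {
    assume "submodule_rank S = 1"
    then obtain f where f: "coeff_space S \<noteq> {0}" "f \<in> coeff_space S" "coeff_space S \<subseteq> closure (cvs.span (range (\<lambda>k. shift k f)))"
      unfolding rank_one_iff[OF sub(1)] by blast
    obtain \<xi> d where \<xi>: "inner_vector \<xi>" "d \<in> {ez, ew}" "coshift d \<xi> = 0" "coeff_space S = range (multiplier \<xi>)"
      by (rule cyclic_structure[OF shift_invariant_coeff_space[OF sub(1)] f(1)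
            cross_condition_of_doubly_commuting[OF assms] f(2,3)]) (rule that)
    define \<Theta> where "\<Theta> z = hfun \<xi> (if d = ew then (z, 0) else (0, z))" for z
    have \<Theta>: "inner_function \<Theta>" unfolding \<Theta>_def by (rule inner_function_of_inner_vector[OF \<xi>(1-3)])
    have multiplier_eq: "hfun (multiplier \<xi> x) p = \<Theta> (if d = ew then fst p else snd p) * hfun x p" for x p
    proof (cases "p \<in> bidisc")
      case True
      have "hfun \<xi> p = \<Theta> (if d = ew then fst p else snd p)"
        using hfun_coord_slice[OF True \<xi>(2,3)] by (simp add: \<Theta>_def coord_slice_def)
      then show ?thesis by (simp add: hfun_multiplier[OF \<xi>(1)])
    qed (simp add: hfun_def)
    have S: "S = {\<lambda>p. \<Theta> (if d = ew then fst p else snd p) * f p | f. f \<in> hardy2}" (is "S = ?R")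
    proof -
      have "S = hfun ` range (multiplier \<xi>)" using hfun_coeff_space[OF sub(2)] \<xi>(4) by simp
      also have "\<dots> = range (\<lambda>x p. \<Theta> (if d = ew then fst p else snd p) * hfun x p)"
        unfolding image_image by (simp only: multiplier_eq[abs_def])
      also have "\<dots> = ?R" unfolding hardy2_eq_range_hfun by blast
      finally show ?thesis .
    qed
    show "\<exists>\<Theta>. inner_function \<Theta> \<and>
      (S = {\<lambda>(z, w). \<Theta> z * f (z, w) | f. f \<in> hardy2} \<or>
       S = {\<lambda>(z, w). \<Theta> w * f (z, w) | f. f \<in> hardy2})"
    proof (intro exI conjI)
      show "S = {\<lambda>(z, w). \<Theta> z * f (z, w) | f. f \<in> hardy2} \<or>
        S = {\<lambda>(z, w). \<Theta> w * f (z, w) | f. f \<in> hardy2}"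
        using S by (cases "d = ew") (simp_all add: case_prod_unfold)
    qed (rule \<Theta>)
  }
  assume "\<exists>\<Theta>. inner_function \<Theta> \<and>
      (S = {\<lambda>(z, w). \<Theta> z * f (z, w) | f. f \<in> hardy2} \<or>
       S = {\<lambda>(z, w). \<Theta> w * f (z, w) | f. f \<in> hardy2})"
  then obtain \<Theta> where \<Theta>: "inner_function \<Theta>"
    and S: "S = {\<lambda>p. \<Theta> (fst p) * f p | f. f \<in> hardy2} \<or> S = {\<lambda>p. \<Theta> (snd p) * f p | f. f \<in> hardy2}"
    by (auto simp: case_prod_unfold)
  obtain z where z: "cmod z < 1" "\<Theta> z \<noteq> 0" by (rule inner_function_nonzero[OF \<Theta>])
  from S have "coeff_space S \<noteq> {0} \<and> (\<exists>f\<in>coeff_space S. coeff_space S \<subseteq> closure (cvs.span (range (\<lambda>k. shift k f))))"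
  proof
    assume S: "S = {\<lambda>p. \<Theta> (fst p) * f p | f. f \<in> hardy2}"
    show ?thesis
      using multiplier_submodule[OF sub(1), of ew "\<lambda>p. \<Theta> (fst p)" "(z, 0)"] S z
      by (simp add: coord_slice_def bidisc_iff)
  next
    assume S: "S = {\<lambda>p. \<Theta> (snd p) * f p | f. f \<in> hardy2}"
    show ?thesis
      using multiplier_submodule[OF sub(1), of ez "\<lambda>p. \<Theta> (snd p)" "(0, z)"] S z
      by (simp add: coord_slice_def bidisc_iff)
  qed
  then show "submodule_rank S = 1" unfolding rank_one_iff[OF sub(1)] .
qed

end
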